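(* Assume $T$ is NIP and the partial type $\pi(\bar x;\bar y)$ over $\emptyset$ is group-like over $M$. Define $$\Phi:E(\mathfrak M_{\bar x}(M),\mathrm{conv}(G_{\pi,M}))\to \mathfrak M^{\mathrm{sfs}}_{\pi(\bar m;\bar y)}(\mathfrak C,M),\qquad \Phi(\eta)(\varphi(\bar n;\bar y)):=\big(\eta(\delta_{\mathrm{tp}(\bar n/M)})\big)(\varphi(\bar x;\bar m))$$ for every $\bar n\in\mathfrak C^{\bar x}$ and $\mathcal L$-formula $\varphi(\bar x;\bar y)$, and $$\Psi:\mathfrak M^{\mathrm{sfs}}_{\pi(\bar m;\bar y)}(\mathfrak C,M)\to E(\mathfrak M_{\bar x}(M),\mathrm{conv}(G_{\pi,M})),\qquad \Psi(\mu)(\nu)(\varphi(\bar x;\bar m)):=(\mu_{\bar y}\otimes\nu_{\bar x})(\varphi(\bar x;\bar y))$$ for $\nu\in\mathfrak M_{\bar x}(M)$. Then $\Phi$ and $\Psi$ are well-defined, $\Phi\circ\Psi=\mathrm{id}$, $\Psi\circ\Phi=\mathrm{id}$, and both $\Phi$ and $\Psi$ are homeomorphisms.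
   Context: $T$ is a complete first-order theory in language $\mathcal L$, $\mathfrak C$ a monster model (highly saturated and strongly homogeneous), $M\preceq\mathfrak C$ a small model with enumeration $\bar m=(m_\alpha)_{\alpha}$, and $\bar x,\bar y$ tuples of variables corresponding to $\bar m$. For a partial type $\pi(\bar x;\bar y)$ over $\emptyset$ let $G_{\pi,M}=\{\sigma\in\mathrm{Aut}(M): M\models\pi(\sigma(\bar m);\bar m)\}$. $\pi$ is group-like over $M$ if (i) $\pi(\bar x;\bar y)\vdash \bar x\equiv_\emptyset\bar y$; (ii) $G_{\pi,M}$ is a subgroup of $\mathrm{Aut}(M)$; (iii) for every $\bar a\in M^{\bar y}$ with $\models\pi(\bar m;\bar a)$ and every finite subtuple $(a_{\alpha_1},\dots,a_{\alpha_k})$ of $\bar a$ there is $\sigma\in G_{\pi,M}$ with $\sigma(m_{\alpha_i})=a_{\alpha_i}$ for $i\le k$. $\mathfrak M_{\bar x}(M)$ is the space of Keisler measures over $M$ (identified with regular Borel probability measures on the type space $S_{\bar x}(M)$), with the weak topology given by the values on formulas. $\mathrm{conv}(G_{\pi,M})$ is the set of finite convex combinations $\sum_i r_i\delta_{\sigma_i}$, $\sigma_i\in G_{\pi,M}$, acting on $\mathfrak M_{\bar x}(M)$ by $(\sum r_i\delta_{\sigma_i})\cdot\mu=\sum r_i(\sigma_i)_*\mu$ where $((\sigma)_*\mu)(\varphi(\bar x;\bar b))=\mu(\varphi(\bar x;\sigma^{-1}(\bar b)))$. For a compact space $X$ and a semigroup $S$ acting by continuous maps, $E(X,S)$ is the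 closure of the set of maps $x\mapsto s\cdot x$ in $X^X$ (product topology). $\mathfrak M^{\mathrm{sfs}}_{\pi(\bar m;\bar y)}(\mathfrak C,M)$ is the set of global Keisler measures $\mu$ in variables $\bar y$ with $\mu([\pi(\bar m;\bar y)])=1$ such that whenever $\mu(\varphi(\bar y;\bar b))>0$ there is $\bar a\in M^{\bar y}$ with $\models\pi(\bar m;\bar a)\wedge\varphi(\bar a;\bar b)$ (such measures are finitely satisfiable in $M$, hence $M$-invariant, hence Borel-definable over $M$ in NIP). For a global $M$-invariant measure $\mu$ in $\bar y$ and a formula $\varphi(\bar x;\bar y)$, $F^{\varphi}_{\mu}:S_{\bar x}(M)\to[0,1]$ is $q\mapsto\mu(\varphi(\bar b;\bar y))$ with $\bar b\models q$; $\mu$ is Borel-definable over $M$ if all these maps are Borel. For such $\mu$ and $\nu\in\mathfrak M_{\bar x}(M)$, the Morley product is $(\mu_{\bar y}\otimes\nu_{\bar x})(\varphi(\bar x;\bar y)):=\int_{S_{\bar x}(M)}F^{\varphi}_{\mu}\,d\nu$ (for formulas with parameters from $M$). *)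

theory Defs
  imports "HOL-Probability.Probability_Measure" "HOL-Algebra.Bij"
begin

unbundle cardinal_syntax

text \<open>
  Bound variables are de Bruijn indices, hence disjoint from the free variables \<open>Free v\<close>, which can
  be indexed by an arbitrary type. Substituting for free variables is therefore just \<open>map_fm\<close>.
\<close>

datatype (dead 'f, vars_tm: 'v) tm =
    Free 'v
  | Bnd nat
  | Fn 'f "('f, 'v) tm list"
  for map: map_tm

datatype (dead 'f, dead 'r, vars_fm: 'v) fm =
    Eq "('f, 'v) tm" "('f, 'v) tm"
  | Rel 'r "('f, 'v) tm list"
  | Neg "('f, 'r, 'v) fm"
  | Or "('f, 'r, 'v) fm" "('f, 'r, 'v) fm"
  | Ex "('f, 'r, 'v) fm"
  for map: map_fm

text \<open>A language lists its function and relation symbols together with their arities.\<close>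

record ('f, 'r) lang =
  Funs :: "('f \<times> nat) set"
  Rels :: "('r \<times> nat) set"

text \<open>\<open>wf_fm L k \<phi>\<close>: the symbols of \<open>\<phi>\<close> are in \<open>L\<close> and at most the indices below \<open>k\<close> are dangling.\<close>

fun wf_tm :: "('f, 'r) lang \<Rightarrow> nat \<Rightarrow> ('f, 'v) tm \<Rightarrow> bool" where
  "wf_tm L k (Free v) \<longleftrightarrow> True"
| "wf_tm L k (Bnd n) \<longleftrightarrow> n < k"
| "wf_tm L k (Fn f ts) \<longleftrightarrow> (f, length ts) \<in> Funs L \<and> (\<forall>t\<in>set ts. wf_tm L k t)"

fun wf_fm :: "('f, 'r) lang \<Rightarrow> nat \<Rightarrow> ('f, 'r, 'v) fm \<Rightarrow> bool" where
  "wf_fm L k (Eq t u) \<longleftrightarrow> wf_tm L k t \<and> wf_tm L k u"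
| "wf_fm L k (Rel r ts) \<longleftrightarrow> (r, length ts) \<in> Rels L \<and> (\<forall>t\<in>set ts. wf_tm L k t)"
| "wf_fm L k (Neg \<phi>) \<longleftrightarrow> wf_fm L k \<phi>"
| "wf_fm L k (Or \<phi> \<psi>) \<longleftrightarrow> wf_fm L k \<phi> \<and> wf_fm L k \<psi>"
| "wf_fm L k (Ex \<phi>) \<longleftrightarrow> wf_fm L (Suc k) \<phi>"

text \<open>
  The big structure has the whole type \<open>'c\<close> as its universe. Its substructures are given by their
  universes \<open>D\<close>, with the restricted interpretation.
\<close>

record ('f, 'r, 'c) struct =
  fn :: "'f \<Rightarrow> 'c list \<Rightarrow> 'c"
  rl :: "'r \<Rightarrow> 'c list \<Rightarrow> bool"

fun eval_tm :: "('f, 'r, 'c) struct \<Rightarrow> (nat \<Rightarrow> 'c) \<Rightarrow> ('v \<Rightarrow> 'c) \<Rightarrow> ('f, 'v) tm \<Rightarrow> 'c" where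
  "eval_tm C e s (Free v) = s v"
| "eval_tm C e s (Bnd n) = e n"
| "eval_tm C e s (Fn f ts) = fn C f (map (eval_tm C e s) ts)"

fun eval_fm ::
  "('f, 'r, 'c) struct \<Rightarrow> 'c set \<Rightarrow> (nat \<Rightarrow> 'c) \<Rightarrow> ('v \<Rightarrow> 'c) \<Rightarrow> ('f, 'r, 'v) fm \<Rightarrow> bool" where
  "eval_fm C D e s (Eq t u) \<longleftrightarrow> eval_tm C e s t = eval_tm C e s u"
| "eval_fm C D e s (Rel r ts) \<longleftrightarrow> rl C r (map (eval_tm C e s) ts)"
| "eval_fm C D e s (Neg \<phi>) \<longleftrightarrow> \<not> eval_fm C D e s \<phi>"
| "eval_fm C D e s (Or \<phi> \<psi>) \<longleftrightarrow> eval_fm C D e s \<phi> \<or> eval_fm C D e s \<psi>"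
| "eval_fm C D e s (Ex \<phi>) \<longleftrightarrow> (\<exists>d\<in>D. eval_fm C D (case_nat d e) s \<phi>)"

text \<open>
  Formulas with parameters have free variables of type \<open>'v + 'c\<close>, where \<open>Inl v\<close> is a proper variable
  and \<open>Inr c\<close> is the constant naming the element \<open>c\<close>. \<open>Fm L A\<close> is the set of formulas of \<open>L\<close> with
  parameters from \<open>A\<close>; in particular \<open>Fm L {}\<close> is the set of \<open>L\<close>-formulas.
\<close>

type_synonym ('f, 'r, 'v, 'c) pfm = "('f, 'r, 'v + 'c) fm"

definition Fm :: "('f, 'r) lang \<Rightarrow> 'c set \<Rightarrow> ('f, 'r, 'v, 'c) pfm set" where
  "Fm L A = {\<phi>. wf_fm L 0 \<phi> \<and> vars_fm \<phi> \<subseteq> range Inl \<union> Inr ` A}"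

definition sat :: "('f, 'r, 'c) struct \<Rightarrow> 'c set \<Rightarrow> ('v \<Rightarrow> 'c) \<Rightarrow> ('f, 'r, 'v, 'c) pfm \<Rightarrow> bool" where
  "sat C D s \<phi> \<longleftrightarrow> eval_fm C D (\<lambda>_. undefined) (case_sum s id) \<phi>"

definition sentences :: "('f, 'r) lang \<Rightarrow> ('f, 'r, nat, 'c) pfm set" where
  "sentences L = {\<phi> \<in> Fm L {}. vars_fm \<phi> = {}}"

text \<open>Consistency of a complete theory will be given by its having a model.\<close>

definition complete_theory :: "('f, 'r) lang \<Rightarrow> ('f, 'r, nat, 'c) pfm set \<Rightarrow> bool" where
  "complete_theory L T \<longleftrightarrow>
     T \<subseteq> sentences L \<and> (\<forall>\<phi>\<in>sentences L. \<phi> \<in> T \<or> Neg \<phi> \<in> T)"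

definition models :: "('f, 'r, 'c) struct \<Rightarrow> ('f, 'r, nat, 'c) pfm set \<Rightarrow> bool" where
  "models C T \<longleftrightarrow> (\<forall>\<phi>\<in>T. sat C UNIV (\<lambda>_. undefined) \<phi>)"

definition elementary_substructure :: "('f, 'r) lang \<Rightarrow> ('f, 'r, 'c) struct \<Rightarrow> 'c set \<Rightarrow> bool" where
  "elementary_substructure L C M \<longleftrightarrow>
     M \<noteq> {} \<and>
     (\<forall>(f, n)\<in>Funs L. \<forall>xs\<in>lists M. length xs = n \<longrightarrow> fn C f xs \<in> M) \<and>
     (\<forall>\<phi>\<in>Fm L {}. \<forall>s :: nat \<Rightarrow> 'c. range s \<subseteq> M \<longrightarrow> sat C M s \<phi> = sat C UNIV s \<phi>)"

definition Aut :: "('f, 'r) lang \<Rightarrow> ('f, 'r, 'c) struct \<Rightarrow> 'c set \<Rightarrow> ('c \<Rightarrow> 'c) set" where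
  "Aut L C D = {\<sigma> \<in> Bij D.
     (\<forall>(f, n)\<in>Funs L. \<forall>xs\<in>lists D. length xs = n \<longrightarrow> \<sigma> (fn C f xs) = fn C f (map \<sigma> xs)) \<and>
     (\<forall>(r, n)\<in>Rels L. \<forall>xs\<in>lists D. length xs = n \<longrightarrow> rl C r xs = rl C r (map \<sigma> xs))}"

definition Aut_group :: "('f, 'r) lang \<Rightarrow> ('f, 'r, 'c) struct \<Rightarrow> 'c set \<Rightarrow> ('c \<Rightarrow> 'c) monoid" where
  "Aut_group L C D = BijGroup D \<lparr>carrier := Aut L C D\<rparr>"

definition tp :: "('f, 'r) lang \<Rightarrow> ('f, 'r, 'c) struct \<Rightarrow> 'c set \<Rightarrow> ('v \<Rightarrow> 'c) \<Rightarrow> ('f, 'r, 'v, 'c) pfm set"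
  where "tp L C A a = {\<phi> \<in> Fm L A. sat C UNIV a \<phi>}"

definition complete_types ::
  "('f, 'r) lang \<Rightarrow> ('f, 'r, 'c) struct \<Rightarrow> 'c set \<Rightarrow> ('f, 'r, 'v, 'c) pfm set set" where
  "complete_types L C A = {p. p \<subseteq> Fm L A \<and>
     (\<forall>F\<subseteq>p. finite F \<longrightarrow> (\<exists>s. \<forall>\<phi>\<in>F. sat C UNIV s \<phi>)) \<and>
     (\<forall>\<phi>\<in>Fm L A. \<phi> \<in> p \<or> Neg \<phi> \<in> p)}"

definition type_space ::
  "('f, 'r) lang \<Rightarrow> ('f, 'r, 'c) struct \<Rightarrow> 'c set \<Rightarrow> ('f, 'r, 'v, 'c) pfm set topology" where
  "type_space L C A =
     topology_generated_by ((\<lambda>\<phi>. {p \<in> complete_types L C A. \<phi> \<in> p}) ` Fm L A)"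

text \<open>Types in one variable are types in variables indexed by \<open>unit\<close>.\<close>

definition saturated :: "('f, 'r) lang \<Rightarrow> ('f, 'r, 'c) struct \<Rightarrow> 'k rel \<Rightarrow> bool" where
  "saturated L C \<kappa> \<longleftrightarrow>
     (\<forall>A. |A| <o \<kappa> \<longrightarrow> (\<forall>p\<in>complete_types L C A. \<exists>s :: unit \<Rightarrow> 'c. \<forall>\<phi>\<in>p. sat C UNIV s \<phi>))"

definition partial_elementary ::
  "('f, 'r) lang \<Rightarrow> ('f, 'r, 'c) struct \<Rightarrow> 'c set \<Rightarrow> ('c \<Rightarrow> 'c) \<Rightarrow> bool" where
  "partial_elementary L C A f \<longleftrightarrow>
     (\<forall>\<phi>\<in>Fm L {}. \<forall>s :: nat \<Rightarrow> 'c. range s \<subseteq> A \<longrightarrow> sat C UNIV s \<phi> = sat C UNIV (f \<circ> s) \<phi>)"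

definition strongly_homogeneous :: "('f, 'r) lang \<Rightarrow> ('f, 'r, 'c) struct \<Rightarrow> 'k rel \<Rightarrow> bool" where
  "strongly_homogeneous L C \<kappa> \<longleftrightarrow>
     (\<forall>A f. |A| <o \<kappa> \<and> partial_elementary L C A f \<longrightarrow> (\<exists>\<sigma>\<in>Aut L C UNIV. \<forall>a\<in>A. \<sigma> a = f a))"

text \<open>\<open>\<kappa>\<close> is the degree of saturation; a set \<open>A\<close> is small if \<open>|A| <o \<kappa>\<close>.\<close>

definition monster :: "('f, 'r) lang \<Rightarrow> ('f, 'r, 'c) struct \<Rightarrow> 'k rel \<Rightarrow> bool" where
  "monster L C \<kappa> \<longleftrightarrow>
     Card_order \<kappa> \<and> natLeq <o \<kappa> \<and> |Funs L| <o \<kappa> \<and> |Rels L| <o \<kappa> \<and>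
     saturated L C \<kappa> \<and> strongly_homogeneous L C \<kappa>"

text \<open>
  A formula \<open>\<phi>(x;y)\<close> with its (finitely many) variables split into \<open>x\<close> and \<open>y\<close> has the independence
  property if there are \<open>a\<^sub>i\<close> and \<open>b\<^sub>I\<close> with \<open>\<phi>(a\<^sub>i;b\<^sub>I) \<longleftrightarrow> i \<in> I\<close>. It suffices to look for these in
  the monster model.
\<close>

definition NIP :: "('f, 'r) lang \<Rightarrow> ('f, 'r, 'c) struct \<Rightarrow> bool" where
  "NIP L C \<longleftrightarrow>
     (\<forall>\<phi>\<in>Fm L {}. \<not> (\<exists>(a :: nat \<Rightarrow> nat \<Rightarrow> 'c) (b :: nat set \<Rightarrow> nat \<Rightarrow> 'c).
        \<forall>i I. sat C UNIV (case_sum (a i) (b I)) \<phi> \<longleftrightarrow> i \<in> I))"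

text \<open>
  The tuples \<open>x\<close> and \<open>y\<close> are both indexed by \<open>'i\<close>: in a formula \<open>\<phi>(x;y)\<close> the variable \<open>x\<^sub>i\<close> is
  \<open>Inl (Inl i)\<close> and \<open>y\<^sub>i\<close> is \<open>Inl (Inr i)\<close>. The next two functions give \<open>\<phi>(n;y)\<close> and \<open>\<phi>(x;n)\<close>.
\<close>

definition inst_x :: "('i \<Rightarrow> 'c) \<Rightarrow> ('f, 'r, 'i + 'i, 'c) pfm \<Rightarrow> ('f, 'r, 'i, 'c) pfm" where
  "inst_x n = map_fm (case_sum (case_sum (Inr \<circ> n) Inl) Inr)"

definition inst_y :: "('i \<Rightarrow> 'c) \<Rightarrow> ('f, 'r, 'i + 'i, 'c) pfm \<Rightarrow> ('f, 'r, 'i, 'c) pfm" where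
  "inst_y n = map_fm (case_sum (case_sum Inl (Inr \<circ> n)) Inr)"

definition realizes ::
  "('f, 'r, 'c) struct \<Rightarrow> 'c set \<Rightarrow> ('f, 'r, 'i + 'i, 'c) pfm set \<Rightarrow> ('i \<Rightarrow> 'c) \<Rightarrow> ('i \<Rightarrow> 'c) \<Rightarrow> bool" where
  "realizes C D \<pi> a b \<longleftrightarrow> (\<forall>\<phi>\<in>\<pi>. sat C D (case_sum a b) \<phi>)"

definition G_pi ::
  "('f, 'r) lang \<Rightarrow> ('f, 'r, 'c) struct \<Rightarrow> 'c set \<Rightarrow> ('i \<Rightarrow> 'c) \<Rightarrow> ('f, 'r, 'i + 'i, 'c) pfm set
   \<Rightarrow> ('c \<Rightarrow> 'c) set" where
  "G_pi L C M m \<pi> = {\<sigma> \<in> Aut L C M. realizes C M \<pi> (\<sigma> \<circ> m) m}"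

definition group_like ::
  "('f, 'r) lang \<Rightarrow> ('f, 'r, 'c) struct \<Rightarrow> 'c set \<Rightarrow> ('i \<Rightarrow> 'c) \<Rightarrow> ('f, 'r, 'i + 'i, 'c) pfm set
   \<Rightarrow> bool" where
  "group_like L C M m \<pi> \<longleftrightarrow>
     (\<forall>a b. realizes C UNIV \<pi> a b \<longrightarrow> tp L C {} a = tp L C {} b) \<and>
     subgroup (G_pi L C M m \<pi>) (Aut_group L C M) \<and>
     (\<forall>a. range a \<subseteq> M \<and> realizes C UNIV \<pi> m a \<longrightarrow>
        (\<forall>F. finite F \<longrightarrow> (\<exists>\<sigma>\<in>G_pi L C M m \<pi>. \<forall>i\<in>F. \<sigma> (m i) = a i)))"

text \<open>
  A Keisler measure over \<open>A\<close> is a finitely additive probability measure on formulas over \<open>A\<close> modulo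
  equivalence. It is a function on formulas, \<open>undefined\<close> outside of \<open>Fm L A\<close>.
\<close>

definition keisler ::
  "('f, 'r) lang \<Rightarrow> ('f, 'r, 'c) struct \<Rightarrow> 'c set \<Rightarrow> (('f, 'r, 'v, 'c) pfm \<Rightarrow> real) set" where
  "keisler L C A = {\<mu> \<in> extensional (Fm L A).
     (\<forall>\<phi>\<in>Fm L A. 0 \<le> \<mu> \<phi>) \<and>
     (\<forall>\<phi>\<in>Fm L A. (\<forall>s. sat C UNIV s \<phi>) \<longrightarrow> \<mu> \<phi> = 1) \<and>
     (\<forall>\<phi>\<in>Fm L A. \<forall>\<psi>\<in>Fm L A. (\<forall>s. sat C UNIV s \<phi> = sat C UNIV s \<psi>) \<longrightarrow> \<mu> \<phi> = \<mu> \<psi>) \<and>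
     (\<forall>\<phi>\<in>Fm L A. \<forall>\<psi>\<in>Fm L A. (\<forall>s. \<not> (sat C UNIV s \<phi> \<and> sat C UNIV s \<psi>)) \<longrightarrow>
        \<mu> (Or \<phi> \<psi>) = \<mu> \<phi> + \<mu> \<psi>)}"

definition keisler_space ::
  "('f, 'r) lang \<Rightarrow> ('f, 'r, 'c) struct \<Rightarrow> 'c set \<Rightarrow> (('f, 'r, 'v, 'c) pfm \<Rightarrow> real) topology" where
  "keisler_space L C A =
     subtopology (product_topology (\<lambda>_. euclideanreal) (Fm L A)) (keisler L C A)"

definition borel_of_top :: "'a topology \<Rightarrow> 'a measure" where
  "borel_of_top X = sigma (topspace X) {U. openin X U}"

definition regular_borel_prob :: "'a topology \<Rightarrow> 'a measure \<Rightarrow> bool" where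
  "regular_borel_prob X N \<longleftrightarrow>
     sets N = sets (borel_of_top X) \<and> prob_space N \<and>
     (\<forall>B\<in>sets N. \<forall>\<epsilon>>0. \<exists>K U. closedin X K \<and> openin X U \<and> K \<subseteq> B \<and> B \<subseteq> U \<and> measure N (U - K) < \<epsilon>)"

text \<open>The regular Borel probability measure on the type space identified with a Keisler measure.\<close>

definition borel_ext ::
  "('f, 'r) lang \<Rightarrow> ('f, 'r, 'c) struct \<Rightarrow> 'c set \<Rightarrow> (('f, 'r, 'v, 'c) pfm \<Rightarrow> real)
   \<Rightarrow> ('f, 'r, 'v, 'c) pfm set measure" where
  "borel_ext L C A \<mu> = (THE N. regular_borel_prob (type_space L C A) N \<and>
     (\<forall>\<phi>\<in>Fm L A. measure N {p \<in> complete_types L C A. \<phi> \<in> p} = \<mu> \<phi>))"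

definition dirac ::
  "('f, 'r) lang \<Rightarrow> 'c set \<Rightarrow> ('f, 'r, 'v, 'c) pfm set \<Rightarrow> ('f, 'r, 'v, 'c) pfm \<Rightarrow> real" where
  "dirac L A p = (\<lambda>\<phi>\<in>Fm L A. if \<phi> \<in> p then 1 else 0)"

definition pushforward ::
  "('f, 'r) lang \<Rightarrow> 'c set \<Rightarrow> ('c \<Rightarrow> 'c) \<Rightarrow> (('f, 'r, 'v, 'c) pfm \<Rightarrow> real)
   \<Rightarrow> ('f, 'r, 'v, 'c) pfm \<Rightarrow> real" where
  "pushforward L M \<sigma> \<mu> = (\<lambda>\<phi>\<in>Fm L M. \<mu> (map_fm (map_sum id (inv_into M \<sigma>)) \<phi>))"

text \<open>The convex combination \<open>\<Sum>\<^sub>i r\<^sub>i \<delta>\<^bsub>\<sigma>\<^sub>i\<^esub>\<close> is encoded by its weight function.\<close>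

definition conv :: "'a set \<Rightarrow> ('a \<Rightarrow> real) set" where
  "conv G = {r. finite {\<sigma>. r \<sigma> \<noteq> 0} \<and> {\<sigma>. r \<sigma> \<noteq> 0} \<subseteq> G \<and> (\<forall>\<sigma>. 0 \<le> r \<sigma>) \<and> (\<Sum>\<sigma> | r \<sigma> \<noteq> 0. r \<sigma>) = 1}"

definition conv_act ::
  "('f, 'r) lang \<Rightarrow> 'c set \<Rightarrow> (('c \<Rightarrow> 'c) \<Rightarrow> real) \<Rightarrow> (('f, 'r, 'v, 'c) pfm \<Rightarrow> real)
   \<Rightarrow> ('f, 'r, 'v, 'c) pfm \<Rightarrow> real" where
  "conv_act L M r \<mu> = (\<lambda>\<phi>\<in>Fm L M. \<Sum>\<sigma> | r \<sigma> \<noteq> 0. r \<sigma> * pushforward L M \<sigma> \<mu> \<phi>)"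

definition ellis :: "'x topology \<Rightarrow> 's set \<Rightarrow> ('s \<Rightarrow> 'x \<Rightarrow> 'x) \<Rightarrow> ('x \<Rightarrow> 'x) set" where
  "ellis X S act =
     product_topology (\<lambda>_. X) (topspace X) closure_of ((\<lambda>s. restrict (act s) (topspace X)) ` S)"

definition ellis_space :: "'x topology \<Rightarrow> 's set \<Rightarrow> ('s \<Rightarrow> 'x \<Rightarrow> 'x) \<Rightarrow> ('x \<Rightarrow> 'x) topology" where
  "ellis_space X S act = subtopology (product_topology (\<lambda>_. X) (topspace X)) (ellis X S act)"

definition E_conv ::
  "('f, 'r) lang \<Rightarrow> ('f, 'r, 'c) struct \<Rightarrow> 'c set \<Rightarrow> ('i \<Rightarrow> 'c) \<Rightarrow> ('f, 'r, 'i + 'i, 'c) pfm set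
   \<Rightarrow> ((('f, 'r, 'i, 'c) pfm \<Rightarrow> real) \<Rightarrow> ('f, 'r, 'i, 'c) pfm \<Rightarrow> real) topology" where
  "E_conv L C M m \<pi> =
     ellis_space (keisler_space L C M) (conv (G_pi L C M m \<pi>)) (conv_act L M)"

definition sfs_measures ::
  "('f, 'r) lang \<Rightarrow> ('f, 'r, 'c) struct \<Rightarrow> 'c set \<Rightarrow> ('i \<Rightarrow> 'c) \<Rightarrow> ('f, 'r, 'i + 'i, 'c) pfm set
   \<Rightarrow> (('f, 'r, 'i, 'c) pfm \<Rightarrow> real) set" where
  "sfs_measures L C M m \<pi> = {\<mu> \<in> keisler L C UNIV.
     measure (borel_ext L C UNIV \<mu>) {p \<in> complete_types L C UNIV. inst_x m ` \<pi> \<subseteq> p} = 1 \<and>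
     (\<forall>\<theta>\<in>Fm L UNIV. \<mu> \<theta> > 0 \<longrightarrow>
        (\<exists>a. range a \<subseteq> M \<and> realizes C UNIV \<pi> m a \<and> sat C UNIV a \<theta>))}"

definition sfs_space ::
  "('f, 'r) lang \<Rightarrow> ('f, 'r, 'c) struct \<Rightarrow> 'c set \<Rightarrow> ('i \<Rightarrow> 'c) \<Rightarrow> ('f, 'r, 'i + 'i, 'c) pfm set
   \<Rightarrow> (('f, 'r, 'i, 'c) pfm \<Rightarrow> real) topology" where
  "sfs_space L C M m \<pi> = subtopology (keisler_space L C UNIV) (sfs_measures L C M m \<pi>)"

definition invariant_measure ::
  "('f, 'r) lang \<Rightarrow> ('f, 'r, 'c) struct \<Rightarrow> 'c set \<Rightarrow> (('f, 'r, 'v, 'c) pfm \<Rightarrow> real) \<Rightarrow> bool" where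
  "invariant_measure L C M \<mu> \<longleftrightarrow>
     (\<forall>\<sigma>\<in>Aut L C UNIV. (\<forall>c\<in>M. \<sigma> c = c) \<longrightarrow>
        (\<forall>\<theta>\<in>Fm L UNIV. \<mu> (map_fm (map_sum id \<sigma>) \<theta>) = \<mu> \<theta>))"

text \<open>
  \<open>F_fun L C M \<mu> \<phi> q = \<mu>(\<phi>(b;y))\<close> for a realization \<open>b\<close> of \<open>q\<close>. For \<open>M\<close>-invariant \<open>\<mu>\<close> the choice of
  \<open>b\<close> is irrelevant.
\<close>

definition F_fun ::
  "('f, 'r) lang \<Rightarrow> ('f, 'r, 'c) struct \<Rightarrow> 'c set \<Rightarrow> (('f, 'r, 'i, 'c) pfm \<Rightarrow> real)
   \<Rightarrow> ('f, 'r, 'i + 'i, 'c) pfm \<Rightarrow> ('f, 'r, 'i, 'c) pfm set \<Rightarrow> real" where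
  "F_fun L C M \<mu> \<phi> q = \<mu> (inst_x (SOME b. tp L C M b = q) \<phi>)"

definition borel_definable ::
  "('f, 'r) lang \<Rightarrow> ('f, 'r, 'c) struct \<Rightarrow> 'c set \<Rightarrow> (('f, 'r, 'i, 'c) pfm \<Rightarrow> real) \<Rightarrow> bool" where
  "borel_definable L C M \<mu> \<longleftrightarrow>
     invariant_measure L C M \<mu> \<and>
     (\<forall>\<phi>\<in>Fm L M. F_fun L C M \<mu> \<phi> \<in> borel_measurable (borel_of_top (type_space L C M)))"

definition morley ::
  "('f, 'r) lang \<Rightarrow> ('f, 'r, 'c) struct \<Rightarrow> 'c set \<Rightarrow> (('f, 'r, 'i, 'c) pfm \<Rightarrow> real)
   \<Rightarrow> (('f, 'r, 'i, 'c) pfm \<Rightarrow> real) \<Rightarrow> ('f, 'r, 'i + 'i, 'c) pfm \<Rightarrow> real" where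
  "morley L C M \<mu> \<nu> \<phi> = (\<integral>q. F_fun L C M \<mu> \<phi> q \<partial>borel_ext L C M \<nu>)"

text \<open>
  Every formula in \<open>y\<close> over the monster model has the form \<open>\<phi>(n;y)\<close>, and every formula in \<open>x\<close> over
  \<open>M\<close> has the form \<open>\<phi>(x;m)\<close>, for some \<open>L\<close>-formula \<open>\<phi>(x;y)\<close>, in general in many ways. So these
  equations have at most one solution; that they do have one is part of well-definedness.
\<close>

definition Phi ::
  "('f, 'r) lang \<Rightarrow> ('f, 'r, 'c) struct \<Rightarrow> 'c set \<Rightarrow> ('i \<Rightarrow> 'c)
   \<Rightarrow> ((('f, 'r, 'i, 'c) pfm \<Rightarrow> real) \<Rightarrow> ('f, 'r, 'i, 'c) pfm \<Rightarrow> real)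
   \<Rightarrow> ('f, 'r, 'i, 'c) pfm \<Rightarrow> real" where
  "Phi L C M m \<eta> = (THE \<mu>. \<mu> \<in> extensional (Fm L UNIV) \<and>
     (\<forall>n. \<forall>\<phi>\<in>Fm L {}. \<mu> (inst_x n \<phi>) = \<eta> (dirac L M (tp L C M n)) (inst_y m \<phi>)))"

definition Psi ::
  "('f, 'r) lang \<Rightarrow> ('f, 'r, 'c) struct \<Rightarrow> 'c set \<Rightarrow> ('i \<Rightarrow> 'c)
   \<Rightarrow> (('f, 'r, 'i, 'c) pfm \<Rightarrow> real)
   \<Rightarrow> (('f, 'r, 'i, 'c) pfm \<Rightarrow> real) \<Rightarrow> ('f, 'r, 'i, 'c) pfm \<Rightarrow> real" where
  "Psi L C M m \<mu> = (\<lambda>\<nu>\<in>keisler L C M. THE \<rho>. \<rho> \<in> extensional (Fm L M) \<and>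
     (\<forall>\<phi>\<in>Fm L {}. \<rho> (inst_y m \<phi>) = morley L C M \<mu> \<nu> \<phi>))"

end

theory Submission
  imports Defs "HOL-Real_Asymp.Real_Asymp"
begin

text \<open>
  A convex combination \<open>r\<close> of elements \<open>\<sigma>\<close> of the group acts on \<open>\<nu>\<close> by integrating the continuous function
  \<open>f\<^sub>r(q) = \<Sum>\<^sub>\<sigma> r\<^sub>\<sigma> [\<phi>(x; \<sigma>\<^sup>-\<^sup>1m) \<in> q]\<close>, and the same numbers are the values at \<open>\<phi>(b; y)\<close>, \<open>b \<Turnstile> q\<close>, of
  the convex combination of the types of the tuples \<open>\<sigma>\<^sup>-\<^sup>1m\<close>. By group-likeness these are dense in the
  strongly finitely satisfiable measures. So everything comes down to one fact: if \<open>f\<^sub>r\<close> converges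
  pointwise along a filter to \<open>F\<close>, then \<open>F\<close> is Borel and the integrals converge for every Keisler
  measure.

  Under NIP this is elementary. If \<open>F\<close> were not Borel, or convergence in measure failed, then for every
  \<open>N\<close> one could build \<open>N\<close> functions \<open>f\<^sub>r\<close> and \<open>2\<^sup>N\<close> types on which they are independently below \<open>s\<close> or
  above \<open>t\<close>. A Rademacher average argument (Massart, Sauer-Shelah) excludes this for the convex hull of a
  family of finite VC dimension.

  Since a homeomorphism from a compact space to a Hausdorff space needs only continuity in one
  direction, it is enough to see that evaluation at Dirac measures is continuous.
\<close>

section \<open>Syntax and semantics\<close>

text \<open>Limits here run along arbitrary filters, where dominated convergence fails: a bounded
  pointwise limit need be neither measurable nor compatible with integrals. What replaces it is a
  gap \<open>s < t\<close>. With a gap, a separating tree of depth \<open>N\<close> forces a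
  correlation with the coin tosses that is linear in \<open>N\<close>, hence exponentially many
  traces, while finite VC dimension allows only polynomially many. The same gap then yields Borel
  sets between \<open>{t < F}\<close> and \<open>{s \<le> F}\<close>, and convergence in measure of
  the one-sided errors; a grid of finitely many gaps recovers the integrals. The filters live on the
  weight functions \<open>r\<close> in \<open>conv G\<close>, not on either space. Hence one filter
  computes an element of the Ellis semigroup through \<open>conv_act\<close> and its measure through
  \<open>conv_mu\<close>, and both compositions of \<open>Phi\<close> and \<open>Psi\<close> reduce
  to uniqueness of limits. Well-definedness has the same source: a limit is attached to the formula
  itself, so it cannot depend on how the formula is written as \<open>\<phi>(n;y)\<close> or
  \<open>\<phi>(x;m)\<close>.\<close>

lemma eval_tm_map: "eval_tm C e s (map_tm f t) = eval_tm C e (s \<circ> f) t"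
  by (induction t) (auto intro!: arg_cong[of _ _ "fn C _"])

lemma eval_fm_map: "eval_fm C D e s (map_fm f \<phi>) = eval_fm C D e (s \<circ> f) \<phi>"
proof (induction \<phi> arbitrary: e)
  case (Eq t u) then show ?case by (simp only: fm.map eval_fm.simps eval_tm_map)
next
  case (Rel r ts) then show ?case by (simp add: eval_tm_map o_def)
qed auto

lemma eval_tm_cong:
  "\<lbrakk>wf_tm L k t; \<And>n. n < k \<Longrightarrow> e n = e' n; \<And>v. v \<in> vars_tm t \<Longrightarrow> s v = s' v\<rbrakk>
    \<Longrightarrow> eval_tm C e s t = eval_tm C e' s' t"
proof (induction t)
  case (Fn f ts)
  have "map (eval_tm C e s) ts = map (eval_tm C e' s') ts"
    using Fn by (intro map_cong[OF refl] Fn.IH) auto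
  then show ?case by (metis eval_tm.simps(3))
qed auto

lemma eval_fm_cong:
  "\<lbrakk>wf_fm L k \<phi>; \<And>n. n < k \<Longrightarrow> e n = e' n; \<And>v. v \<in> vars_fm \<phi> \<Longrightarrow> s v = s' v\<rbrakk>
    \<Longrightarrow> eval_fm C D e s \<phi> = eval_fm C D e' s' \<phi>"
proof (induction \<phi> arbitrary: k e e')
  case (Eq t u)
  have "eval_tm C e s t = eval_tm C e' s' t" "eval_tm C e s u = eval_tm C e' s' u"
    using Eq by (auto intro!: eval_tm_cong)
  then show ?case by simp
next
  case (Rel r ts)
  have "map (eval_tm C e s) ts = map (eval_tm C e' s') ts"
    using Rel by (intro map_cong[OF refl] eval_tm_cong) auto
  then show ?case by (metis eval_fm.simps(2))
next
  case (Neg \<phi>)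
  have "eval_fm C D e s \<phi> = eval_fm C D e' s' \<phi>"
    using Neg.prems by (intro Neg.IH[of k]) auto
  then show ?case by simp
next
  case (Or \<phi> \<psi>)
  have "eval_fm C D e s \<phi> = eval_fm C D e' s' \<phi>"
    using Or.prems by (intro Or.IH(1)[of k]) auto
  moreover have "eval_fm C D e s \<psi> = eval_fm C D e' s' \<psi>"
    using Or.prems by (intro Or.IH(2)[of k]) auto
  ultimately show ?case by simp
next
  case (Ex \<phi>)
  have "eval_fm C D (case_nat d e) s \<phi> = eval_fm C D (case_nat d e') s' \<phi>" for d
    using Ex.prems by (intro Ex.IH[of "Suc k"]) (auto split: nat.split)
  then show ?case by simp
qed

lemma finite_vars_tm: "finite (vars_tm t)"
  by (induction t) auto

lemma finite_vars_fm: "finite (vars_fm \<phi>)"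
  by (induction \<phi>) (auto simp: finite_vars_tm)

lemma wf_tm_map [simp]: "wf_tm L k (map_tm f t) = wf_tm L k t"
  by (induction t) auto

lemma wf_fm_map [simp]: "wf_fm L k (map_fm f \<phi>) = wf_fm L k \<phi>"
  by (induction \<phi> arbitrary: k) auto

lemma sat_map: "sat C D s (map_fm h \<phi>) = eval_fm C D (\<lambda>_. undefined) (case_sum s id \<circ> h) \<phi>"
  by (simp add: sat_def eval_fm_map)

lemma sat_cong:
  assumes "wf_fm L 0 \<phi>" "\<And>v. Inl v \<in> vars_fm \<phi> \<Longrightarrow> s v = s' v"
  shows "sat C D s \<phi> = sat C D s' \<phi>"
  unfolding sat_def by (rule eval_fm_cong[OF assms(1)]) (auto split: sum.split intro: assms(2))

lemma sat_Neg [simp]: "sat C D s (Neg \<phi>) \<longleftrightarrow> \<not> sat C D s \<phi>"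
  by (simp add: sat_def)

lemma sat_Or [simp]: "sat C D s (Or \<phi> \<psi>) \<longleftrightarrow> sat C D s \<phi> \<or> sat C D s \<psi>"
  by (simp add: sat_def)

lemma Neg_Fm [simp]: "Neg \<phi> \<in> Fm L A \<longleftrightarrow> \<phi> \<in> Fm L A"
  by (auto simp: Fm_def)

lemma Or_Fm [simp]: "Or \<phi> \<psi> \<in> Fm L A \<longleftrightarrow> \<phi> \<in> Fm L A \<and> \<psi> \<in> Fm L A"
  by (auto simp: Fm_def)

lemma Fm_mono: "A \<subseteq> B \<Longrightarrow> Fm L A \<subseteq> Fm L B"
  unfolding Fm_def by blast

lemma Fm_UNIV: "\<phi> \<in> Fm L UNIV \<longleftrightarrow> wf_fm L 0 \<phi>"
  by (simp add: Fm_def flip: UNIV_sum)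

lemma Fm_empty_Inr: "\<phi> \<in> Fm L {} \<Longrightarrow> Inr c \<notin> vars_fm \<phi>"
  by (auto simp: Fm_def)

lemma Fm_Inr: "\<phi> \<in> Fm L A \<Longrightarrow> Inr c \<in> vars_fm \<phi> \<Longrightarrow> c \<in> A"
  by (auto simp: Fm_def)

text \<open>A truth constant without free variables or symbols, so that it belongs to
  \<open>Fm L A\<close> for every language and every parameter set.\<close>

definition top_fm :: "('f, 'r, 'v, 'c) pfm" where
  "top_fm = Ex (Eq (Bnd 0) (Bnd 0))"

lemma top_fm_Fm [simp]: "top_fm \<in> Fm L A"
  by (simp add: top_fm_def Fm_def)

lemma sat_top_fm [simp]: "sat C UNIV s top_fm"
  by (simp add: top_fm_def sat_def)

definition And :: "('f, 'r, 'v, 'c) pfm \<Rightarrow> ('f, 'r, 'v, 'c) pfm \<Rightarrow> ('f, 'r, 'v, 'c) pfm" where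
  "And \<phi> \<psi> = Neg (Or (Neg \<phi>) (Neg \<psi>))"

lemma And_Fm [simp]: "And \<phi> \<psi> \<in> Fm L A \<longleftrightarrow> \<phi> \<in> Fm L A \<and> \<psi> \<in> Fm L A"
  by (simp add: And_def)

lemma sat_And [simp]: "sat C D s (And \<phi> \<psi>) \<longleftrightarrow> sat C D s \<phi> \<and> sat C D s \<psi>"
  by (simp add: And_def)

text \<open>The bound on the variables keeps the conjunction within the variables already realized
  when a type is realized one variable at a time.\<close>

lemma finite_conj:
  assumes "finite F" "F \<subseteq> Fm L A"
  obtains \<psi> where "\<psi> \<in> Fm L A" "vars_fm \<psi> \<subseteq> (\<Union>\<phi>\<in>F. vars_fm \<phi>)"
    "\<And>C s. sat C UNIV s \<psi> \<longleftrightarrow> (\<forall>\<phi>\<in>F. sat C UNIV s \<phi>)"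
proof -
  have "\<exists>\<psi>. \<psi> \<in> Fm L A \<and> vars_fm \<psi> \<subseteq> (\<Union>\<phi>\<in>F. vars_fm \<phi>) \<and>
      (\<forall>C s. sat C UNIV s \<psi> \<longleftrightarrow> (\<forall>\<phi>\<in>F. sat C UNIV s \<phi>))"
    using assms
  proof (induction F)
    case empty
    show ?case by (rule exI[of _ top_fm]) (simp, simp add: top_fm_def)
  next
    case (insert \<phi> F)
    then obtain \<psi> where "\<psi> \<in> Fm L A" "vars_fm \<psi> \<subseteq> (\<Union>\<phi>\<in>F. vars_fm \<phi>)"
      "\<forall>C s. sat C UNIV s \<psi> \<longleftrightarrow> (\<forall>\<phi>\<in>F. sat C UNIV s \<phi>)" by auto
    then show ?case
      using insert.prems by (intro exI[of _ "And \<phi> \<psi>"]) (auto simp: And_def)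
  qed
  then show ?thesis using that by blast
qed

text \<open>Turning the free variable \<open>v\<close> into the index of an enclosing quantifier at depth \<open>k\<close>.\<close>

fun bind_tm :: "'v \<Rightarrow> nat \<Rightarrow> ('f, 'v) tm \<Rightarrow> ('f, 'v) tm" where
  "bind_tm v k (Free w) = (if w = v then Bnd k else Free w)"
| "bind_tm v k (Bnd n) = Bnd n"
| "bind_tm v k (Fn f ts) = Fn f (map (bind_tm v k) ts)"

fun bind_fm :: "'v \<Rightarrow> nat \<Rightarrow> ('f, 'r, 'v) fm \<Rightarrow> ('f, 'r, 'v) fm" where
  "bind_fm v k (Eq t u) = Eq (bind_tm v k t) (bind_tm v k u)"
| "bind_fm v k (Rel r ts) = Rel r (map (bind_tm v k) ts)"
| "bind_fm v k (Neg \<phi>) = Neg (bind_fm v k \<phi>)"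
| "bind_fm v k (Or \<phi> \<psi>) = Or (bind_fm v k \<phi>) (bind_fm v k \<psi>)"
| "bind_fm v k (Ex \<phi>) = Ex (bind_fm v (Suc k) \<phi>)"

lemma wf_bind_tm: "wf_tm L k t \<Longrightarrow> wf_tm L (Suc k) (bind_tm v k t)"
  by (induction t) auto

lemma wf_bind_fm: "wf_fm L k \<phi> \<Longrightarrow> wf_fm L (Suc k) (bind_fm v k \<phi>)"
  by (induction \<phi> arbitrary: k) (auto simp: wf_bind_tm)

lemma vars_bind_tm: "vars_tm (bind_tm v k t) \<subseteq> vars_tm t - {v}"
  by (induction t) auto

lemma vars_bind_fm: "vars_fm (bind_fm v k \<phi>) \<subseteq> vars_fm \<phi> - {v}"
  using vars_bind_tm by (induction \<phi> arbitrary: k) (fastforce+)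

lemma eval_bind_tm: "eval_tm C e s (bind_tm v k t) = eval_tm C e (s(v := e k)) t"
  by (induction t) (auto intro!: arg_cong[of _ _ "fn C _"])

lemma eval_bind_fm: "eval_fm C D e s (bind_fm v k \<phi>) = eval_fm C D e (s(v := e k)) \<phi>"
proof (induction \<phi> arbitrary: k e)
  case (Eq t u) then show ?case by (simp only: bind_fm.simps eval_fm.simps eval_bind_tm)
next
  case (Rel r ts) then show ?case by (simp add: eval_bind_tm o_def del: fun_upd_apply cong: map_cong)
qed auto

text \<open>Projecting out a variable turns a condition on a new variable into a condition on the
  old ones.\<close>

lemma ex_var_fm:
  assumes "\<phi> \<in> Fm L A"
  obtains \<psi> where "\<psi> \<in> Fm L A" "vars_fm \<psi> \<subseteq> vars_fm \<phi> - {Inl v}"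
    "\<And>C s. sat C UNIV s \<psi> \<longleftrightarrow> (\<exists>c. sat C UNIV (s(v := c)) \<phi>)"
proof -
  let ?\<psi> = "Ex (bind_fm (Inl v) 0 \<phi>)"
  have "vars_fm ?\<psi> \<subseteq> vars_fm \<phi> - {Inl v}"
    using vars_bind_fm by force
  moreover have "?\<psi> \<in> Fm L A"
    using assms wf_bind_fm[of L 0 \<phi>] calculation by (auto simp: Fm_def)
  moreover have "sat C UNIV s ?\<psi> \<longleftrightarrow> (\<exists>c. sat C UNIV (s(v := c)) \<phi>)" for C s
  proof -
    have wf: "wf_fm L 0 \<phi>" using assms by (auto simp: Fm_def)
    have "eval_fm C UNIV (case_nat c (\<lambda>_. undefined)) ((case_sum s id)(Inl v := c)) \<phi>
        = sat C UNIV (s(v := c)) \<phi>" for c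
      unfolding sat_def by (rule eval_fm_cong[OF wf]) (auto split: sum.split)
    then show ?thesis by (simp add: sat_def eval_bind_fm)
  qed
  ultimately show ?thesis using that by blast
qed

section \<open>Complete types and saturation\<close>

definition fin_sat :: "('f, 'r, 'c) struct \<Rightarrow> ('f, 'r, 'v, 'c) pfm set \<Rightarrow> bool" where
  "fin_sat C p \<longleftrightarrow> (\<forall>F\<subseteq>p. finite F \<longrightarrow> (\<exists>s. \<forall>\<phi>\<in>F. sat C UNIV s \<phi>))"

lemma complete_types_alt:
  "q \<in> complete_types L C A \<longleftrightarrow>
    q \<subseteq> Fm L A \<and> fin_sat C q \<and> (\<forall>\<phi>\<in>Fm L A. \<phi> \<in> q \<or> Neg \<phi> \<in> q)"
  by (auto simp: complete_types_def fin_sat_def)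

lemma fin_sat_insert:
  assumes "fin_sat C p" "\<not> fin_sat C (insert \<phi> p)"
  obtains F where "finite F" "F \<subseteq> p" "\<And>s. \<forall>\<psi>\<in>F. sat C UNIV s \<psi> \<Longrightarrow> \<not> sat C UNIV s \<phi>"
proof -
  obtain F where F: "F \<subseteq> insert \<phi> p" "finite F" "\<nexists>s. \<forall>\<psi>\<in>F. sat C UNIV s \<psi>"
    using assms(2) by (auto simp: fin_sat_def)
  show ?thesis
    by (rule that[of "F - {\<phi>}"]) (use F in auto)
qed

text \<open>Lindenbaum's argument by Zorn's lemma: a maximal finitely satisfiable set decides every
  formula, since finite parts refuting \<phi> and its negation would together be
  unsatisfiable.\<close>

theorem extend_to_complete_type:
  assumes "p0 \<subseteq> Fm L A" "fin_sat C p0"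
  obtains q where "q \<in> complete_types L C A" "p0 \<subseteq> q"
proof -
  let ?Z = "{p. p0 \<subseteq> p \<and> p \<subseteq> Fm L A \<and> fin_sat C p}"
  have "\<exists>q\<in>?Z. \<forall>p\<in>?Z. q \<subseteq> p \<longrightarrow> p = q"
  proof (rule subset_Zorn_nonempty)
    show "?Z \<noteq> {}" using assms by auto
  next
    fix K assume K: "K \<noteq> {}" "subset.chain ?Z K"
    have "fin_sat C (\<Union>K)"
      unfolding fin_sat_def
    proof (intro allI impI)
      fix F assume "F \<subseteq> \<Union>K" "finite F"
      then obtain k where "k \<in> K" "F \<subseteq> k"
        using finite_subset_Union_chain[OF _ _ K] by metis
      moreover have "fin_sat C k" using \<open>k \<in> K\<close> K by (auto simp: subset.chain_def)
      ultimately show "\<exists>s. \<forall>\<phi>\<in>F. sat C UNIV s \<phi>" using \<open>finite F\<close> by (auto simp: fin_sat_def)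
    qed
    then show "\<Union>K \<in> ?Z" using K by (fastforce simp: subset.chain_def)
  qed
  then obtain q where q: "p0 \<subseteq> q" "q \<subseteq> Fm L A" "fin_sat C q"
    and max: "\<And>p. p \<subseteq> Fm L A \<Longrightarrow> fin_sat C p \<Longrightarrow> q \<subseteq> p \<Longrightarrow> p = q"
    by (smt (verit) mem_Collect_eq order_trans)
  have "\<phi> \<in> q \<or> Neg \<phi> \<in> q" if \<phi>: "\<phi> \<in> Fm L A" for \<phi>
  proof (rule ccontr)
    assume no: "\<not> (\<phi> \<in> q \<or> Neg \<phi> \<in> q)"
    have "\<not> fin_sat C (insert \<phi> q)" "\<not> fin_sat C (insert (Neg \<phi>) q)"
      using max[of "insert \<phi> q"] max[of "insert (Neg \<phi>) q"] no q \<phi> by auto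
    then obtain F F' where F: "finite F" "F \<subseteq> q" "\<And>s. \<forall>\<psi>\<in>F. sat C UNIV s \<psi> \<Longrightarrow> \<not> sat C UNIV s \<phi>"
      "finite F'" "F' \<subseteq> q" "\<And>s. \<forall>\<psi>\<in>F'. sat C UNIV s \<psi> \<Longrightarrow> \<not> sat C UNIV s (Neg \<phi>)"
      using fin_sat_insert[OF q(3)] by metis
    obtain s where "\<forall>\<psi>\<in>F \<union> F'. sat C UNIV s \<psi>"
      using q(3) F unfolding fin_sat_def by (metis finite_UnI le_sup_iff)
    then show False using F(3)[of s] F(6)[of s] by auto
  qed
  then have "q \<in> complete_types L C A" using q by (simp add: complete_types_alt)
  then show ?thesis using that q(1) by blast
qed

lemma tp_complete: "tp L C A a \<in> complete_types L C A"
  by (auto simp: tp_def complete_types_def)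

lemma complete_type_sat2:
  assumes "q \<in> complete_types L C A" "\<phi> \<in> q" "\<psi> \<in> q"
  obtains s where "sat C UNIV s \<phi>" "sat C UNIV s \<psi>"
proof -
  have "\<exists>s. \<forall>\<xi>\<in>{\<phi>, \<psi>}. sat C UNIV s \<xi>"
    using assms unfolding complete_types_alt fin_sat_def by (metis empty_subsetI finite.simps insert_subset)
  then show ?thesis using that by auto
qed

lemma complete_type_Neg:
  assumes "q \<in> complete_types L C A" "\<phi> \<in> Fm L A"
  shows "Neg \<phi> \<in> q \<longleftrightarrow> \<phi> \<notin> q"
proof
  assume "Neg \<phi> \<in> q" then show "\<phi> \<notin> q"
    using complete_type_sat2[OF assms(1), of "Neg \<phi>" \<phi>] by auto
next
  assume "\<phi> \<notin> q" then show "Neg \<phi> \<in> q" using assms by (auto simp: complete_types_def)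
qed

text \<open>Finite satisfiability is applied to \<open>F\<close> together with the negation of
  \<phi>; an empty \<open>F\<close> gives the valid formulas.\<close>

lemma complete_type_conseq:
  assumes q: "q \<in> complete_types L C A" and F: "F \<subseteq> q" "finite F" and \<phi>: "\<phi> \<in> Fm L A"
    and conseq: "\<And>s. \<forall>\<psi>\<in>F. sat C UNIV s \<psi> \<Longrightarrow> sat C UNIV s \<phi>"
  shows "\<phi> \<in> q"
proof (rule ccontr)
  assume "\<phi> \<notin> q"
  then have "insert (Neg \<phi>) F \<subseteq> q" using complete_type_Neg[OF q \<phi>] F by auto
  then obtain s where "\<forall>\<psi>\<in>insert (Neg \<phi>) F. sat C UNIV s \<psi>"
    using q F(2) unfolding complete_types_alt fin_sat_def by (meson finite.insertI)
  then show False using conseq[of s] by auto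
qed

lemma complete_type_Or:
  assumes "q \<in> complete_types L C A" "\<phi> \<in> Fm L A" "\<psi> \<in> Fm L A"
  shows "Or \<phi> \<psi> \<in> q \<longleftrightarrow> \<phi> \<in> q \<or> \<psi> \<in> q"
proof
  assume o: "Or \<phi> \<psi> \<in> q"
  show "\<phi> \<in> q \<or> \<psi> \<in> q"
  proof (rule ccontr)
    assume "\<not> (\<phi> \<in> q \<or> \<psi> \<in> q)"
    then have "{Or \<phi> \<psi>, Neg \<phi>} \<subseteq> q" "\<psi> \<notin> q"
      using o complete_type_Neg[OF assms(1,2)] by auto
    moreover have "\<psi> \<in> q"
      by (rule complete_type_conseq[OF assms(1) calculation(1)]) (use assms in auto)
    ultimately show False by simp
  qed
next
  assume "\<phi> \<in> q \<or> \<psi> \<in> q"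
  then show "Or \<phi> \<psi> \<in> q"
    using complete_type_conseq[OF assms(1), of "{\<phi>}" "Or \<phi> \<psi>"]
      complete_type_conseq[OF assms(1), of "{\<psi>}" "Or \<phi> \<psi>"] assms by auto
qed

section \<open>Realizing types in the monster model\<close>

lemma ordLess_Un:
  assumes "Card_order \<kappa>" "natLeq <o \<kappa>" "|A| <o \<kappa>" "|B| <o \<kappa>"
  shows "|A \<union> B| <o \<kappa>"
proof -
  have "infinite (Field \<kappa>)"
    using assms(1,2) by (metis cinfinite_def cinfinite_mono natLeq_cinfinite ordLess_imp_ordLeq)
  then show ?thesis using card_of_Un_ordLess_infinite_Field assms by blast
qed

text \<open>Saturation realizes types in a single variable. The values \<open>s\<close> of the
  variables in \<open>V\<close> become parameters, which keeps the parameter set small, and what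
  \<open>q\<close> says about \<open>v\<close> becomes such a type.\<close>

lemma complete_type_vars_realized:
  assumes mon: "monster L C \<kappa>" and A: "|A| <o \<kappa>" and q: "q \<in> complete_types L C A"
    and V: "|V| <o \<kappa>"
    and s: "\<And>\<phi>. \<phi> \<in> q \<Longrightarrow> vars_fm \<phi> \<subseteq> Inl ` V \<union> range Inr \<Longrightarrow> sat C UNIV s \<phi>"
  shows "\<exists>c. \<forall>\<phi>\<in>q. vars_fm \<phi> \<subseteq> Inl ` insert v V \<union> range Inr \<longrightarrow> sat C UNIV (s(v := c)) \<phi>"
proof -
  let ?B = "A \<union> s ` V"
  let ?q = "{\<phi> \<in> q. vars_fm \<phi> \<subseteq> Inl ` insert v V \<union> range Inr}"
  \<comment> \<open>\<open>v\<close> becomes the variable of the one-variable type, and any other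
    variable becomes the parameter naming its value.\<close>
  define h where "h = case_sum (\<lambda>w. if w = v then Inl () else Inr (s w)) Inr"
  have sath: "sat C UNIV a (map_fm h \<phi>) = sat C UNIV (s(v := a ())) \<phi>"
    if "wf_fm L 0 \<phi>" for a \<phi>
    unfolding sat_map unfolding sat_def
    by (rule eval_fm_cong[OF that]) (auto simp: h_def split: sum.split)
  have wfq: "wf_fm L 0 \<phi>" if "\<phi> \<in> q" for \<phi>
    using q that by (auto simp: complete_types_def Fm_def)
  have 1: "|?B| <o \<kappa>"
    using mon A V by (intro ordLess_Un) (auto simp: monster_def intro: ordLeq_ordLess_trans[OF card_of_image])
  have 2: "map_fm h ` ?q \<subseteq> Fm L ?B"
  proof
    fix \<psi> assume "\<psi> \<in> map_fm h ` ?q"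
    then obtain \<phi> where \<phi>: "\<psi> = map_fm h \<phi>" "\<phi> \<in> q" "vars_fm \<phi> \<subseteq> Inl ` insert v V \<union> range Inr" by blast
    have "h x \<in> range Inl \<union> Inr ` ?B" if "x \<in> vars_fm \<phi>" for x
    proof (cases x)
      case (Inl w) then have "w = v \<or> w \<in> V" using that \<phi>(3) by auto
      then show ?thesis by (auto simp: h_def Inl)
    next
      case (Inr c) then have "c \<in> A" using that \<phi>(2) q Fm_Inr[of \<phi> L A c] by (auto simp: complete_types_def)
      then show ?thesis by (auto simp: h_def Inr)
    qed
    then show "\<psi> \<in> Fm L ?B" using wfq[OF \<phi>(2)] by (auto simp: Fm_def \<phi>(1) fm.set_map)
  qed
  have 3: "fin_sat C (map_fm h ` ?q)"
    unfolding fin_sat_def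
  proof (intro allI impI)
    fix F assume "F \<subseteq> map_fm h ` ?q" "finite F"
    then obtain G where G: "G \<subseteq> ?q" "finite G" "F = map_fm h ` G"
      by (meson finite_subset_image)
    have "G \<subseteq> Fm L A" using G(1) q by (auto simp: complete_types_def)
    then obtain \<psi> where \<psi>: "\<psi> \<in> Fm L A" "vars_fm \<psi> \<subseteq> (\<Union>\<phi>\<in>G. vars_fm \<phi>)"
      "\<And>C s. sat C UNIV s \<psi> \<longleftrightarrow> (\<forall>\<phi>\<in>G. sat C UNIV s \<phi>)"
      using finite_conj[OF G(2)] by metis
    obtain \<xi> where \<xi>: "\<xi> \<in> Fm L A" "vars_fm \<xi> \<subseteq> vars_fm \<psi> - {Inl v}"
      "\<And>C s. sat C UNIV s \<xi> \<longleftrightarrow> (\<exists>c. sat C UNIV (s(v := c)) \<psi>)"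
      using ex_var_fm[OF \<psi>(1)] by metis
    \<comment> \<open>Projecting \<open>v\<close> out of the conjunction leaves a consequence in the
      variables of \<open>V\<close>, where \<open>s\<close> already satisfies \<open>q\<close>; its
      witness is the value for \<open>v\<close>.\<close>
    have "\<xi> \<in> q"
    proof (rule complete_type_conseq[OF q _ G(2) \<xi>(1)])
      show "G \<subseteq> q" using G by auto
      fix s assume "\<forall>\<psi>\<in>G. sat C UNIV s \<psi>"
      then show "sat C UNIV s \<xi>" unfolding \<xi> \<psi> by (metis fun_upd_triv)
    qed
    moreover have "vars_fm \<xi> \<subseteq> Inl ` V \<union> range Inr"
    proof
      fix x assume "x \<in> vars_fm \<xi>"
      then have "x \<noteq> Inl v" "x \<in> Inl ` insert v V \<union> range Inr"
        using \<xi>(2) \<psi>(2) G(1) by blast+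
      then show "x \<in> Inl ` V \<union> range Inr" by auto
    qed
    ultimately obtain c where "\<forall>\<phi>\<in>G. sat C UNIV (s(v := c)) \<phi>"
      using s[of \<xi>] \<xi>(3) \<psi>(3) by blast
    then have "\<forall>\<phi>\<in>F. sat C UNIV (\<lambda>_. c) \<phi>"
      using G by (auto simp: sath wfq)
    then show "\<exists>a. \<forall>\<phi>\<in>F. sat C UNIV a \<phi>" by (rule exI[of _ "\<lambda>_. c"])
  qed
  obtain p where p: "p \<in> complete_types L C ?B" "map_fm h ` ?q \<subseteq> p"
    using extend_to_complete_type[OF 2 3] by blast
  then obtain a where "\<forall>\<phi>\<in>p. sat C UNIV a \<phi>"
    using mon 1 unfolding monster_def saturated_def by blast
  then have "sat C UNIV (s(v := a ())) \<phi>" if "\<phi> \<in> q" "vars_fm \<phi> \<subseteq> Inl ` insert v V \<union> range Inr" for \<phi>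
    using p(2) that sath[of \<phi> a] wfq by auto
  then show ?thesis by blast
qed

text \<open>Zorn's lemma on partial assignments: a maximal one compatible with \<open>q\<close> is
  total, since \<open>complete_type_vars_realized\<close> would otherwise extend it.\<close>

theorem realize_complete_type:
  fixes q :: "('f, 'r, 'v, 'c) pfm set"
  assumes mon: "monster L C \<kappa>" and A: "|A| <o \<kappa>" and V: "|UNIV :: 'v set| <o \<kappa>"
    and q: "q \<in> complete_types L C A"
  obtains s where "\<forall>\<phi>\<in>q. sat C UNIV s \<phi>"
proof -
  \<comment> \<open>Satisfaction takes total assignments, so a partial one is judged by all its
    total extensions, and only on formulas whose variables it determines.\<close>
  define ok where "ok g \<longleftrightarrow> single_valued g \<and> (\<forall>\<phi>\<in>q. vars_fm \<phi> \<subseteq> Inl ` Domain g \<union> range Inr \<longrightarrow>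
    (\<forall>s. (\<forall>(v, c)\<in>g. s v = c) \<longrightarrow> sat C UNIV s \<phi>))" for g :: "('v \<times> 'c) set"
  have wfq: "wf_fm L 0 \<phi>" if "\<phi> \<in> q" for \<phi>
    using q that by (auto simp: complete_types_def Fm_def)
  have "\<exists>g\<in>Collect ok. \<forall>g'\<in>Collect ok. g \<subseteq> g' \<longrightarrow> g' = g"
  proof (rule subset_Zorn_nonempty)
    have "sat C UNIV s \<phi>" if \<phi>: "\<phi> \<in> q" "vars_fm \<phi> \<subseteq> range Inr" for \<phi> s
    proof -
      obtain s' where "sat C UNIV s' \<phi>" using complete_type_sat2[OF q \<phi>(1) \<phi>(1)] by blast
      moreover have "sat C UNIV s \<phi> = sat C UNIV s' \<phi>"
        by (rule sat_cong[OF wfq]) (use \<phi> in auto)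
      ultimately show ?thesis by simp
    qed
    then have "ok {}" by (auto simp: ok_def)
    then show "Collect ok \<noteq> {}" by auto
  next
    fix K assume K: "K \<noteq> {}" "subset.chain (Collect ok) K"
    have okK: "k \<in> K \<Longrightarrow> ok k" for k using K by (auto simp: subset.chain_def)
    have fin: "\<exists>k\<in>K. F \<subseteq> k" if "finite F" "F \<subseteq> \<Union>K" for F
      using finite_subset_Union_chain[OF that K] by metis
    have "single_valued (\<Union>K)"
    proof (rule single_valuedI)
      fix x y z assume "(x, y) \<in> \<Union>K" "(x, z) \<in> \<Union>K"
      then obtain k where "k \<in> K" "(x, y) \<in> k" "(x, z) \<in> k"
        using fin[of "{(x, y), (x, z)}"] by auto
      then show "y = z" using okK[of k] by (auto simp: ok_def single_valued_def)
    qed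
    moreover have "sat C UNIV s \<phi>"
      if \<phi>: "\<phi> \<in> q" "vars_fm \<phi> \<subseteq> Inl ` Domain (\<Union>K) \<union> range Inr" and s: "\<forall>(v, c)\<in>\<Union>K. s v = c" for \<phi> s
    proof -
      \<comment> \<open>A formula has finitely many variables, so one member of the chain already
        assigns all of them.\<close>
      let ?W = "{v. Inl v \<in> vars_fm \<phi>}"
      have "finite ?W" using finite_vimageI[OF finite_vars_fm inj_Inl] by (simp add: vimage_def)
      then have "finite ((\<lambda>v. (v, s v)) ` ?W)" by simp
      moreover have "(\<lambda>v. (v, s v)) ` ?W \<subseteq> \<Union>K"
      proof clarify
        fix v assume "Inl v \<in> vars_fm \<phi>"
        then have "v \<in> Domain (\<Union>K)" using \<phi>(2) by auto
        then obtain c where "(v, c) \<in> \<Union>K" by auto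
        moreover from this have "s v = c" using s by (metis case_prodD)
        ultimately show "(v, s v) \<in> \<Union>K" by simp
      qed
      ultimately obtain k where k: "k \<in> K" "(\<lambda>v. (v, s v)) ` ?W \<subseteq> k" using fin by blast
      have "vars_fm \<phi> \<subseteq> Inl ` Domain k \<union> range Inr"
      proof
        fix x assume x: "x \<in> vars_fm \<phi>"
        show "x \<in> Inl ` Domain k \<union> range Inr" using x k(2) by (cases x rule: sum.exhaust) auto
      qed
      moreover have "\<forall>(v, c)\<in>k. s v = c"
      proof (rule ballI)
        fix x assume "x \<in> k"
        then have "x \<in> \<Union>K" using k(1) by (rule UnionI[rotated])
        with s show "case x of (v, c) \<Rightarrow> s v = c" by (rule bspec)
      qed
      ultimately show ?thesis using okK[OF k(1)] \<phi>(1) unfolding ok_def by metis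
    qed
    ultimately show "\<Union>K \<in> Collect ok" by (auto simp: ok_def)
  qed
  then obtain g where g: "ok g" and max: "\<And>g'. ok g' \<Longrightarrow> g \<subseteq> g' \<Longrightarrow> g' = g" by auto
  define s where "s v = (if v \<in> Domain g then THE c. (v, c) \<in> g else undefined)" for v
  have sg: "s v = c" if "(v, c) \<in> g" for v c
    using that g by (auto simp: s_def ok_def single_valued_def)
  have "v \<in> Domain g" for v
  proof (rule ccontr)
    assume v: "v \<notin> Domain g"
    have cd: "|Domain g| <o \<kappa>" using V ordLeq_ordLess_trans card_of_mono1 subset_UNIV by metis
    have "\<forall>(v, c)\<in>g. s v = c" using sg by auto
    then have "sat C UNIV s \<phi>" if "\<phi> \<in> q" "vars_fm \<phi> \<subseteq> Inl ` Domain g \<union> range Inr" for \<phi>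
      using g that unfolding ok_def by metis
    then obtain c where c: "\<And>\<phi>. \<phi> \<in> q \<Longrightarrow> vars_fm \<phi> \<subseteq> Inl ` insert v (Domain g) \<union> range Inr
        \<Longrightarrow> sat C UNIV (s(v := c)) \<phi>"
      using complete_type_vars_realized[OF mon A q cd, of s v] by metis
    have "ok (insert (v, c) g)"
      unfolding ok_def
    proof (intro conjI ballI impI allI)
      show "single_valued (insert (v, c) g)"
        using g v by (auto simp: ok_def single_valued_def)
    next
      fix \<phi> s' assume \<phi>: "\<phi> \<in> q" "vars_fm \<phi> \<subseteq> Inl ` Domain (insert (v, c) g) \<union> range Inr"
        and s': "\<forall>(w, d)\<in>insert (v, c) g. s' w = d"
      have "sat C UNIV s' \<phi> = sat C UNIV (s(v := c)) \<phi>"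
      proof (rule sat_cong[OF wfq[OF \<phi>(1)]])
        fix w assume "Inl w \<in> vars_fm \<phi>"
        then have "w = v \<or> w \<in> Domain g" using \<phi>(2) by auto
        then show "s' w = (s(v := c)) w" using s' sg v by auto
      qed
      then show "sat C UNIV s' \<phi>" using c[OF \<phi>(1)] \<phi>(2) by simp
    qed
    then show False using max[of "insert (v, c) g"] v by auto
  qed
  then have "Inl ` Domain g \<union> range Inr = (UNIV :: ('v + 'c) set)" by (auto simp: UNIV_sum)
  moreover have "\<forall>(v, c)\<in>g. s v = c" using sg by auto
  ultimately have "\<forall>\<phi>\<in>q. sat C UNIV s \<phi>" using g unfolding ok_def by (metis subset_UNIV)
  then show ?thesis using that by blast
qed

corollary realize_partial_type:
  fixes p :: "('f, 'r, 'v, 'c) pfm set"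
  assumes "monster L C \<kappa>" "|A| <o \<kappa>" "|UNIV :: 'v set| <o \<kappa>" "p \<subseteq> Fm L A" "fin_sat C p"
  obtains s where "\<forall>\<phi>\<in>p. sat C UNIV s \<phi>"
  using extend_to_complete_type[OF assms(4,5)] realize_complete_type[OF assms(1-3)] by (metis subsetD)

section \<open>Shattering\<close>

definition shattered :: "'a set set \<Rightarrow> 'a set \<Rightarrow> bool" where
  "shattered \<F> S \<longleftrightarrow> (\<forall>T\<subseteq>S. \<exists>R\<in>\<F>. R \<inter> S = T)"

text \<open>Induction on the ground set. \<open>\<F>1\<close> collects the traces on
  \<open>A\<close>, and \<open>\<F>2\<close> those traces that occur both with and without
  \<open>x\<close>, so that the cardinality of \<open>\<F>\<close> is the sum of theirs. Sets
  shattered by \<open>\<F>1\<close> are shattered by \<open>\<F>\<close>, and those shattered by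
  \<open>\<F>2\<close> remain so after adding \<open>x\<close>, which makes the two contributions
  disjoint.\<close>

theorem Pajor:
  assumes "finite A" "\<F> \<subseteq> Pow A"
  shows "card \<F> \<le> card {S. S \<subseteq> A \<and> shattered \<F> S}"
  using assms
proof (induction A arbitrary: \<F>)
  case empty
  then have "\<F> = {} \<or> \<F> = {{}}" by auto
  then show ?case
  proof
    assume "\<F> = {{}}"
    moreover from this have "{S. S \<subseteq> {} \<and> shattered \<F> S} = {{}}"
      by (auto simp: shattered_def)
    ultimately show ?thesis by simp
  qed simp
next
  case (insert x A)
  define \<F>1 where "\<F>1 = (\<lambda>R. R - {x}) ` \<F>"
  define \<F>2 where "\<F>2 = {R. R \<subseteq> A \<and> R \<in> \<F> \<and> insert x R \<in> \<F>}"
  have fin: "finite \<F>" using insert by (meson finite.insertI finite_Pow_iff finite_subset)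
  have "\<F>1 \<subseteq> Pow A" "\<F>2 \<subseteq> Pow A" using insert by (auto simp: \<F>1_def \<F>2_def)
  note IH = insert.IH[OF this(1)] insert.IH[OF this(2)] and sub = this
  let ?sh = "\<lambda>\<G>. {S. S \<subseteq> A \<and> shattered \<G> S}"
  let ?a = "{R \<in> \<F>. x \<notin> R}" and ?b = "(\<lambda>R. R - {x}) ` {R \<in> \<F>. x \<in> R}"
  have split: "?a \<union> {R \<in> \<F>. x \<in> R} = \<F>" by auto
  have "card (?a \<union> {R \<in> \<F>. x \<in> R}) = card ?a + card {R \<in> \<F>. x \<in> R}"
    by (rule card_Un_disjoint) (use fin in auto)
  then have "card \<F> = card ?a + card {R \<in> \<F>. x \<in> R}" by (simp only: split)
  also have "card {R \<in> \<F>. x \<in> R} = card ?b"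
    by (rule card_image[symmetric]) (auto simp: inj_on_def)
  also have "card ?a + card ?b = card (?a \<union> ?b) + card (?a \<inter> ?b)"
    using card_Un_Int[of ?a ?b] fin by simp
  also have "?a \<union> ?b = \<F>1"
  proof -
    have "(\<lambda>R. R - {x}) ` ?a = (\<lambda>R. R) ` ?a" by (rule image_cong) auto
    then have "?a \<union> ?b = (\<lambda>R. R - {x}) ` (?a \<union> {R \<in> \<F>. x \<in> R})" by (simp only: image_Un image_ident)
    then show ?thesis by (simp only: split \<F>1_def)
  qed
  also have "?a \<inter> ?b = \<F>2"
  proof (intro subset_antisym subsetI)
    fix R assume "R \<in> ?a \<inter> ?b"
    then obtain R' where "R \<in> \<F>" "x \<notin> R" "R = R' - {x}" "R' \<in> \<F>" "x \<in> R'" by blast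
    moreover from this have "insert x R = R'" by auto
    ultimately show "R \<in> \<F>2" using insert.prems by (auto simp: \<F>2_def)
  next
    fix R assume "R \<in> \<F>2"
    then have R: "R \<in> \<F>" "x \<notin> R" "insert x R \<in> \<F>" using insert.hyps(2) by (auto simp: \<F>2_def)
    then have "R = insert x R - {x}" by simp
    then show "R \<in> ?a \<inter> ?b" using R by blast
  qed
  finally have "card \<F> \<le> card (?sh \<F>1) + card (?sh \<F>2)" using IH by simp
  also have "card (?sh \<F>2) = card (insert x ` ?sh \<F>2)"
    by (rule card_image[symmetric]) (use insert.hyps(2) in \<open>auto simp: inj_on_def\<close>)
  also have "card (?sh \<F>1) + card (insert x ` ?sh \<F>2) = card (?sh \<F>1 \<union> insert x ` ?sh \<F>2)"
    by (rule card_Un_disjoint[symmetric]) (use insert.hyps in auto)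
  also have "\<dots> \<le> card {S. S \<subseteq> insert x A \<and> shattered \<F> S}"
  proof (rule card_mono)
    show "finite {S. S \<subseteq> insert x A \<and> shattered \<F> S}" using insert.hyps(1) by simp
    have "shattered \<F> S" if S: "S \<subseteq> A" "shattered \<F>1 S" for S
      unfolding shattered_def
    proof (intro allI impI)
      fix T assume "T \<subseteq> S"
      then obtain R where "R \<in> \<F>" "(R - {x}) \<inter> S = T"
        using S(2) unfolding shattered_def \<F>1_def by blast
      moreover have "x \<notin> S" using S(1) insert.hyps(2) by auto
      ultimately show "\<exists>R\<in>\<F>. R \<inter> S = T" by blast
    qed
    moreover have "shattered \<F> (insert x S)" if S: "S \<subseteq> A" "shattered \<F>2 S" for S
      unfolding shattered_def
    proof (intro allI impI)
      have xS: "x \<notin> S" using S(1) insert.hyps(2) by auto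
      fix T assume T: "T \<subseteq> insert x S"
      then have "T - {x} \<subseteq> S" by auto
      then obtain R where R: "R \<in> \<F>2" "R \<inter> S = T - {x}"
        using S(2) unfolding shattered_def by blast
      then have "R \<in> \<F>" "insert x R \<in> \<F>" "x \<notin> R" using insert.hyps(2) by (auto simp: \<F>2_def)
      then show "\<exists>R\<in>\<F>. R \<inter> insert x S = T"
        using R(2) T xS by (intro bexI[of _ "if x \<in> T then insert x R else R"]) auto
    qed
    ultimately show "?sh \<F>1 \<union> insert x ` ?sh \<F>2 \<subseteq> {S. S \<subseteq> insert x A \<and> shattered \<F> S}"
      by auto
  qed
  finally show ?case .
qed

text \<open>A small set is read off from a list of length \<open>d\<close>, padded with the dummy
  entry \<open>N\<close> outside the ground set; hence the base \<open>N + 1\<close>.\<close>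

lemma card_small_subsets:
  "card {S. S \<subseteq> {..<N} \<and> card S \<le> d} \<le> (N + 1) ^ d"
proof -
  let ?L = "{xs. set xs \<subseteq> {..N} \<and> length xs = d}"
  have "{S. S \<subseteq> {..<N} \<and> card S \<le> d} \<subseteq> (\<lambda>xs. set xs - {N}) ` ?L"
  proof clarify
    fix S assume S: "S \<subseteq> {..<N}" "card S \<le> d"
    have "finite S" using S(1) finite_subset by blast
    then have "set (sorted_list_of_set S @ replicate (d - card S) N) - {N} = S"
      using S(1) by auto
    moreover have "sorted_list_of_set S @ replicate (d - card S) N \<in> ?L"
      using S \<open>finite S\<close> by (auto simp: less_imp_le)
    ultimately show "S \<in> (\<lambda>xs. set xs - {N}) ` ?L"
      by (intro image_eqI[of _ _ "sorted_list_of_set S @ replicate (d - card S) N"]) simp_all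
  qed
  moreover have "finite ?L" by (rule finite_lists_length_eq) simp
  ultimately have "card {S. S \<subseteq> {..<N} \<and> card S \<le> d} \<le> card ?L"
    using surj_card_le by blast
  also have "\<dots> = (N + 1) ^ d"
    using card_lists_length_eq[of "{..N}" d] by simp
  finally show ?thesis .
qed

text \<open>The bound is crude, but it only has to lose against an exponential in
  \<open>N\<close>.\<close>

corollary Sauer_Shelah:
  assumes "\<F> \<subseteq> Pow {..<N}" "\<And>S. S \<subseteq> {..<N} \<Longrightarrow> shattered \<F> S \<Longrightarrow> card S \<le> d"
  shows "card \<F> \<le> (N + 1) ^ d"
proof -
  have "card \<F> \<le> card {S. S \<subseteq> {..<N} \<and> shattered \<F> S}"
    using assms(1) by (intro Pajor) auto
  also have "\<dots> \<le> card {S. S \<subseteq> {..<N} \<and> card S \<le> d}"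
    using assms(2) by (intro card_mono) auto
  also note card_small_subsets
  finally show ?thesis .
qed

section \<open>Rademacher averages and separating trees\<close>

text \<open>Moment bound for one fair sign. The constant in the exponent is cruder than the optimal
  \<open>1 / 2\<close>, but a quadratic bound for \<open>exp\<close> on the unit interval gives
  it.\<close>

lemma cosh_le_exp:
  fixes x :: real
  assumes "0 \<le> x" "x \<le> 1"
  shows "exp x + exp (- x) \<le> 2 * exp (x\<^sup>2)"
proof -
  have "exp x \<le> 1 + x + x\<^sup>2" using exp_bound[OF assms] .
  moreover have "exp (- x) \<le> 1 - x + x\<^sup>2"
  proof -
    \<comment> \<open>The product equals \<open>1 + x ^ 3\<close>.\<close>
    have "1 \<le> (1 - x + x\<^sup>2) * (1 + x)"
      using assms by (simp add: algebra_simps power2_eq_square)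
    also have "\<dots> \<le> (1 - x + x\<^sup>2) * exp x"
      using exp_ge_add_one_self[of x] assms by (intro mult_left_mono) auto
    finally show ?thesis by (simp add: exp_minus field_simps)
  qed
  moreover have "1 + x\<^sup>2 \<le> exp (x\<^sup>2)" by (rule exp_ge_add_one_self)
  ultimately show ?thesis by linarith
qed

text \<open>\<open>sgn_of \<eta> k\<close> is the sign of the \<open>k\<close>-th coin toss when the sets \<open>\<eta>\<close> encode the outcomes.\<close>

definition sgn_of :: "nat set \<Rightarrow> nat \<Rightarrow> real" where
  "sgn_of \<eta> k = (if k \<in> \<eta> then 1 else - 1)"

lemma sum_Pow_lessThan_Suc:
  "(\<Sum>\<eta>\<in>Pow {..<Suc N}. g \<eta>) = (\<Sum>\<eta>\<in>Pow {..<N}. g \<eta> + g (insert N \<eta>))"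
proof -
  have "Pow {..<Suc N} = Pow {..<N} \<union> insert N ` Pow {..<N}"
    by (simp add: lessThan_Suc Pow_insert)
  moreover have "sum g (Pow {..<N} \<union> insert N ` Pow {..<N})
      = sum g (Pow {..<N}) + sum g (insert N ` Pow {..<N})"
    by (rule sum.union_disjoint) auto
  moreover have "sum g (insert N ` Pow {..<N}) = (\<Sum>\<eta>\<in>Pow {..<N}. g (insert N \<eta>))"
  proof (subst sum.reindex)
    show "inj_on (insert N) (Pow {..<N})"
      unfolding inj_on_def by (metis Pow_iff insert_ident lessThan_iff less_irrefl subsetD)
  qed simp
  ultimately show ?thesis by (simp add: sum.distrib)
qed

text \<open>Independence of the coin tosses: the moment generating function, not normalized, factors
  over the tosses.\<close>

lemma sum_exp_signs:
  "(\<Sum>\<eta>\<in>Pow {..<N}. exp (l * (\<Sum>k<N. sgn_of \<eta> k * w k)))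
    = (\<Prod>k<N. exp (l * w k) + exp (- (l * w k)))"
proof (induction N)
  case (Suc N)
  have "(\<Sum>k<N. sgn_of (insert N \<eta>) k * w k) = (\<Sum>k<N. sgn_of \<eta> k * w k)" for \<eta>
    by (rule sum.cong) (auto simp: sgn_of_def)
  moreover have "sgn_of (insert N \<eta>) N = 1" for \<eta> by (simp add: sgn_of_def)
  moreover have "sgn_of \<eta> N = - 1" if "\<eta> \<in> Pow {..<N}" for \<eta> using that by (auto simp: sgn_of_def)
  ultimately have "(\<Sum>\<eta>\<in>Pow {..<Suc N}. exp (l * (\<Sum>k<Suc N. sgn_of \<eta> k * w k)))
    = (\<Sum>\<eta>\<in>Pow {..<N}. exp (l * (\<Sum>k<N. sgn_of \<eta> k * w k)) * (exp (l * w N) + exp (- (l * w N))))"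
    unfolding sum_Pow_lessThan_Suc
    by (intro sum.cong refl) (simp add: algebra_simps flip: exp_add)
  then show ?case using Suc by (simp flip: sum_distrib_right)
qed simp

text \<open>
  A tangent-line estimate for \<open>exp\<close> replaces Jensen's inequality in the usual proof of Massart's
  bound on Rademacher averages.
\<close>

lemma Massart:
  fixes tr :: "nat set \<Rightarrow> nat set"
  assumes tr: "\<And>\<eta>. \<eta> \<subseteq> {..<N} \<Longrightarrow> tr \<eta> \<in> \<F>" and fin: "finite \<F>"
    and c: "0 \<le> c" "c \<le> 1"
    and corr: "2 ^ N * (c * N) \<le> (\<Sum>\<eta>\<in>Pow {..<N}. \<Sum>k<N. sgn_of \<eta> k * of_bool (k \<in> tr \<eta>))"
  shows "exp (c\<^sup>2 * N / 4) \<le> card \<F>"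
proof -
  \<comment> \<open>This maximizes the final exponent \<open>l * c - l\<^sup>2\<close> per toss; the
    maximum is \<open>c\<^sup>2 / 4\<close>.\<close>
  define l where "l = c / 2"
  have l: "0 \<le> l" "l \<le> 1" using c by (auto simp: l_def)
  define X where "X \<eta> S = (\<Sum>k<N. sgn_of \<eta> k * of_bool (k \<in> S))" for \<eta> S
  \<comment> \<open>The added term is nonnegative by \<open>corr\<close>, and it turns the
    right-hand side into a sum of values of the tangent line of \<open>exp\<close> at
    \<open>l * (c * N)\<close>.\<close>
  have "2 ^ N * exp (l * (c * N)) \<le> 2 ^ N * exp (l * (c * N))
      + exp (l * (c * N)) * l * ((\<Sum>\<eta>\<in>Pow {..<N}. X \<eta> (tr \<eta>)) - 2 ^ N * (c * N))"
    using corr l unfolding X_def by (simp add: mult_nonneg_nonneg)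
  also have "\<dots> = (\<Sum>\<eta>\<in>Pow {..<N}. exp (l * (c * N)) * (1 + l * (X \<eta> (tr \<eta>) - c * N)))"
  proof -
    have "(\<Sum>\<eta>\<in>Pow {..<N}. K * (1 + l * (X \<eta> (tr \<eta>) - c * N)))
        = 2 ^ N * K + K * l * ((\<Sum>\<eta>\<in>Pow {..<N}. X \<eta> (tr \<eta>)) - 2 ^ N * (c * N))" for K
      unfolding right_diff_distrib distrib_left sum.distrib sum_subtractf
      by (simp add: card_Pow sum_distrib_left mult.assoc)
    then show ?thesis by simp
  qed
  also have "\<dots> \<le> (\<Sum>\<eta>\<in>Pow {..<N}. exp (l * X \<eta> (tr \<eta>)))"
  proof (rule sum_mono)
    fix \<eta>
    have "exp (l * X \<eta> (tr \<eta>)) = exp (l * (c * N)) * exp (l * (X \<eta> (tr \<eta>) - c * N))"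
      by (simp add: algebra_simps flip: exp_add)
    then show "exp (l * (c * N)) * (1 + l * (X \<eta> (tr \<eta>) - c * N)) \<le> exp (l * X \<eta> (tr \<eta>))"
      using exp_ge_add_one_self[of "l * (X \<eta> (tr \<eta>) - c * N)"] by simp
  qed
  \<comment> \<open>The trace depends on the tosses. Summing over all of \<open>\<F>\<close> removes
    this dependence at the price of the factor \<open>card \<F>\<close>, and each fixed
    \<open>S\<close> then meets independent tosses.\<close>
  also have "\<dots> \<le> (\<Sum>\<eta>\<in>Pow {..<N}. \<Sum>S\<in>\<F>. exp (l * X \<eta> S))"
    using tr fin by (intro sum_mono member_le_sum) auto
  also have "\<dots> = (\<Sum>S\<in>\<F>. \<Sum>\<eta>\<in>Pow {..<N}. exp (l * X \<eta> S))" by (rule sum.swap)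
  also have "\<dots> \<le> (\<Sum>S\<in>\<F>. (2 * exp (l\<^sup>2)) ^ N)"
  proof (rule sum_mono)
    fix S
    have "(\<Sum>\<eta>\<in>Pow {..<N}. exp (l * X \<eta> S))
        = (\<Prod>k<N. exp (l * of_bool (k \<in> S)) + exp (- (l * of_bool (k \<in> S))))"
      unfolding X_def by (rule sum_exp_signs)
    also have "\<dots> \<le> (\<Prod>k<N. 2 * exp (l\<^sup>2))"
      using cosh_le_exp[OF l] by (intro prod_mono) (auto simp: add_nonneg_nonneg)
    finally show "(\<Sum>\<eta>\<in>Pow {..<N}. exp (l * X \<eta> S)) \<le> (2 * exp (l\<^sup>2)) ^ N" by simp
  qed
  also have "\<dots> = 2 ^ N * (card \<F> * exp (N * l\<^sup>2))"
    by (simp add: power_mult_distrib exp_of_nat_mult)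
  finally have "exp (l * (c * N)) \<le> card \<F> * exp (N * l\<^sup>2)" by simp
  then have "exp (l * (c * N) - N * l\<^sup>2) \<le> card \<F>" by (simp add: exp_diff divide_le_eq)
  moreover have "l * (c * N) - N * l\<^sup>2 = c\<^sup>2 * N / 4"
    by (simp add: l_def power2_eq_square field_simps)
  ultimately show ?thesis by simp
qed

lemma sum_sgn_of: "k < N \<Longrightarrow> (\<Sum>\<eta>\<in>Pow {..<N}. sgn_of \<eta> k) = 0"
proof (induction N)
  case (Suc N)
  show ?case
  proof (cases "k = N")
    case True
    have "sgn_of \<eta> k + sgn_of (insert N \<eta>) k = 0" if "\<eta> \<in> Pow {..<N}" for \<eta>
      using that True by (auto simp: sgn_of_def)
    then show ?thesis unfolding sum_Pow_lessThan_Suc by simp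
  next
    case False
    then have "sgn_of (insert N \<eta>) k = sgn_of \<eta> k" for \<eta> by (auto simp: sgn_of_def)
    then show ?thesis using Suc False by (simp add: sum_Pow_lessThan_Suc flip: sum_distrib_left)
  qed
qed simp

text \<open>Each level has one function for all branches, so this is a fat shattering with the gap
  from \<open>s\<close> to \<open>t\<close>, the branches \<open>\<eta>\<close> indexing the points
  that realize the patterns.\<close>

definition sep_tree :: "'r set \<Rightarrow> ('r \<Rightarrow> 'a \<Rightarrow> real) \<Rightarrow> 'a set \<Rightarrow> real \<Rightarrow> real \<Rightarrow> nat \<Rightarrow> bool" where
  "sep_tree R f X s t N \<longleftrightarrow> (\<exists>r b. (\<forall>i<N. r i \<in> R) \<and> (\<forall>\<eta>\<subseteq>{..<N}. b \<eta> \<in> X \<and>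
     (\<forall>i<N. (i \<in> \<eta> \<longrightarrow> t < f (r i) (b \<eta>)) \<and> (i \<notin> \<eta> \<longrightarrow> f (r i) (b \<eta>) < s))))"

lemma exp_beats_power:
  fixes c :: real and d :: nat assumes "0 < c" shows "\<exists>N::nat. (real N + 1) ^ d < exp (c * N)"
proof -
  have "((\<lambda>x::real. x ^ d / exp x) \<longlongrightarrow> 0) at_top" by (rule tendsto_power_div_exp_0)
  moreover have "filterlim (\<lambda>N::nat. c * (real N + 1)) at_top sequentially"
    using assms by real_asymp
  ultimately have "((\<lambda>N::nat. (c * (real N + 1)) ^ d / exp (c * (real N + 1))) \<longlongrightarrow> 0) sequentially"
    by (rule filterlim_compose)
  \<comment> \<open>The threshold \<open>c ^ d / exp c\<close> compensates for evaluating at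
    \<open>c * (N + 1)\<close> instead of comparing \<open>N + 1\<close> with
    \<open>exp (c * N)\<close> directly.\<close>
  then have "eventually (\<lambda>N::nat. (c * (real N + 1)) ^ d / exp (c * (real N + 1)) < c ^ d / exp c) sequentially"
    by (rule order_tendstoD) (use assms in auto)
  then obtain N :: nat where "(c * (real N + 1)) ^ d / exp (c * (real N + 1)) < c ^ d / exp c"
    by (auto simp: eventually_sequentially)
  then have "(c * (real N + 1)) ^ d < c ^ d * exp (c * N)"
    by (simp add: field_simps exp_add)
  then have "c ^ d * (real N + 1) ^ d < c ^ d * exp (c * N)"
    by (simp only: power_mult_distrib)
  then have "(real N + 1) ^ d < exp (c * N)" using assms by simp
  then show ?thesis ..
qed

text \<open>
  A convex combination correlates with the coin tosses no better than one of its members, so a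
  separating tree for the convex hull yields one function per level for which
  the traces of the \<open>2\<^sup>N\<close> points correlate with the tosses; by Massart there are exponentially many of
  these traces, against Sauer-Shelah.
\<close>

theorem no_sep_tree_convex_hull:
  fixes Q :: "'a \<Rightarrow> 'p \<Rightarrow> bool" and w :: "'r \<Rightarrow> 'p \<Rightarrow> real" and d :: nat
  assumes vc: "\<nexists>a (b :: nat set \<Rightarrow> 'a). \<forall>I\<subseteq>{..<d}. \<forall>i<d. Q (b I) (a i) \<longleftrightarrow> i \<in> I"
    and w: "\<And>r. r \<in> R \<Longrightarrow> finite (P r)" "\<And>r p. r \<in> R \<Longrightarrow> p \<in> P r \<Longrightarrow> 0 \<le> w r p"
      "\<And>r. r \<in> R \<Longrightarrow> sum (w r) (P r) = 1"
    and f: "\<And>r x. r \<in> R \<Longrightarrow> x \<in> X \<Longrightarrow> f r x = (\<Sum>p\<in>P r. w r p * of_bool (Q x p))"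
    and st: "s < t"
  shows "\<exists>N. \<not> sep_tree R f X s t N"
proof (rule ccontr)
  assume "\<not> ?thesis"
  then have tree: "sep_tree R f X s t N" for N by auto
  \<comment> \<open>Half the gap is the distance of \<open>s\<close> and \<open>t\<close> from their
    midpoint; the cap at 1 is the range in which \<open>Massart\<close> applies.\<close>
  define c where "c = min 1 ((t - s) / 2)"
  have c: "0 < c" "c \<le> 1" "c \<le> (t - s) / 2" using st unfolding c_def by (simp, simp, linarith)
  obtain N :: nat where N: "(real N + 1) ^ d < exp (c\<^sup>2 / 4 * N)"
    using exp_beats_power[of "c\<^sup>2 / 4" d] c by auto
  obtain r b where rb: "\<forall>i<N. r i \<in> R" "\<forall>\<eta>\<subseteq>{..<N}. b \<eta> \<in> X \<and>
     (\<forall>i<N. (i \<in> \<eta> \<longrightarrow> t < f (r i) (b \<eta>)) \<and> (i \<notin> \<eta> \<longrightarrow> f (r i) (b \<eta>) < s))"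
    using tree[of N] unfolding sep_tree_def by blast
  then have r: "\<And>i. i < N \<Longrightarrow> r i \<in> R" and b: "\<And>\<eta>. \<eta> \<subseteq> {..<N} \<Longrightarrow> b \<eta> \<in> X"
    and sep: "\<And>\<eta> i. \<lbrakk>\<eta> \<subseteq> {..<N}; i < N; i \<in> \<eta>\<rbrakk> \<Longrightarrow> t < f (r i) (b \<eta>)"
      "\<And>\<eta> i. \<lbrakk>\<eta> \<subseteq> {..<N}; i < N; i \<notin> \<eta>\<rbrakk> \<Longrightarrow> f (r i) (b \<eta>) < s"
    by auto
  \<comment> \<open>The correlation of the single member \<open>p\<close> with the
    \<open>i\<close>-th toss, summed over all outcomes.\<close>
  define g where "g i p = (\<Sum>\<eta>\<in>Pow {..<N}. sgn_of \<eta> i * of_bool (Q (b \<eta>) p))" for i p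
  have "\<exists>p. 2 ^ N * c \<le> g i p" if i: "i < N" for i
  proof (rule ccontr)
    assume no: "\<not> ?thesis"
    have "2 ^ N * c \<le> (\<Sum>\<eta>\<in>Pow {..<N}. (t - s) / 2)" using c(3) by (simp add: card_Pow)
    also have "\<dots> \<le> (\<Sum>\<eta>\<in>Pow {..<N}. sgn_of \<eta> i * (f (r i) (b \<eta>) - (s + t) / 2))"
    proof (rule sum_mono)
      fix \<eta> assume "\<eta> \<in> Pow {..<N}"
      then show "(t - s) / 2 \<le> sgn_of \<eta> i * (f (r i) (b \<eta>) - (s + t) / 2)"
        using sep[of \<eta> i] i by (auto simp: sgn_of_def field_simps)
    qed
    \<comment> \<open>Centring at the midpoint costs nothing, because the signs of one toss sum to
      zero.\<close>
    also have "\<dots> = (\<Sum>\<eta>\<in>Pow {..<N}. sgn_of \<eta> i * f (r i) (b \<eta>)) - (s + t) / 2 * (\<Sum>\<eta>\<in>Pow {..<N}. sgn_of \<eta> i)"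
      unfolding sum_distrib_left sum_subtractf[symmetric] by (simp add: algebra_simps)
    also have "\<dots> = (\<Sum>\<eta>\<in>Pow {..<N}. sgn_of \<eta> i * f (r i) (b \<eta>))"
      using sum_sgn_of[OF i] by simp
    also have "\<dots> = (\<Sum>\<eta>\<in>Pow {..<N}. \<Sum>p\<in>P (r i). w (r i) p * (sgn_of \<eta> i * of_bool (Q (b \<eta>) p)))"
      by (intro sum.cong refl) (simp add: f r i b sum_distrib_left algebra_simps)
    also have "\<dots> = (\<Sum>p\<in>P (r i). w (r i) p * g i p)"
      unfolding g_def sum_distrib_left by (rule sum.swap)
    also have "\<dots> < (\<Sum>p\<in>P (r i). w (r i) p * (2 ^ N * c))"
    proof -
      have "\<exists>p\<in>P (r i). w (r i) p \<noteq> 0"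
        using w(3)[OF r[OF i]] by (metis sum.neutral zero_neq_one)
      then obtain p where "p \<in> P (r i)" "0 < w (r i) p" using w(2)[OF r[OF i]] by force
      then show ?thesis
        using no w(1,2)[OF r[OF i]]
        by (intro sum_strict_mono_ex1) (auto intro!: mult_left_mono bexI[of _ p] simp: not_le less_imp_le)
    qed
    also have "\<dots> = 2 ^ N * c" using w(3)[OF r[OF i]] by (simp flip: sum_distrib_right)
    finally show False by simp
  qed
  then obtain a where a: "\<And>i. i < N \<Longrightarrow> 2 ^ N * c \<le> g i (a i)" by metis
  define tr where "tr \<eta> = {i. i < N \<and> Q (b \<eta>) (a i)}" for \<eta>
  define \<F> where "\<F> = tr ` Pow {..<N}"
  have "exp (c\<^sup>2 * N / 4) \<le> card \<F>"
  proof (rule Massart)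
    have "2 ^ N * (c * N) = (\<Sum>i<N. 2 ^ N * c)" by simp
    also have "\<dots> \<le> (\<Sum>i<N. g i (a i))" by (rule sum_mono) (use a in auto)
    also have "\<dots> = (\<Sum>\<eta>\<in>Pow {..<N}. \<Sum>k<N. sgn_of \<eta> k * of_bool (Q (b \<eta>) (a k)))"
      unfolding g_def by (rule sum.swap)
    also have "\<dots> = (\<Sum>\<eta>\<in>Pow {..<N}. \<Sum>k<N. sgn_of \<eta> k * of_bool (k \<in> tr \<eta>))"
      by (intro sum.cong refl) (simp add: tr_def)
    finally show "2 ^ N * (c * N) \<le> (\<Sum>\<eta>\<in>Pow {..<N}. \<Sum>k<N. sgn_of \<eta> k * of_bool (k \<in> tr \<eta>))" .
  qed (use c in \<open>auto simp: \<F>_def\<close>)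
  moreover have "card \<F> \<le> (N + 1) ^ d"
  proof (rule Sauer_Shelah)
    show "\<F> \<subseteq> Pow {..<N}" by (auto simp: \<F>_def tr_def)
  next
    fix S assume S: "S \<subseteq> {..<N}" "shattered \<F> S"
    show "card S \<le> d"
    proof (rule ccontr)
      assume "\<not> card S \<le> d"
      \<comment> \<open>A shattered set with more than \<open>d\<close> points has a subset of
        exactly \<open>d\<close>; enumerating it produces the pattern excluded by
        \<open>vc\<close>.\<close>
      then obtain S' where S': "S' \<subseteq> S" "card S' = d" "finite S'"
        by (metis nat_le_linear obtain_subset_with_card_n)
      then obtain h where h: "bij_betw h {..<d} S'"
        using ex_bij_betw_nat_finite[OF S'(3)] by (auto simp: lessThan_atLeast0)
      have "\<exists>x. \<forall>i<d. Q x (a (h i)) \<longleftrightarrow> i \<in> I" if I: "I \<subseteq> {..<d}" for I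
      proof -
        have "h ` I \<subseteq> S" using h I S'(1) by (auto simp: bij_betw_def)
        then obtain R' where R': "R' \<in> \<F>" "R' \<inter> S = h ` I"
          using S(2) unfolding shattered_def by metis
        then obtain \<eta> where \<eta>: "\<eta> \<subseteq> {..<N}" "tr \<eta> \<inter> S = h ` I"
          unfolding \<F>_def by (metis imageE PowD)
        have "Q (b \<eta>) (a (h i)) \<longleftrightarrow> i \<in> I" if "i < d" for i
        proof -
          have hi: "h i \<in> S" "h i < N" using h that S'(1) S(1) by (auto simp: bij_betw_def)
          then have "Q (b \<eta>) (a (h i)) \<longleftrightarrow> h i \<in> tr \<eta> \<inter> S" by (simp add: tr_def)
          also have "\<dots> \<longleftrightarrow> i \<in> I"
            unfolding \<eta>(2) using h I that by (auto simp: bij_betw_def inj_on_def)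
          finally show ?thesis .
        qed
        then show ?thesis by blast
      qed
      then have "\<forall>I. \<exists>x. I \<subseteq> {..<d} \<longrightarrow> (\<forall>i<d. Q x (a (h i)) \<longleftrightarrow> i \<in> I)" by blast
      then obtain b' where "\<forall>I\<subseteq>{..<d}. \<forall>i<d. Q (b' I) (a (h i)) \<longleftrightarrow> i \<in> I" by metis
      then have "\<exists>a (b :: nat set \<Rightarrow> 'a). \<forall>I\<subseteq>{..<d}. \<forall>i<d. Q (b I) (a i) \<longleftrightarrow> i \<in> I"
        by (intro exI[of _ "\<lambda>i. a (h i)"] exI[of _ b'])
      with vc show False by contradiction
    qed
  qed
  then have "real (card \<F>) \<le> real ((N + 1) ^ d)" by (simp only: of_nat_le_iff)
  ultimately have "exp (c\<^sup>2 * N / 4) \<le> (real N + 1) ^ d" by (simp add: add.commute)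
  then show False using N by simp
qed

section \<open>Regular Borel measures on a Stone space\<close>

lemma openin_topology_generated_by_basis:
  assumes int: "\<And>a b. a \<in> \<B> \<Longrightarrow> b \<in> \<B> \<Longrightarrow> a \<inter> b \<in> \<B>"
    and "openin (topology_generated_by \<B>) U" "x \<in> U"
  obtains b where "b \<in> \<B>" "x \<in> b" "b \<subseteq> U"
proof -
  have "generate_topology_on \<B> U" using assms(2) by (simp add: openin_topology_generated_by_iff)
  then have "\<forall>x\<in>U. \<exists>b\<in>\<B>. x \<in> b \<and> b \<subseteq> U"
  proof induction
    case (Int a b)
    show ?case
    proof
      fix x assume "x \<in> a \<inter> b"
      then obtain a' b' where "a' \<in> \<B>" "b' \<in> \<B>" "x \<in> a' \<inter> b'" "a' \<subseteq> a" "b' \<subseteq> b" using Int by blast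
      then show "\<exists>c\<in>\<B>. x \<in> c \<and> c \<subseteq> a \<inter> b" using int by (intro bexI[of _ "a' \<inter> b'"]) auto
    qed
  next
    case (UN K) then show ?case by (meson UnionE Union_upper subset_trans)
  qed auto
  then show ?thesis using that assms(3) by blast
qed

text \<open>Abstracts a type space with the algebra of its definable clopen sets; the analysis that
  follows sees only this.\<close>

locale stone_space = algebra \<Omega> \<B> for \<Omega> :: "'a set" and \<B> :: "'a set set" +
  assumes finite_subcover: "\<And>\<C>. \<C> \<subseteq> \<B> \<Longrightarrow> \<Union>\<C> = \<Omega> \<Longrightarrow> \<exists>\<D>\<subseteq>\<C>. finite \<D> \<and> \<Union>\<D> = \<Omega>"
begin

definition X :: "'a topology" where "X = topology_generated_by \<B>"

lemma topspace_X [simp]: "topspace X = \<Omega>"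
  using sets_into_space by (auto simp: X_def)

lemma openin_basic: "b \<in> \<B> \<Longrightarrow> openin X b"
  by (simp add: X_def topology_generated_by_Basis)

lemma closedin_basic: "b \<in> \<B> \<Longrightarrow> closedin X b"
  using openin_basic[of "\<Omega> - b"] sets_into_space[of b] by (simp add: closedin_def compl_sets)

lemma openin_basis: "openin X U \<Longrightarrow> x \<in> U \<Longrightarrow> \<exists>b\<in>\<B>. x \<in> b \<and> b \<subseteq> U"
  unfolding X_def using openin_topology_generated_by_basis Int by metis

lemma compact_X: "compact_space X"
  unfolding compact_space_alt
proof (intro allI impI, elim conjE)
  fix \<U> assume U: "\<forall>U\<in>\<U>. openin X U" "topspace X \<subseteq> \<Union>\<U>"
  let ?C = "{b \<in> \<B>. \<exists>U\<in>\<U>. b \<subseteq> U}"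
  have "\<Union>?C = \<Omega>"
  proof
    show "\<Union>?C \<subseteq> \<Omega>" using sets_into_space by auto
    show "\<Omega> \<subseteq> \<Union>?C"
    proof
      fix x assume "x \<in> \<Omega>"
      then obtain U where "U \<in> \<U>" "x \<in> U" using U(2) by auto
      then obtain b where "b \<in> \<B>" "x \<in> b" "b \<subseteq> U" using openin_basis U(1) by blast
      then show "x \<in> \<Union>?C" using \<open>U \<in> \<U>\<close> by blast
    qed
  qed
  then obtain \<D> where D: "\<D> \<subseteq> ?C" "finite \<D>" "\<Union>\<D> = \<Omega>" using finite_subcover[of ?C] by auto
  then have "\<forall>b\<in>\<D>. \<exists>U\<in>\<U>. b \<subseteq> U" by auto
  then obtain g where g: "\<And>b. b \<in> \<D> \<Longrightarrow> g b \<in> \<U> \<and> b \<subseteq> g b" by metis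
  have "finite (g ` \<D>)" "g ` \<D> \<subseteq> \<U>" using D(2) g by auto
  moreover have "topspace X \<subseteq> \<Union>(g ` \<D>)" using D(3) g by fastforce
  ultimately show "\<exists>\<F>. finite \<F> \<and> \<F> \<subseteq> \<U> \<and> topspace X \<subseteq> \<Union>\<F>" by blast
qed

lemma closedin_finite_subcover:
  assumes "closedin X K" "\<And>U. U \<in> \<U> \<Longrightarrow> openin X U" "K \<subseteq> \<Union>\<U>"
  obtains \<F> where "finite \<F>" "\<F> \<subseteq> \<U>" "K \<subseteq> \<Union>\<F>"
  using closedin_compact_space[OF compact_X assms(1)] assms(2,3) unfolding compactin_def by metis

lemma closedin_basic_cover:
  assumes K: "closedin X K" and cov: "\<And>x. x \<in> K \<Longrightarrow> \<exists>b\<in>\<B>. x \<in> b \<and> P b"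
  shows "\<exists>F. finite F \<and> F \<subseteq> \<B> \<and> (\<forall>b\<in>F. P b) \<and> K \<subseteq> \<Union>F"
proof -
  obtain F where "finite F" "F \<subseteq> {b \<in> \<B>. P b}" "K \<subseteq> \<Union>F"
  proof (rule closedin_finite_subcover[OF K, of "{b \<in> \<B>. P b}"])
    show "K \<subseteq> \<Union>{b \<in> \<B>. P b}" using cov by blast
  qed (use openin_basic in auto)
  then show ?thesis by (intro exI[of _ F]) auto
qed

text \<open>Through this, a set squeezed tightly between a closed and an open set is close in
  measure to a basic one.\<close>

lemma between:
  assumes "closedin X K" "openin X U" "K \<subseteq> U"
  obtains b where "b \<in> \<B>" "K \<subseteq> b" "b \<subseteq> U"
proof -
  have "\<exists>b\<in>\<B>. x \<in> b \<and> b \<subseteq> U" if "x \<in> K" for x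
    using openin_basis[OF assms(2)] assms(3) that by blast
  from closedin_basic_cover[OF assms(1) this]
  obtain F where F: "finite F" "F \<subseteq> \<B>" "\<forall>b\<in>F. b \<subseteq> U" "K \<subseteq> \<Union>F" by metis
  have "\<Union>F \<in> \<B>" using F(1,2) by (rule finite_Union)
  then show ?thesis using that[of "\<Union>F"] F by blast
qed

lemma sets_borel_of_top: "sets (borel_of_top X) = sigma_sets \<Omega> {U. openin X U}"
  unfolding borel_of_top_def using openin_subset[of X] by (simp add: subset_iff)

lemma space_borel_of_top [simp]: "space (borel_of_top X) = \<Omega>"
  by (simp add: borel_of_top_def space_measure_of_conv)

lemma open_borel: "openin X U \<Longrightarrow> U \<in> sets (borel_of_top X)"
  by (auto simp: sets_borel_of_top)

lemma closed_borel: "closedin X K \<Longrightarrow> K \<in> sets (borel_of_top X)"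
  using sets.compl_sets[OF open_borel, of "\<Omega> - K"] closedin_subset[of X K]
  by (simp add: closedin_def double_diff)

text \<open>One basic set between \<open>K \<union> K'\<close> and \<open>U \<inter> U'\<close>
  approximates \<open>B\<close> in both measures at once, and on basic sets they agree.\<close>

lemma regular_borel_prob_unique:
  assumes N: "regular_borel_prob X N" and N': "regular_borel_prob X N'"
    and eq: "\<And>b. b \<in> \<B> \<Longrightarrow> measure N b = measure N' b"
  shows "N = N'"
proof -
  interpret N: prob_space N using N by (simp add: regular_borel_prob_def)
  interpret N': prob_space N' using N' by (simp add: regular_borel_prob_def)
  have sets: "sets N = sets (borel_of_top X)" "sets N' = sets (borel_of_top X)"
    using N N' by (auto simp: regular_borel_prob_def)
  have "measure N B = measure N' B" if B: "B \<in> sets N" for B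
  proof -
    have close: "\<bar>measure N B - measure N' B\<bar> \<le> 2 * \<epsilon>" if e: "\<epsilon> > 0" for \<epsilon>
    proof -
      obtain K U where KU: "closedin X K" "openin X U" "K \<subseteq> B" "B \<subseteq> U" "measure N (U - K) < \<epsilon>"
        using N B e unfolding regular_borel_prob_def by metis
      obtain K' U' where KU': "closedin X K'" "openin X U'" "K' \<subseteq> B" "B \<subseteq> U'" "measure N' (U' - K') < \<epsilon>"
        using N' B e sets unfolding regular_borel_prob_def by metis
      obtain b where b: "b \<in> \<B>" "K \<union> K' \<subseteq> b" "b \<subseteq> U \<inter> U'"
        by (rule between[of "K \<union> K'" "U \<inter> U'"]) (use KU KU' in auto)
      note [simp] = sets closed_borel[OF KU(1)] open_borel[OF KU(2)] closed_borel[OF KU'(1)]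
        open_borel[OF KU'(2)] closed_borel[OF closedin_basic[OF b(1)]]
      have [simp]: "B \<in> sets (borel_of_top X)" using B sets by simp
      have [simp]: "U - K \<in> sets (borel_of_top X)" "U' - K' \<in> sets (borel_of_top X)" by auto
      have "\<bar>measure N B - measure N b\<bar> \<le> measure N (U - K)"
      proof -
        have "measure N B \<le> measure N (b \<union> (U - K))" "measure N b \<le> measure N (B \<union> (U - K))"
          using b KU by (intro N.finite_measure_mono; auto)+
        moreover have "measure N (b \<union> (U - K)) \<le> measure N b + measure N (U - K)"
          "measure N (B \<union> (U - K)) \<le> measure N B + measure N (U - K)"
          by (auto intro!: measure_Un_le)
        ultimately show ?thesis by linarith
      qed
      moreover have "\<bar>measure N' B - measure N' b\<bar> \<le> measure N' (U' - K')"
      proof -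
        have "measure N' B \<le> measure N' (b \<union> (U' - K'))" "measure N' b \<le> measure N' (B \<union> (U' - K'))"
          using b KU' by (intro N'.finite_measure_mono; auto)+
        moreover have "measure N' (b \<union> (U' - K')) \<le> measure N' b + measure N' (U' - K')"
          "measure N' (B \<union> (U' - K')) \<le> measure N' B + measure N' (U' - K')"
          by (auto intro!: measure_Un_le)
        ultimately show ?thesis by linarith
      qed
      ultimately show ?thesis using eq[OF b(1)] KU(5) KU'(5) by linarith
    qed
    have "\<bar>measure N B - measure N' B\<bar> \<le> 0"
    proof (rule field_le_epsilon)
      fix \<epsilon> :: real assume "0 < \<epsilon>"
      then show "\<bar>measure N B - measure N' B\<bar> \<le> 0 + \<epsilon>"
        using close[of "\<epsilon> / 2"] by simp
    qed
    then show ?thesis by simp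
  qed
  then show ?thesis
    using sets by (intro measure_eqI) (simp_all add: N.emeasure_eq_measure N'.emeasure_eq_measure)
qed

end

section \<open>Caratheodory extension of a content to a regular Borel measure\<close>

locale stone_content = stone_space \<Omega> \<B> for \<Omega> :: "'a set" and \<B> :: "'a set set" +
  fixes \<mu> :: "'a set \<Rightarrow> real"
  assumes nonneg: "\<And>b. b \<in> \<B> \<Longrightarrow> 0 \<le> \<mu> b" and mass: "\<mu> \<Omega> = 1"
    and add: "\<And>a b. \<lbrakk>a \<in> \<B>; b \<in> \<B>; a \<inter> b = {}\<rbrakk> \<Longrightarrow> \<mu> (a \<union> b) = \<mu> a + \<mu> b"
begin

lemma content_empty [simp]: "\<mu> {} = 0"
  using add[of "{}" "{}"] by simp

lemma content_mono: "a \<in> \<B> \<Longrightarrow> b \<in> \<B> \<Longrightarrow> a \<subseteq> b \<Longrightarrow> \<mu> a \<le> \<mu> b"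
  using add[OF _ Diff, of a b a] nonneg[OF Diff, of b a] by (simp add: Un_absorb1)

lemma content_le_1: "b \<in> \<B> \<Longrightarrow> \<mu> b \<le> 1"
  using content_mono[of b \<Omega>] sets_into_space mass by auto

lemma content_Union_le: "finite I \<Longrightarrow> (\<And>i. i \<in> I \<Longrightarrow> c i \<in> \<B>) \<Longrightarrow> \<mu> (\<Union>i\<in>I. c i) \<le> (\<Sum>i\<in>I. \<mu> (c i))"
proof (induction I rule: finite_induct)
  case (insert i I)
  let ?u = "\<Union>i\<in>I. c i"
  have u: "?u \<in> \<B>" using insert by (intro finite_UN) auto
  have "(\<Union>j\<in>insert i I. c j) = c i \<union> (?u - c i)" by auto
  then have "\<mu> (\<Union>j\<in>insert i I. c j) = \<mu> (c i) + \<mu> (?u - c i)"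
    using add[of "c i" "?u - c i"] u insert by auto
  moreover have "\<mu> (?u - c i) \<le> \<mu> ?u" using u insert by (intro content_mono) auto
  ultimately show ?case using insert by simp
qed simp

text \<open>The value that inner regularity forces on an open set; \<open>outer\<close> then extends
  it by outer regularity.\<close>

definition inner :: "'a set \<Rightarrow> ennreal" where
  "inner U = (SUP b\<in>{b \<in> \<B>. b \<subseteq> U}. ennreal (\<mu> b))"

definition outer :: "'a set \<Rightarrow> ennreal" where
  "outer E = (INF U\<in>{U. openin X U \<and> E \<subseteq> U}. inner U)"

lemma inner_upper: "b \<in> \<B> \<Longrightarrow> b \<subseteq> U \<Longrightarrow> ennreal (\<mu> b) \<le> inner U"
  unfolding inner_def by (rule SUP_upper) auto

lemma inner_mono: "U \<subseteq> V \<Longrightarrow> inner U \<le> inner V"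
  unfolding inner_def by (rule SUP_subset_mono) auto

lemma inner_basic: "b \<in> \<B> \<Longrightarrow> inner b = ennreal (\<mu> b)"
  unfolding inner_def by (rule antisym) (auto intro!: SUP_least SUP_upper ennreal_leI content_mono)

lemma inner_le_1: "inner U \<le> 1"
  unfolding inner_def by (auto intro!: SUP_least simp: content_le_1 ennreal_le_1)

lemma outer_open: "openin X U \<Longrightarrow> outer U = inner U"
  unfolding outer_def by (rule antisym) (auto intro!: INF_lower INF_greatest inner_mono)

lemma outer_mono: "E \<subseteq> F \<Longrightarrow> outer E \<le> outer F"
  unfolding outer_def by (rule INF_superset_mono) auto

lemma outer_le_1: "E \<subseteq> \<Omega> \<Longrightarrow> outer E \<le> 1"
  using outer_mono[of E \<Omega>] outer_open[of \<Omega>] inner_le_1[of \<Omega>] openin_topspace[of X] by simp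

lemma outer_approx:
  assumes "E \<subseteq> \<Omega>" "\<epsilon> > 0"
  obtains U where "openin X U" "E \<subseteq> U" "inner U < outer E + ennreal \<epsilon>"
proof -
  have "outer E < outer E + ennreal \<epsilon>"
    using outer_le_1[OF assms(1)] assms(2)
    by (metis add.right_neutral ennreal_add_left_cancel_less ennreal_less_zero_iff ennreal_one_less_top
        infinity_ennreal_def leD top.not_eq_extremum)
  then show ?thesis using that unfolding outer_def INF_less_iff by auto
qed

text \<open>A basic subset of the union is compact, so finitely many basic sets, each inside one
  \<open>U n\<close>, cover it. Grouping them by \<open>n\<close> reduces countable to finite
  subadditivity.\<close>

lemma inner_UN:
  fixes U :: "nat \<Rightarrow> 'a set"
  assumes U: "\<And>n. openin X (U n)"
  shows "inner (\<Union>n. U n) \<le> (\<Sum>n. inner (U n))"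
  unfolding inner_def[of "\<Union>n. U n"]
proof (rule SUP_least, clarify)
  fix b assume b: "b \<in> \<B>" "b \<subseteq> (\<Union>n. U n)"
  have "\<exists>c\<in>\<B>. x \<in> c \<and> (\<exists>n. c \<subseteq> U n)" if x: "x \<in> b" for x
  proof -
    obtain n where "x \<in> U n" using x b by auto
    then show ?thesis using openin_basis[OF U] by blast
  qed
  from closedin_basic_cover[OF closedin_basic[OF b(1)] this]
  obtain F where F: "finite F" "F \<subseteq> \<B>" "\<forall>c\<in>F. \<exists>n. c \<subseteq> U n" "b \<subseteq> \<Union>F" by metis
  from F(3) obtain k where k: "\<And>c. c \<in> F \<Longrightarrow> c \<subseteq> U (k c)" by metis
  define d where "d n = \<Union>{c \<in> F. k c = n}" for n
  have d: "d n \<in> \<B>" "d n \<subseteq> U n" for n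
    using F(1,2) k by (auto simp: d_def intro!: finite_Union dest: subsetD[OF k])
  have "b \<subseteq> (\<Union>n\<in>k ` F. d n)" using F(4) unfolding d_def by blast
  then have "\<mu> b \<le> \<mu> (\<Union>n\<in>k ` F. d n)" using F(1) b d by (intro content_mono finite_UN) auto
  also have "\<dots> \<le> (\<Sum>n\<in>k ` F. \<mu> (d n))" using F(1) d by (intro content_Union_le) auto
  finally have "ennreal (\<mu> b) \<le> (\<Sum>n\<in>k ` F. ennreal (\<mu> (d n)))"
    using d nonneg by (simp add: ennreal_leI sum_ennreal)
  also have "\<dots> \<le> (\<Sum>n\<in>k ` F. inner (U n))" using d by (intro sum_mono inner_upper) auto
  also have "\<dots> \<le> (\<Sum>n. inner (U n))" using F(1) by (intro sum_le_suminf) auto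
  finally show "ennreal (\<mu> b) \<le> (\<Sum>n. inner (U n))" .
qed

lemma outer_measure_space_outer: "outer_measure_space (Pow \<Omega>) outer"
  unfolding outer_measure_space_def
proof (intro conjI)
  show "positive (Pow \<Omega>) outer"
    using outer_open[of "{}"] inner_basic[of "{}"] by (simp add: positive_def)
  show "increasing (Pow \<Omega>) outer" by (auto simp: increasing_def outer_mono)
  show "countably_subadditive (Pow \<Omega>) outer"
    unfolding countably_subadditive_def
  proof (intro allI impI)
    fix E :: "nat \<Rightarrow> 'a set" assume E: "range E \<subseteq> Pow \<Omega>"
    show "outer (\<Union>i. E i) \<le> (\<Sum>i. outer (E i))"
    proof (rule ennreal_le_epsilon)
      fix \<epsilon> :: real assume "0 < \<epsilon>"
      \<comment> \<open>Errors that sum to \<epsilon>.\<close>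
      define d where "d n = \<epsilon> * (1 / 2) ^ Suc n" for n
      have d: "d n > 0" for n using \<open>0 < \<epsilon>\<close> by (simp add: d_def)
      have "\<exists>U. openin X U \<and> E n \<subseteq> U \<and> inner U < outer (E n) + ennreal (d n)" for n
        using outer_approx[OF _ d, of "E n" n] E by (metis Pow_iff range_subsetD)
      then obtain U where U: "\<And>n. openin X (U n)" "\<And>n. E n \<subseteq> U n"
        "\<And>n. inner (U n) < outer (E n) + ennreal (d n)" by metis
      have "openin X (\<Union>n. U n)" using U by (intro openin_Union) auto
      then have "outer (\<Union>i. E i) \<le> inner (\<Union>n. U n)"
        unfolding outer_def using U(2) by (intro INF_lower) auto
      also have "\<dots> \<le> (\<Sum>n. inner (U n))" using U(1) by (rule inner_UN)
      also have "\<dots> \<le> (\<Sum>n. outer (E n) + ennreal (d n))"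
        using U(3) by (intro suminf_le) (auto intro: less_imp_le)
      also have "\<dots> = (\<Sum>n. outer (E n)) + (\<Sum>n. ennreal (d n))" by (rule suminf_add[symmetric]) auto
      also have "(\<Sum>n. ennreal (d n)) = ennreal \<epsilon>"
        using sums_mult[OF power_half_series, of \<epsilon>] d
        by (intro suminf_ennreal_eq) (auto simp: d_def less_imp_le)
      finally show "outer (\<Union>i. E i) \<le> (\<Sum>i. outer (E i)) + ennreal \<epsilon>" .
    qed
  qed
qed

lemma inner_split:
  assumes "b \<in> \<B>" "b \<subseteq> W" shows "ennreal (\<mu> b) + inner (W - b) \<le> inner W"
proof -
  have "ennreal (\<mu> b) + inner (W - b) = (SUP c\<in>{c \<in> \<B>. c \<subseteq> W - b}. ennreal (\<mu> b) + ennreal (\<mu> c))"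
    unfolding inner_def by (rule ennreal_SUP_add_right) (auto intro!: exI[of _ "{}"])
  also have "\<dots> \<le> inner W"
  proof (rule SUP_least, clarify)
    fix c assume c: "c \<in> \<B>" "c \<subseteq> W - b"
    then have "ennreal (\<mu> b) + ennreal (\<mu> c) = ennreal (\<mu> (b \<union> c))"
      using assms nonneg by (subst add) auto
    then show "ennreal (\<mu> b) + ennreal (\<mu> c) \<le> inner W"
      using inner_upper[of "b \<union> c" W] c assms by auto
  qed
  finally show ?thesis .
qed

text \<open>Caratheodory measurability of open sets. \<open>E\<close> is replaced by an open
  \<open>W\<close> of nearly the same outer measure, and a basic \<open>b\<close> inside
  \<open>U \<inter> W\<close> splits \<open>W\<close> into \<open>b\<close> and the open set
  \<open>W - b\<close>; the supremum over \<open>b\<close> gives the claim.\<close>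

lemma open_lambda_system:
  assumes U: "openin X U" shows "U \<in> lambda_system \<Omega> (Pow \<Omega>) outer"
proof -
  interpret P: algebra \<Omega> "Pow \<Omega>" by (rule algebra_Pow)
  have "outer (U \<inter> E) + outer (E - U) = outer E" if E: "E \<subseteq> \<Omega>" for E
  proof (rule antisym)
    show "outer (U \<inter> E) + outer (E - U) \<le> outer E"
    proof (rule ennreal_le_epsilon)
      fix \<epsilon> :: real assume e: "0 < \<epsilon>"
      obtain W where W: "openin X W" "E \<subseteq> W" "inner W < outer E + ennreal \<epsilon>"
        using outer_approx[OF E e] by blast
      have WU: "openin X (U \<inter> W)" using U W by auto
      have "outer (U \<inter> E) + outer (E - U) \<le> inner (U \<inter> W) + outer (E - U)"
        using outer_mono[of "U \<inter> E" "U \<inter> W"] outer_open[OF WU] W(2) by (intro add_right_mono) auto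
      also have "\<dots> = (SUP b\<in>{b \<in> \<B>. b \<subseteq> U \<inter> W}. ennreal (\<mu> b) + outer (E - U))"
        unfolding inner_def by (rule ennreal_SUP_add_left[symmetric]) (auto intro!: exI[of _ "{}"])
      also have "\<dots> \<le> inner W"
      proof (rule SUP_least, clarify)
        fix b assume b: "b \<in> \<B>" "b \<subseteq> U \<inter> W"
        have "openin X (W - b)" using W(1) closedin_basic[OF b(1)] by auto
        then have "outer (E - U) \<le> inner (W - b)"
          unfolding outer_def using W(2) b(2) by (intro INF_lower) auto
        then show "ennreal (\<mu> b) + outer (E - U) \<le> inner W"
          using inner_split[OF b(1), of W] b(2) by (meson add_left_mono le_inf_iff order_trans)
      qed
      finally show "outer (U \<inter> E) + outer (E - U) \<le> outer E + ennreal \<epsilon>" using W(3) by auto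
    qed
    have "(U \<inter> E) \<union> (E - U) = E" by auto
    have "countably_subadditive (Pow \<Omega>) outer" "positive (Pow \<Omega>) outer"
      using outer_measure_space_outer by (auto simp: outer_measure_space_def)
    then have "subadditive (Pow \<Omega>) outer"
      using P.countably_subadditive_subadditive by blast
    then have "outer ((U \<inter> E) \<union> (E - U)) \<le> outer (U \<inter> E) + outer (E - U)"
      using E by (intro subadditiveD) auto
    then show "outer E \<le> outer (U \<inter> E) + outer (E - U)"
      using \<open>(U \<inter> E) \<union> (E - U) = E\<close> by simp
  qed
  then show ?thesis
    using openin_subset[OF U] by (auto simp: P.lambda_system_eq Int_commute)
qed

text \<open>Outer regularity is built into \<open>outer\<close>; applied to the complement it gives
  the closed set inside.\<close>

theorem regular_borel_prob_exists:
  obtains N where "regular_borel_prob X N" "\<And>b. b \<in> \<B> \<Longrightarrow> measure N b = \<mu> b"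
proof -
  define N where "N = measure_of \<Omega> {U. openin X U} outer"
  interpret P: sigma_algebra \<Omega> "Pow \<Omega>" by (rule sigma_algebra_Pow)
  let ?S = "sigma_sets \<Omega> {U. openin X U}"
  have ms: "measure_space \<Omega> (lambda_system \<Omega> (Pow \<Omega>) outer) outer"
    using P.caratheodory_lemma[OF outer_measure_space_outer] .
  have opens: "{U. openin X U} \<subseteq> Pow \<Omega>" using openin_subset[of X] by auto
  have "?S \<subseteq> lambda_system \<Omega> (Pow \<Omega>) outer"
    using ms open_lambda_system by (intro sigma_algebra.sigma_sets_subset) (auto simp: measure_space_def)
  then have "measure_space \<Omega> ?S outer"
    using ms opens by (auto intro: measure_down sigma_algebra_sigma_sets)
  then have em: "emeasure N B = outer B" if "B \<in> ?S" for B
    unfolding N_def using that opens by (intro emeasure_measure_of) (auto simp: measure_space_def N_def)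
  have sets: "sets N = ?S" "space N = \<Omega>"
    unfolding N_def using opens by (auto simp: space_measure_of_conv)
  have setsN: "sets N = sets (borel_of_top X)" by (simp add: sets sets_borel_of_top)
  have "emeasure N (space N) = 1"
    using em[of \<Omega>] outer_open[of \<Omega>] openin_topspace[of X] inner_basic[of \<Omega>] mass
    by (simp add: sets sigma_sets_top)
  then interpret N: prob_space N by (rule prob_spaceI)
  have basic: "measure N b = \<mu> b" if "b \<in> \<B>" for b
  proof -
    have "b \<in> ?S" using openin_basic[OF that] by auto
    then show ?thesis
      using em[of b] outer_open[OF openin_basic[OF that]] inner_basic[OF that] nonneg[OF that]
      by (simp add: measure_def)
  qed
  have out: "\<exists>U. openin X U \<and> B \<subseteq> U \<and> measure N (U - B) < \<epsilon>"
    if B: "B \<in> sets N" and e: "\<epsilon> > 0" for B \<epsilon>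
  proof -
    have "B \<subseteq> \<Omega>" using sets.sets_into_space[OF B] sets by simp
    then obtain U where U: "openin X U" "B \<subseteq> U" "inner U < outer B + ennreal \<epsilon>"
      using outer_approx e by blast
    have US: "U \<in> sets N" using U by (auto simp: sets)
    have "ennreal (measure N U) < ennreal (measure N B) + ennreal \<epsilon>"
      using U(3) em[of U] em[of B] US B outer_open[OF U(1)]
      by (simp add: N.emeasure_eq_measure[symmetric] sets)
    then have "measure N U < measure N B + \<epsilon>"
      using e by (simp add: ennreal_less_iff flip: ennreal_plus)
    then have "measure N (U - B) < \<epsilon>"
      using N.finite_measure_Diff[OF US B U(2)] by simp
    then show ?thesis using U by blast
  qed
  have "\<exists>K U. closedin X K \<and> openin X U \<and> K \<subseteq> B \<and> B \<subseteq> U \<and> measure N (U - K) < \<epsilon>"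
    if B: "B \<in> sets N" and e: "\<epsilon> > 0" for B \<epsilon>
  proof -
    have B': "\<Omega> - B \<in> sets N" using sets.compl_sets[OF B] sets by simp
    obtain U where U: "openin X U" "B \<subseteq> U" "measure N (U - B) < \<epsilon> / 2"
      using out[OF B, of "\<epsilon> / 2"] e by auto
    obtain V where V: "openin X V" "\<Omega> - B \<subseteq> V" "measure N (V - (\<Omega> - B)) < \<epsilon> / 2"
      using out[OF B', of "\<epsilon> / 2"] e by auto
    have sU: "U - B \<in> sets N" "V - (\<Omega> - B) \<in> sets N"
      using B B' open_borel[OF U(1)] open_borel[OF V(1)] setsN by auto
    have "measure N (U - (\<Omega> - V)) \<le> measure N ((U - B) \<union> (V - (\<Omega> - B)))"
      using sU U(2) V(2) openin_subset[OF U(1)] by (intro N.finite_measure_mono) auto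
    also have "\<dots> \<le> measure N (U - B) + measure N (V - (\<Omega> - B))"
      using sU by (rule measure_Un_le)
    finally have "measure N (U - (\<Omega> - V)) < \<epsilon>" using U(3) V(3) by linarith
    moreover have "closedin X (\<Omega> - V)" using V(1) by (metis closedin_diff closedin_topspace topspace_X)
    moreover have "\<Omega> - V \<subseteq> B" using V(2) by auto
    ultimately show ?thesis using U by blast
  qed
  then have "regular_borel_prob X N"
    using setsN N.prob_space_axioms by (simp add: regular_borel_prob_def)
  then show ?thesis using that basic by blast
qed

end

section \<open>Pointwise limits of functions without separating trees\<close>

text \<open>Finer filters are smaller, so ultrafilters are the minimal filters other than
  \<open>bot\<close>: if the negation of \<open>P\<close> is not eventual, meeting the filter with
  \<open>P\<close> stays proper and so changes nothing.\<close>

lemma ultrafilter_below: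
  assumes "U \<noteq> (bot :: 'a filter)"
  obtains V where "V \<le> U" "V \<noteq> bot" "\<And>P. eventually P V \<or> eventually (\<lambda>x. \<not> P x) V"
proof -
  let ?A = "{V. V \<le> U \<and> V \<noteq> bot}"
  let ?r = "relation_of (\<ge>) ?A"
  have "\<exists>m\<in>?A. \<forall>a\<in>?A. a \<le> m \<longrightarrow> a = m"
  proof (rule predicate_Zorn)
    show "partial_order_on ?A ?r"
      by (rule partial_order_on_relation_ofI) auto
  next
    fix C assume C: "C \<in> Chains ?r"
    show "\<exists>u\<in>?A. \<forall>a\<in>C. u \<le> a"
    proof (cases "C = {}")
      case True then show ?thesis using assms by auto
    next
      case False
      have CA: "C \<subseteq> ?A" using C by (auto simp: Chains_def relation_of_def)
      have "eventually P (Inf C) \<longleftrightarrow> (\<exists>F\<in>C. eventually P F)" for P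
      proof (rule eventually_Inf_base[OF False])
        fix F G assume "F \<in> C" "G \<in> C"
        then have "F \<le> G \<or> G \<le> F" using C by (auto simp: Chains_def relation_of_def)
        then show "\<exists>x\<in>C. x \<le> inf F G" using \<open>F \<in> C\<close> \<open>G \<in> C\<close> by (auto intro: inf_greatest)
      qed
      then have "Inf C \<noteq> bot" using CA by (auto simp flip: eventually_False)
      moreover obtain c where "c \<in> C" using False by auto
      then have "Inf C \<le> U" using CA by (auto intro: Inf_lower2)
      ultimately show ?thesis by (auto intro: Inf_lower)
    qed
  qed
  then obtain V where V: "V \<le> U" "V \<noteq> bot" and min: "\<And>W. W \<le> V \<Longrightarrow> W \<noteq> bot \<Longrightarrow> W = V"
    by (auto dest: order_trans)
  have "eventually P V \<or> eventually (\<lambda>x. \<not> P x) V" for P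
  proof (rule ccontr)
    assume no: "\<not> ?thesis"
    have "inf V (principal {x. P x}) \<noteq> bot"
      using no by (auto simp: eventually_inf_principal simp flip: eventually_False)
  then have "inf V (principal {x. P x}) = V" by (intro min) auto
    moreover have "eventually P (inf V (principal {x. P x}))" by (simp add: eventually_inf_principal)
    ultimately have "eventually P V" by simp
    then show False using no by simp
  qed
  then show ?thesis using that V by blast
qed

lemma sep_tree_mono:
  assumes "sep_tree R f A s t N" "A \<subseteq> B" shows "sep_tree R f B s t N"
proof -
  obtain r b where "\<forall>i<N. r i \<in> R" "\<forall>\<eta>\<subseteq>{..<N}. b \<eta> \<in> A \<and>
     (\<forall>i<N. (i \<in> \<eta> \<longrightarrow> t < f (r i) (b \<eta>)) \<and> (i \<notin> \<eta> \<longrightarrow> f (r i) (b \<eta>) < s))"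
    using assms(1) unfolding sep_tree_def by blast
  then show ?thesis
    unfolding sep_tree_def using assms(2) by (intro exI[of _ r] exI[of _ b]) auto
qed

text \<open>Passing to \<open>1 - f\<close> exchanges low and high values, so the branches are
  complemented.\<close>

lemma sep_tree_compl:
  assumes "sep_tree R (\<lambda>r x. 1 - f r x) A s t N"
  shows "sep_tree R f A (1 - t) (1 - s) N"
proof -
  obtain r b where rb: "\<forall>i<N. r i \<in> R" "\<forall>\<eta>\<subseteq>{..<N}. b \<eta> \<in> A \<and>
     (\<forall>i<N. (i \<in> \<eta> \<longrightarrow> t < 1 - f (r i) (b \<eta>)) \<and> (i \<notin> \<eta> \<longrightarrow> 1 - f (r i) (b \<eta>) < s))"
    using assms unfolding sep_tree_def by blast
  have "b ({..<N} - \<eta>) \<in> A \<and> (\<forall>i<N. (i \<in> \<eta> \<longrightarrow> 1 - s < f (r i) (b ({..<N} - \<eta>))) \<and>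
      (i \<notin> \<eta> \<longrightarrow> f (r i) (b ({..<N} - \<eta>)) < 1 - t))" for \<eta>
    using rb(2)[rule_format, of "{..<N} - \<eta>"] by fastforce
  then show ?thesis
    unfolding sep_tree_def using rb(1) by (intro exI[of _ r] exI[of _ "\<lambda>\<eta>. b ({..<N} - \<eta>)"]) auto
qed

context stone_space
begin

text \<open>The tree grows downwards through the sets \<open>Z\<close>. A tree of depth
  \<open>k\<close> on \<open>Z (Suc n)\<close> has finitely many points, each with a basic
  neighbourhood on which all chosen functions stay on their side; one further function then splits
  every such neighbourhood inside \<open>Z n\<close> into a low and a high point.\<close>

lemma sep_tree_of_levels:
  fixes Z :: "nat \<Rightarrow> 'a set" and f :: "'r \<Rightarrow> 'a \<Rightarrow> real"
  assumes Z: "\<And>n. Z n \<subseteq> \<Omega>"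
    and basic: "\<And>r c. r \<in> R \<Longrightarrow> {x \<in> \<Omega>. f r x < c} \<in> \<B>" "\<And>r c. r \<in> R \<Longrightarrow> {x \<in> \<Omega>. c < f r x} \<in> \<B>"
    and step: "\<And>n (J :: nat set set) x V. \<lbrakk>finite J; \<And>j. j \<in> J \<Longrightarrow> x j \<in> Z (Suc n);
        \<And>j. j \<in> J \<Longrightarrow> V j \<in> \<B> \<and> x j \<in> V j\<rbrakk> \<Longrightarrow>
      \<exists>r\<in>R. \<forall>j\<in>J. (\<exists>y\<in>V j \<inter> Z n. f r y < s) \<and> (\<exists>z\<in>V j \<inter> Z n. t < f r z)"
  shows "Z (n + k) \<noteq> {} \<Longrightarrow> sep_tree R f (Z n) s t k"
proof (induction k arbitrary: n)
  case 0
  then obtain x where "x \<in> Z n" by auto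
  then show ?case by (auto simp: sep_tree_def)
next
  case (Suc k)
  then have "sep_tree R f (Z (Suc n)) s t k" by (intro Suc.IH) simp
  then obtain r b where rb: "\<forall>i<k. r i \<in> R" "\<forall>\<eta>\<subseteq>{..<k}. b \<eta> \<in> Z (Suc n) \<and>
     (\<forall>i<k. (i \<in> \<eta> \<longrightarrow> t < f (r i) (b \<eta>)) \<and> (i \<notin> \<eta> \<longrightarrow> f (r i) (b \<eta>) < s))"
    unfolding sep_tree_def by blast
  \<comment> \<open>The extra index \<open>k\<close> with the whole space keeps the intersection
    below nonempty as an indexed family, also for \<open>k = 0\<close>.\<close>
  define W where "W \<eta> i = (if i = k then \<Omega> else if i \<in> \<eta> then {x \<in> \<Omega>. t < f (r i) x}
    else {x \<in> \<Omega>. f (r i) x < s})" for \<eta> i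
  define V where "V \<eta> = (\<Inter>i\<in>{..k}. W \<eta> i)" for \<eta>
  have W: "W \<eta> i \<in> \<B>" if "i \<le> k" for \<eta> i
    using that basic rb(1) by (auto simp: W_def)
  have VB: "V \<eta> \<in> \<B>" for \<eta>
    unfolding V_def using W by (intro finite_INT) auto
  have b: "b \<eta> \<in> V \<eta>" if "\<eta> \<subseteq> {..<k}" for \<eta>
    using rb(2)[rule_format, OF that] Z[of "Suc n"] by (auto simp: V_def W_def)
  have Vsep: "(i \<in> \<eta> \<longrightarrow> t < f (r i) x) \<and> (i \<notin> \<eta> \<longrightarrow> f (r i) x < s)" if "x \<in> V \<eta>" "i < k" for x \<eta> i
  proof -
    have "x \<in> W \<eta> i" using that by (auto simp: V_def)
    then show ?thesis using that(2) by (auto simp: W_def split: if_splits)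
  qed
  have "\<exists>r'\<in>R. \<forall>\<eta>\<in>Pow {..<k}. (\<exists>y\<in>V \<eta> \<inter> Z n. f r' y < s) \<and> (\<exists>z\<in>V \<eta> \<inter> Z n. t < f r' z)"
    by (rule step[where x = b]) (use rb VB b in auto)
  then obtain r' y z where r': "r' \<in> R"
    and y: "\<And>\<eta>. \<eta> \<subseteq> {..<k} \<Longrightarrow> y \<eta> \<in> V \<eta> \<inter> Z n \<and> f r' (y \<eta>) < s"
    and z: "\<And>\<eta>. \<eta> \<subseteq> {..<k} \<Longrightarrow> z \<eta> \<in> V \<eta> \<inter> Z n \<and> t < f r' (z \<eta>)"
    by (metis PowI)
  \<comment> \<open>The new function is toss \<open>k\<close>; the remaining tosses select the old
    branch whose neighbourhood is split.\<close>
  define b' where "b' \<eta> = (if k \<in> \<eta> then z (\<eta> - {k}) else y (\<eta> - {k}))" for \<eta>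
  have "b' \<eta> \<in> Z n \<and> (\<forall>i<Suc k. (i \<in> \<eta> \<longrightarrow> t < f ((r(k := r')) i) (b' \<eta>)) \<and>
      (i \<notin> \<eta> \<longrightarrow> f ((r(k := r')) i) (b' \<eta>) < s))" if \<eta>: "\<eta> \<subseteq> {..<Suc k}" for \<eta>
  proof -
    have sub: "\<eta> - {k} \<subseteq> {..<k}" using \<eta> by (auto simp: less_Suc_eq)
    have V: "b' \<eta> \<in> V (\<eta> - {k})" "b' \<eta> \<in> Z n" using y[OF sub] z[OF sub] by (auto simp: b'_def)
    have k: "(k \<in> \<eta> \<longrightarrow> t < f r' (b' \<eta>)) \<and> (k \<notin> \<eta> \<longrightarrow> f r' (b' \<eta>) < s)"
      using y[OF sub] z[OF sub] by (auto simp: b'_def)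
    then show ?thesis using V Vsep[OF V(1)] by (auto simp: less_Suc_eq)
  qed
  then show ?case
    unfolding sep_tree_def using rb(1) r'
    by (intro exI[of _ "r(k := r')"] exI[of _ b']) (auto simp: less_Suc_eq)
qed

end

text \<open>The setting of the convergence theorem. NIP enters only through \<open>no_tree\<close>,
  and continuity of the members through \<open>less_basic\<close> and
  \<open>greater_basic\<close>.\<close>

locale stone_limit = stone_space \<Omega> \<B> for \<Omega> :: "'a set" and \<B> :: "'a set set" +
  fixes R :: "'r set" and f :: "'r \<Rightarrow> 'a \<Rightarrow> real" and F :: "'a \<Rightarrow> real" and U :: "'r filter"
  assumes U: "U \<noteq> bot" "eventually (\<lambda>r. r \<in> R) U"
    and less_basic: "\<And>r c. r \<in> R \<Longrightarrow> {x \<in> \<Omega>. f r x < c} \<in> \<B>"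
    and greater_basic: "\<And>r c. r \<in> R \<Longrightarrow> {x \<in> \<Omega>. c < f r x} \<in> \<B>"
    and lim: "\<And>x. x \<in> \<Omega> \<Longrightarrow> ((\<lambda>r. f r x) \<longlongrightarrow> F x) U"
    and no_tree: "\<And>s t. s < t \<Longrightarrow> \<exists>N. \<not> sep_tree R f \<Omega> s t N"
    and range: "\<And>r x. r \<in> R \<Longrightarrow> x \<in> \<Omega> \<Longrightarrow> 0 \<le> f r x \<and> f r x \<le> 1"
begin

text \<open>
  The closed sets \<open>Z n\<close> are the Cantor-Bendixson-like derivatives that measure how badly the sets
  \<open>F < s\<close> and \<open>t < F\<close> accumulate at each other; a point of \<open>Z N\<close> yields a separating tree of depth \<open>N\<close>.
\<close>

lemma borel_separation:
  assumes st: "s < t"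
  obtains E where "E \<in> sets (borel_of_top X)" "{x \<in> \<Omega>. t < F x} \<subseteq> E" "E \<subseteq> {x \<in> \<Omega>. s \<le> F x}"
proof -
  define Z where "Z = rec_nat \<Omega> (\<lambda>n Y. X closure_of (Y \<inter> {x. F x < s}) \<inter> X closure_of (Y \<inter> {x. t < F x}))"
  have Z0: "Z 0 = \<Omega>" and ZS: "Z (Suc n) = X closure_of (Z n \<inter> {x. F x < s}) \<inter> X closure_of (Z n \<inter> {x. t < F x})" for n
    by (simp_all add: Z_def)
  have closed: "closedin X (Z n)" for n
  proof (cases n)
    case 0 then show ?thesis using closedin_topspace[of X] by (simp add: Z0)
  qed (simp add: ZS closedin_Int)
  have ZO: "Z n \<subseteq> \<Omega>" for n using closedin_subset[OF closed] by simp
  have tree: "sep_tree R f (Z 0) s t N" if "Z (0 + N) \<noteq> {}" for N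
    using that
  proof (rule sep_tree_of_levels[rotated -1, where Z = Z])
    fix n and J :: "nat set set" and x V
    assume J: "finite J" "\<And>j. j \<in> J \<Longrightarrow> x j \<in> Z (Suc n)" "\<And>j. j \<in> J \<Longrightarrow> V j \<in> \<B> \<and> x j \<in> V j"
    have "\<exists>y\<in>V j \<inter> Z n. F y < s" "\<exists>z\<in>V j \<inter> Z n. t < F z" if j: "j \<in> J" for j
    proof -
      have "x j \<in> V j \<and> openin X (V j)" using J(3)[OF j] openin_basic by blast
      moreover have "x j \<in> X closure_of (Z n \<inter> {x. F x < s})" "x j \<in> X closure_of (Z n \<inter> {x. t < F x})"
        using J(2)[OF j] by (simp_all add: ZS)
      ultimately have "\<exists>y. y \<in> Z n \<inter> {x. F x < s} \<and> y \<in> V j" "\<exists>y. y \<in> Z n \<inter> {x. t < F x} \<and> y \<in> V j"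
        unfolding in_closure_of by blast+
      then show "\<exists>y\<in>V j \<inter> Z n. F y < s" "\<exists>z\<in>V j \<inter> Z n. t < F z" by blast+
    qed
    then obtain y z where y: "\<And>j. j \<in> J \<Longrightarrow> y j \<in> V j \<inter> Z n \<and> F (y j) < s"
      and z: "\<And>j. j \<in> J \<Longrightarrow> z j \<in> V j \<inter> Z n \<and> t < F (z j)" by metis
    \<comment> \<open>Only finitely many points are involved, so pointwise convergence yields a
      single \<open>r\<close> that works for all of them.\<close>
    have "eventually (\<lambda>r. f r (y j) < s \<and> t < f r (z j)) U" if "j \<in> J" for j
      using y[OF that] z[OF that] ZO[of n]
      by (intro eventually_conj order_tendstoD[OF lim]) auto
    then have "eventually (\<lambda>r. r \<in> R \<and> (\<forall>j\<in>J. f r (y j) < s \<and> t < f r (z j))) U"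
      using U(2) J(1) by (simp add: eventually_ball_finite eventually_conj)
    then obtain r where "r \<in> R" "\<forall>j\<in>J. f r (y j) < s \<and> t < f r (z j)"
      using eventually_happens'[OF U(1)] by blast
    then show "\<exists>r\<in>R. \<forall>j\<in>J. (\<exists>y\<in>V j \<inter> Z n. f r y < s) \<and> (\<exists>z\<in>V j \<inter> Z n. t < f r z)"
      using y z by blast
  qed (use ZO less_basic greater_basic in auto)
  obtain N where "\<not> sep_tree R f \<Omega> s t N" using no_tree[OF st] by blast
  then have ZN: "Z N = {}" using tree[of N] Z0 by auto
  \<comment> \<open>A point of \<open>Z n - Z (Suc n)\<close> misses one of the two closures, so
    lying in the closure of the high points rules out \<open>F x < s\<close>. Every point lies in
    exactly one such difference, since \<open>Z N\<close> is empty.\<close>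
  define E where "E = (\<Union>n<N. (Z n - Z (Suc n)) \<inter> X closure_of (Z n \<inter> {x. t < F x}))"
  show ?thesis
  proof (rule that[of E])
    show "E \<in> sets (borel_of_top X)"
      unfolding E_def by (intro sets.finite_UN sets.Int sets.Diff closed_borel closed) auto
    show "{x \<in> \<Omega>. t < F x} \<subseteq> E"
    proof clarify
      fix x assume x: "x \<in> \<Omega>" "t < F x"
      define M where "M = (LEAST n. x \<notin> Z n)"
      have "x \<notin> Z M" unfolding M_def by (rule LeastI[of _ N]) (simp add: ZN)
      moreover have M: "x \<in> Z n" if "n < M" for n using not_less_Least that M_def by blast
      moreover have "M \<le> N" unfolding M_def by (rule Least_le) (simp add: ZN)
      ultimately obtain n where n: "M = Suc n" "x \<in> Z n" "x \<notin> Z (Suc n)" "n < N"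
        using Z0 x(1) by (cases M) auto
      have "x \<in> X closure_of (Z n \<inter> {x. t < F x})"
        using n(2) x closure_of_subset_Int[of X "Z n \<inter> {x. t < F x}"] by auto
      then show "x \<in> E" using n by (auto simp: E_def)
    qed
    show "E \<subseteq> {x \<in> \<Omega>. s \<le> F x}"
    proof
      fix x assume "x \<in> E"
      then obtain n where n: "x \<in> Z n" "x \<notin> Z (Suc n)" "x \<in> X closure_of (Z n \<inter> {x. t < F x})"
        by (auto simp: E_def)
      have "\<not> F x < s"
      proof
        assume "F x < s"
        then have "x \<in> X closure_of (Z n \<inter> {x. F x < s})"
          using n(1) ZO[of n] closure_of_subset_Int[of X "Z n \<inter> {x. F x < s}"] by auto
        then show False using n by (simp add: ZS)
      qed
      then show "x \<in> {x \<in> \<Omega>. s \<le> F x}" using n(1) ZO by auto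
    qed
  qed
qed

theorem limit_borel: "F \<in> borel_measurable (borel_of_top X)"
  unfolding borel_measurable_iff_greater
proof
  fix c
  \<comment> \<open>Both thresholds stay above \<open>c\<close>, so each \<open>E n\<close> lies
    inside \<open>{c < F}\<close>; the upper ones tend to \<open>c\<close>, so the
    \<open>E n\<close> exhaust it.\<close>
  let ?s = "\<lambda>n::nat. c + 1 / real (n + 2)" and ?t = "\<lambda>n::nat. c + 1 / real (n + 1)"
  have "\<exists>E. E \<in> sets (borel_of_top X) \<and> {x \<in> \<Omega>. ?t n < F x} \<subseteq> E \<and> E \<subseteq> {x \<in> \<Omega>. ?s n \<le> F x}" for n
    by (rule borel_separation[of "?s n" "?t n"]) (auto simp: field_simps)
  then have "\<exists>E. \<forall>n. E n \<in> sets (borel_of_top X) \<and> {x \<in> \<Omega>. ?t n < F x} \<subseteq> E n \<and> E n \<subseteq> {x \<in> \<Omega>. ?s n \<le> F x}"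
    by (intro choice allI)
  then obtain E where "\<forall>n. E n \<in> sets (borel_of_top X) \<and> {x \<in> \<Omega>. ?t n < F x} \<subseteq> E n \<and> E n \<subseteq> {x \<in> \<Omega>. ?s n \<le> F x}"
    by (rule exE)
  then have E: "\<And>n. E n \<in> sets (borel_of_top X)" "\<And>n. {x \<in> \<Omega>. ?t n < F x} \<subseteq> E n"
    "\<And>n. E n \<subseteq> {x \<in> \<Omega>. ?s n \<le> F x}" by simp_all
  have "{x \<in> \<Omega>. c < F x} = (\<Union>n. E n)"
  proof
    show "{x \<in> \<Omega>. c < F x} \<subseteq> (\<Union>n. E n)"
    proof clarify
      fix x assume x: "x \<in> \<Omega>" "c < F x"
      then obtain n :: nat where "1 / real (n + 1) < F x - c"
        using nat_approx_posE[of "F x - c"] by (metis Suc_eq_plus1 diff_gt_0_iff_gt)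
      then have "x \<in> {x \<in> \<Omega>. ?t n < F x}" using x by auto
      then have "x \<in> E n" using E(2)[of n] by (rule subsetD[rotated])
      then show "x \<in> (\<Union>n. E n)" by (rule UN_I[OF UNIV_I])
    qed
    show "(\<Union>n. E n) \<subseteq> {x \<in> \<Omega>. c < F x}"
    proof
      fix x assume "x \<in> (\<Union>n. E n)"
      then obtain n where "x \<in> E n" by auto
      then have "x \<in> \<Omega>" "?s n \<le> F x" using subsetD[OF E(3)[of n]] by auto
      moreover have "c < ?s n" by simp
      ultimately have "c < F x" by linarith
      with \<open>x \<in> \<Omega>\<close> show "x \<in> {x \<in> \<Omega>. c < F x}" by auto
    qed
  qed
  then show "{x \<in> space (borel_of_top X). c < F x} \<in> sets (borel_of_top X)"
    using E(1) by (simp add: sets.countable_UN)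
qed

text \<open>
  Along an ultrafilter, the points all of whose basic neighbourhoods meet the set
  \<open>{f r < s, t < F}\<close> in a non-vanishing measure branch into a separating tree: low points come from
  the measure, high points from the pointwise convergence.
\<close>

theorem converges_in_measure:
  assumes N: "regular_borel_prob X N" and st: "s < t"
  shows "((\<lambda>r. measure N {x \<in> \<Omega>. t < F x \<and> f r x < s}) \<longlongrightarrow> 0) U"
proof (rule ccontr)
  assume not0: "\<not> ?thesis"
  interpret N: prob_space N using N by (simp add: regular_borel_prob_def)
  have setsN: "sets N = sets (borel_of_top X)" using N by (simp add: regular_borel_prob_def)
  define low where "low r = {x \<in> \<Omega>. t < F x \<and> f r x < s}" for r
  have "\<exists>\<epsilon>>0. \<not> eventually (\<lambda>r. measure N (low r) < \<epsilon>) U"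
    using not0 unfolding tendsto_iff low_def by (auto simp: dist_real_def)
  then obtain \<epsilon> where e: "\<epsilon> > 0" "\<not> eventually (\<lambda>r. measure N (low r) < \<epsilon>) U" by auto
  \<comment> \<open>Restricting to the \<open>r\<close> with a large bad set keeps the filter
    proper, and all eventual properties of \<open>U\<close> survive in the ultrafilter below
    it.\<close>
  have "inf U (principal {r. \<epsilon> \<le> measure N (low r)}) \<noteq> bot"
    using e(2) by (simp add: eventually_inf_principal not_le flip: eventually_False)
  then obtain V where V: "V \<le> inf U (principal {r. \<epsilon> \<le> measure N (low r)})" "V \<noteq> bot"
    and ultra: "\<And>P. eventually P V \<or> eventually (\<lambda>r. \<not> P r) V"
    using ultrafilter_below by blast
  have VU: "eventually P V" if "eventually P U" for P
    using that V(1) by (meson filter_leD le_inf_iff)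
  have VR: "eventually (\<lambda>r. r \<in> R) V" using U(2) by (rule VU)
  have big: "eventually (\<lambda>r. \<epsilon> \<le> measure N (low r)) V"
    using V(1) by (simp add: le_principal)
  have F_sets: "{x \<in> \<Omega>. t < F x} \<in> sets N"
    using borel_measurable_iff_greater[THEN iffD1, OF limit_borel] setsN by simp
  have low_sets: "low r \<in> sets N" if "r \<in> R" for r
  proof -
    have "low r = {x \<in> \<Omega>. t < F x} \<inter> {x \<in> \<Omega>. f r x < s}" by (auto simp: low_def)
    then show ?thesis
      using F_sets open_borel[OF openin_basic[OF less_basic[OF that]]] setsN by auto
  qed
  have B_sets: "b \<in> sets N" if "b \<in> \<B>" for b using open_borel[OF openin_basic[OF that]] setsN by simp
  \<comment> \<open>On a null set the low sets vanish in measure along \<open>V\<close>;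
    \<open>K\<close> is the support of what remains.\<close>
  define null where "null W \<longleftrightarrow> (\<forall>e>0. eventually (\<lambda>r. measure N (W \<inter> low r) \<le> e) V)" for W
  define K where "K = {x \<in> \<Omega>. \<forall>W\<in>\<B>. x \<in> W \<longrightarrow> \<not> null W}"
  have meets: "eventually (\<lambda>r. \<exists>y\<in>W \<inter> K. y \<in> low r) V" if W: "W \<in> \<B>" "\<not> null W" for W
  proof -
    obtain e where e: "e > 0" "\<not> eventually (\<lambda>r. measure N (W \<inter> low r) \<le> e) V"
      using W(2) by (auto simp: null_def)
    \<comment> \<open>This needs an ultrafilter: failing to be eventually small becomes being
      eventually large.\<close>
    then have gt: "eventually (\<lambda>r. \<not> measure N (W \<inter> low r) \<le> e) V" using ultra by blast
    \<comment> \<open>\<open>W - K\<close> is covered by null basic sets, possibly infinitely many.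
      A closed part of nearly full measure needs only finitely many of them, so \<open>W - K\<close>
      cannot carry the measure of the low sets.\<close>
    have "W - K = \<Union>{W \<inter> b | b. b \<in> \<B> \<and> null b}"
      using sets_into_space[OF W(1)] by (auto simp: K_def)
    moreover have "openin X (\<Union>{W \<inter> b | b. b \<in> \<B> \<and> null b})"
      using W(1) by (intro openin_Union) (auto intro: openin_basic)
    ultimately have opWK: "openin X (W - K)" by simp
    then have WK: "W - K \<in> sets N" using open_borel setsN by simp
    obtain H where H: "closedin X H" "H \<subseteq> W - K" "measure N ((W - K) - H) < e / 4"
    proof -
      have "e / 4 > 0" using e by simp
      then obtain H G where HG: "closedin X H" "openin X G" "H \<subseteq> W - K" "W - K \<subseteq> G" "measure N (G - H) < e / 4"
        using N WK unfolding regular_borel_prob_def by metis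
      have "measure N ((W - K) - H) \<le> measure N (G - H)"
        using HG open_borel[OF HG(2)] closed_borel[OF HG(1)] setsN by (intro N.finite_measure_mono) auto
      then show ?thesis by (intro that[of H] HG) (use HG in linarith)
    qed
    have HS: "(W - K) - H \<in> sets N" using WK closed_borel[OF H(1)] setsN by auto
    have "\<exists>b\<in>\<B>. x \<in> b \<and> null b" if "x \<in> H" for x
      using that H(2) sets_into_space[OF W(1)] by (auto simp: K_def)
    from closedin_basic_cover[OF H(1) this]
    obtain \<F> where \<F>: "finite \<F>" "\<F> \<subseteq> \<B>" "\<forall>b\<in>\<F>. null b" "H \<subseteq> \<Union>\<F>" by metis
    \<comment> \<open>A quarter of \<open>e\<close> in total for the finite cover, next to the
      quarter for the part outside \<open>H\<close>; the \<open>+ 1\<close> allows an empty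
      family.\<close>
    define d where "d = e / (4 * (real (card \<F>) + 1))"
    have d: "d > 0" "real (card \<F>) * d \<le> e / 4"
      using e(1) by (auto simp: d_def field_simps)
    have small: "eventually (\<lambda>r. \<forall>b\<in>\<F>. measure N (b \<inter> low r) \<le> d) V"
      using \<F> d(1) by (intro eventually_ball_finite) (auto simp: null_def)
    show ?thesis
      using eventually_conj[OF VR eventually_conj[OF gt small]]
    proof (rule eventually_mono, elim conjE)
      fix r assume r: "r \<in> R" "\<not> measure N (W \<inter> low r) \<le> e" "\<forall>b\<in>\<F>. measure N (b \<inter> low r) \<le> d"
      show "\<exists>y\<in>W \<inter> K. y \<in> low r"
      proof (rule ccontr)
        assume no: "\<not> ?thesis"
        have US: "(\<Union>b\<in>\<F>. b \<inter> low r) \<in> sets N"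
          using \<F> low_sets[OF r(1)] B_sets by (intro sets.finite_UN) auto
        have "measure N (W \<inter> low r) \<le> measure N (((W - K) - H) \<union> (\<Union>b\<in>\<F>. b \<inter> low r))"
          using no \<F>(4) by (intro N.finite_measure_mono sets.Un HS US) auto
        also have "\<dots> \<le> measure N ((W - K) - H) + measure N (\<Union>b\<in>\<F>. b \<inter> low r)"
          using HS US by (rule measure_Un_le)
        also have "measure N (\<Union>b\<in>\<F>. b \<inter> low r) \<le> (\<Sum>b\<in>\<F>. measure N (b \<inter> low r))"
          using \<F> low_sets[OF r(1)] B_sets by (intro N.finite_measure_subadditive_finite) auto
        also have "\<dots> \<le> real (card \<F>) * d"
          using r(3) sum_bounded_above[of \<F> "\<lambda>b. measure N (b \<inter> low r)" d] by simp
        finally show False using r(2) H(3) d(2) e(1) by simp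
      qed
    qed
  qed
  \<comment> \<open>All levels can be the same set: every basic neighbourhood of a point of
    \<open>K\<close> contains points of \<open>K\<close> that are low for most \<open>r\<close>, and
    low points satisfy \<open>t < F\<close> by definition.\<close>
  let ?Z = "\<lambda>n::nat. K \<inter> {x. t < F x}"
  have KO: "K \<subseteq> \<Omega>" by (auto simp: K_def)
  have "\<not> null \<Omega>"
  proof
    assume "null \<Omega>"
    moreover have "\<epsilon> / 2 > 0" using e(1) by simp
    ultimately have "eventually (\<lambda>r. measure N (\<Omega> \<inter> low r) \<le> \<epsilon> / 2) V" unfolding null_def by blast
    then have "eventually (\<lambda>r. measure N (\<Omega> \<inter> low r) \<le> \<epsilon> / 2 \<and> \<epsilon> \<le> measure N (low r)) V"
      using big by (rule eventually_conj)
    then obtain r where "measure N (\<Omega> \<inter> low r) \<le> \<epsilon> / 2" "\<epsilon> \<le> measure N (low r)"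
      using eventually_happens'[OF V(2)] by blast
    moreover have "\<Omega> \<inter> low r = low r" by (auto simp: low_def)
    ultimately show False using e(1) by simp
  qed
  then obtain r0 where "\<exists>y\<in>\<Omega> \<inter> K. y \<in> low r0"
    using eventually_happens'[OF V(2) meets[OF top]] by blast
  then have ne: "?Z (0 + k) \<noteq> {}" for k by (auto simp: low_def)
  have "sep_tree R f (?Z 0) s t k" for k
    using ne
  proof (rule sep_tree_of_levels[rotated -1, where Z = ?Z])
    fix n and J :: "nat set set" and x W
    assume J: "finite J" "\<And>j. j \<in> J \<Longrightarrow> x j \<in> ?Z (Suc n)" "\<And>j. j \<in> J \<Longrightarrow> W j \<in> \<B> \<and> x j \<in> W j"
    \<comment> \<open>The high point is \<open>x j\<close> itself, and \<open>meets\<close> supplies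
      a low one.\<close>
    have "eventually (\<lambda>r. (\<exists>y\<in>W j \<inter> K. y \<in> low r) \<and> t < f r (x j)) V" if j: "j \<in> J" for j
    proof (rule eventually_conj)
      show "eventually (\<lambda>r. \<exists>y\<in>W j \<inter> K. y \<in> low r) V"
        using J(2,3)[OF j] by (intro meets) (auto simp: K_def)
      show "eventually (\<lambda>r. t < f r (x j)) V"
        using J(2)[OF j] KO by (intro VU order_tendstoD(1)[OF lim]) auto
    qed
    then have "eventually (\<lambda>r. r \<in> R \<and> (\<forall>j\<in>J. (\<exists>y\<in>W j \<inter> K. y \<in> low r) \<and> t < f r (x j))) V"
      using VR J(1) by (simp add: eventually_ball_finite eventually_conj)
    then obtain r where r: "r \<in> R" "\<forall>j\<in>J. (\<exists>y\<in>W j \<inter> K. y \<in> low r) \<and> t < f r (x j)"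
      using eventually_happens'[OF V(2)] by blast
    have "(\<exists>y\<in>W j \<inter> ?Z n. f r y < s) \<and> (\<exists>z\<in>W j \<inter> ?Z n. t < f r z)" if j: "j \<in> J" for j
      using r(2)[rule_format, OF j] J(2,3)[OF j] by (auto simp: low_def)
    then show "\<exists>r\<in>R. \<forall>j\<in>J. (\<exists>y\<in>W j \<inter> ?Z n. f r y < s) \<and> (\<exists>z\<in>W j \<inter> ?Z n. t < f r z)"
      using r(1) by blast
  qed (use KO less_basic greater_basic in auto)
  from sep_tree_mono[OF this] have "sep_tree R f \<Omega> s t k" for k
    using KO by blast
  then show False using no_tree[OF st] by blast
qed

lemma limit_range: "x \<in> \<Omega> \<Longrightarrow> 0 \<le> F x \<and> F x \<le> 1"
  using tendsto_lowerbound[OF lim _ U(1)] tendsto_upperbound[OF lim _ U(1)] range U(2)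
  by (metis (mono_tags, lifting) eventually_mono)

lemma member_borel: "r \<in> R \<Longrightarrow> f r \<in> borel_measurable (borel_of_top X)"
  unfolding borel_measurable_iff_greater
  using open_borel[OF openin_basic[OF greater_basic]] by simp

text \<open>If \<open>F\<close> exceeds \<open>f r\<close> by more than two grid steps, some gap of
  the grid lies between them. Hence the excess is confined to finitely many sets that are small by
  \<open>converges_in_measure\<close>.\<close>

lemma integral_le_limit:
  assumes N: "regular_borel_prob X N" and e: "\<epsilon> > 0"
  shows "eventually (\<lambda>r. (\<integral>x. F x \<partial>N) \<le> (\<integral>x. f r x \<partial>N) + \<epsilon>) U"
proof -
  interpret N: prob_space N using N by (simp add: regular_borel_prob_def)
  have setsN: "sets N = sets (borel_of_top X)" using N by (simp add: regular_borel_prob_def)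
  then have spaceN: "space N = \<Omega>" using sets_eq_imp_space_eq[of N "borel_of_top X"] by simp
  \<comment> \<open>Two of the three parts pay for the grid, one for the exceptional set.\<close>
  define \<delta> where "\<delta> = \<epsilon> / 3"
  have d: "\<delta> > 0" using e by (simp add: \<delta>_def)
  \<comment> \<open>The grid has to reach past 1, the bound on the values.\<close>
  obtain J :: nat where J: "1 / \<delta> \<le> real J" using real_arch_simple by blast
  define A where "A j r = {x \<in> \<Omega>. (real j + 1) * \<delta> < F x \<and> f r x < real j * \<delta>}" for j r
  \<comment> \<open>There are \<open>J + 2\<close> grid indices, so these bounds add up to
    \<delta>.\<close>
  have "eventually (\<lambda>r. measure N (A j r) < \<delta> / (J + 2)) U" for j
    unfolding A_def by (rule order_tendstoD(2)[OF converges_in_measure[OF N]]) (use d in \<open>auto simp: field_simps\<close>)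
  then have "eventually (\<lambda>r. r \<in> R \<and> (\<forall>j\<in>{..J + 1}. measure N (A j r) < \<delta> / (J + 2))) U"
    using U(2) by (intro eventually_conj eventually_ball_finite) auto
  then show ?thesis
  proof (rule eventually_mono, elim conjE)
    fix r assume r: "r \<in> R" "\<forall>j\<in>{..J + 1}. measure N (A j r) < \<delta> / (J + 2)"
    have meas: "F \<in> borel_measurable N" "f r \<in> borel_measurable N"
      using limit_borel member_borel[OF r(1)] measurable_cong_sets[OF setsN refl] by auto
    have AS: "A j r \<in> sets N" for j
    proof -
      have "A j r = {x \<in> space N. (real j + 1) * \<delta> < F x \<and> f r x < real j * \<delta>}" by (simp add: A_def spaceN)
      then show ?thesis using meas by simp
    qed
    define B where "B = (\<Union>j\<in>{..J + 1}. A j r)"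
    have BS: "B \<in> sets N" using AS by (auto simp: B_def)
    have "measure N B \<le> (\<Sum>j\<in>{..J + 1}. measure N (A j r))"
      unfolding B_def using AS by (intro N.finite_measure_subadditive_finite) auto
    also have "\<dots> \<le> (\<Sum>j\<in>{..J + 1}. \<delta> / (J + 2))" using r(2) by (intro sum_mono less_imp_le) auto
    also have "\<dots> = \<delta>" by simp
    finally have B: "measure N B \<le> \<delta>" .
    have int: "integrable N F" "integrable N (f r)"
      using meas limit_range range[OF r(1)] by (auto intro!: N.integrable_const_bound[where B = 1] AE_I2 simp: spaceN)
    have pw: "F x \<le> f r x + (2 * \<delta> + indicator B x)" if x: "x \<in> space N" for x
    proof (cases "F x \<le> f r x + 2 * \<delta>")
      case True then show ?thesis by (simp add: indicator_def)
    next
      case False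
      have x': "x \<in> \<Omega>" using x by (simp add: spaceN)
      \<comment> \<open>The index with \<open>(j - 1) * \<delta> \<le> f r x < j * \<delta>\<close>;
        an excess above \<open>2 * \<delta>\<close> then puts \<open>F x\<close> beyond the next
        grid point.\<close>
      define j where "j = nat \<lfloor>f r x / \<delta>\<rfloor> + 1"
      have f01: "0 \<le> f r x / \<delta>" "f r x / \<delta> \<le> 1 / \<delta>"
        using range[OF r(1) x'] d by (auto intro: divide_right_mono)
      have j: "real j = real_of_int \<lfloor>f r x / \<delta>\<rfloor> + 1" using f01(1) by (simp add: j_def)
      have "f r x / \<delta> < real j" "real j - 1 \<le> f r x / \<delta>" unfolding j by linarith+
      then have "f r x < real j * \<delta>" "(real j - 1) * \<delta> \<le> f r x"
        using d by (auto simp: field_simps)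
      moreover have "(real j + 1) * \<delta> < F x"
        using calculation(2) False by (simp add: algebra_simps)
      moreover have "j \<le> J + 1"
        using \<open>real j - 1 \<le> f r x / \<delta>\<close> f01(2) J by linarith
      ultimately have "x \<in> B" using x' by (auto simp: B_def A_def)
      moreover have "F x \<le> 1" "0 \<le> f r x" using limit_range[OF x'] range[OF r(1) x'] by auto
      ultimately show ?thesis using d by (simp add: indicator_def)
    qed
    have intB: "integrable N (indicat_real B)" using BS by (simp add: N.emeasure_eq_measure)
    have "(\<integral>x. F x \<partial>N) \<le> (\<integral>x. f r x + (2 * \<delta> + indicator B x) \<partial>N)"
      using int intB pw by (intro integral_mono) auto
    also have "\<dots> = (\<integral>x. f r x \<partial>N) + (2 * \<delta> + measure N B)"
      using int intB BS N.prob_space sets.sets_into_space[OF BS] by (simp add: Int_absorb2)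
    finally show "(\<integral>x. F x \<partial>N) \<le> (\<integral>x. f r x \<partial>N) + \<epsilon>" using B by (simp add: \<delta>_def)
  qed
qed

text \<open>The one-sided estimate for \<open>f\<close> and for \<open>1 - f\<close>; the locale is
  symmetric under this exchange.\<close>

theorem integral_tendsto:
  assumes N: "regular_borel_prob X N"
  shows "((\<lambda>r. \<integral>x. f r x \<partial>N) \<longlongrightarrow> (\<integral>x. F x \<partial>N)) U"
proof -
  interpret N: prob_space N using N by (simp add: regular_borel_prob_def)
  have setsN: "sets N = sets (borel_of_top X)" using N by (simp add: regular_borel_prob_def)
  then have spaceN: "space N = \<Omega>" using sets_eq_imp_space_eq[of N "borel_of_top X"] by simp
  interpret C: stone_limit \<Omega> \<B> R "\<lambda>r x. 1 - f r x" "\<lambda>x. 1 - F x" U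
  proof
    show "{x \<in> \<Omega>. 1 - f r x < c} \<in> \<B>" if "r \<in> R" for r c
      using greater_basic[OF that, of "1 - c"] by (simp add: algebra_simps)
    show "{x \<in> \<Omega>. c < 1 - f r x} \<in> \<B>" if "r \<in> R" for r c
      using less_basic[OF that, of "1 - c"] by (simp add: algebra_simps)
    show "((\<lambda>r. 1 - f r x) \<longlongrightarrow> 1 - F x) U" if "x \<in> \<Omega>" for x
      by (intro tendsto_intros lim that)
    show "\<exists>N. \<not> sep_tree R (\<lambda>r x. 1 - f r x) \<Omega> s t N" if "s < t" for s t
      using no_tree[of "1 - t" "1 - s"] sep_tree_compl[of R f \<Omega> s t] that by auto
  qed (use U range in auto)
  have int: "(\<integral>x. 1 - f r x \<partial>N) = 1 - (\<integral>x. f r x \<partial>N)" if "r \<in> R" for r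
  proof -
    have "integrable N (f r)"
      using member_borel[OF that] range[OF that] measurable_cong_sets[OF setsN refl]
      by (auto intro!: N.integrable_const_bound[where B = 1] AE_I2 simp: spaceN)
    then show ?thesis using N.prob_space by simp
  qed
  have intF: "(\<integral>x. 1 - F x \<partial>N) = 1 - (\<integral>x. F x \<partial>N)"
  proof -
    have "integrable N F"
      using limit_borel limit_range measurable_cong_sets[OF setsN refl]
      by (auto intro!: N.integrable_const_bound[where B = 1] AE_I2 simp: spaceN)
    then show ?thesis using N.prob_space by simp
  qed
  show ?thesis
    unfolding tendsto_iff
  proof (intro allI impI)
    fix \<epsilon> :: real assume e: "\<epsilon> > 0"
    then have "\<epsilon> / 2 > 0" by simp
    from integral_le_limit[OF N this] C.integral_le_limit[OF N this] U(2)
    show "eventually (\<lambda>r. dist (\<integral>x. f r x \<partial>N) (\<integral>x. F x \<partial>N) < \<epsilon>) U"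
    proof eventually_elim
      case (elim r)
      then show ?case using int[OF elim(3)] intF e by (auto simp: dist_real_def)
    qed
  qed
qed

end

section \<open>NIP bounds the VC dimension\<close>

lemma countable_small:
  assumes "monster L C \<kappa>" "countable A" shows "|A| <o \<kappa>"
proof -
  have "|A| \<le>o |UNIV :: nat set|"
    using assms(2) unfolding countable_def card_of_ordLeq[symmetric] by auto
  then have "|A| \<le>o natLeq" using card_of_nat ordLeq_ordIso_trans by blast
  then show ?thesis using assms(1) ordLeq_ordLess_trans unfolding monster_def by blast
qed

lemma sat_inst:
  assumes "wf_fm L 0 \<phi>" "\<And>v. Inl v \<in> vars_fm \<phi> \<Longrightarrow> case_sum s id (h (Inl v)) = s' v"
    and "\<And>c. Inr c \<in> vars_fm \<phi> \<Longrightarrow> case_sum s id (h (Inr c)) = c"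
  shows "sat C D s (map_fm h \<phi>) = sat C D s' \<phi>"
  unfolding sat_map unfolding sat_def
proof (rule eval_fm_cong[OF assms(1) refl])
  fix v assume "v \<in> vars_fm \<phi>"
  then show "(case_sum s id \<circ> h) v = case_sum s' id v"
    using assms(2,3) by (cases v rule: sum.exhaust) simp_all
qed

text \<open>
  Two applications of saturation: the first produces an infinite sequence \<open>a\<^sub>i\<close> all of whose finite
  subsets are cut out by some \<open>b\<close>, the second then realizes the types that cut out the infinite ones.
\<close>

lemma NIP_shatter_nat:
  fixes \<phi> :: "('f, 'r, nat + nat, 'c) pfm"
  assumes mon: "monster L C \<kappa>" and nip: "NIP L C" and \<phi>: "\<phi> \<in> Fm L {}"
  shows "\<exists>d::nat. \<nexists>a b. \<forall>I\<subseteq>{..<d}. \<forall>i<d. sat C UNIV (case_sum (a i) (b I)) \<phi> \<longleftrightarrow> i \<in> I"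
proof (rule ccontr)
  assume "\<not> ?thesis"
  then have sh: "\<exists>a b. \<forall>I\<subseteq>{..<d}. \<forall>i<d. sat C UNIV (case_sum (a i) (b I)) \<phi> \<longleftrightarrow> i \<in> I" for d :: nat
    by simp
  have wf: "wf_fm L 0 \<phi>" using \<phi> by (simp add: Fm_def)
  have noInr: "Inr c \<notin> vars_fm \<phi>" for c using \<phi> by (rule Fm_empty_Inr)
  \<comment> \<open>Separate copies of the variables for each \<open>i\<close> and each finite set,
    the latter coded by a list so that the variable type stays countable.\<close>
  define h :: "nat \<Rightarrow> nat list \<Rightarrow> (nat + nat) + 'c \<Rightarrow> (nat \<times> nat + nat list \<times> nat) + 'c" where
    "h i l = case_sum (case_sum (\<lambda>x. Inl (Inl (i, x))) (\<lambda>y. Inl (Inr (l, y)))) Inr" for i l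
  define \<psi> where "\<psi> i l = (if i \<in> set l then map_fm (h i l) \<phi> else Neg (map_fm (h i l) \<phi>))" for i l
  have hFm: "map_fm (h i l) \<phi> \<in> Fm L {}" for i l
  proof -
    have "h i l v \<in> range Inl" if "v \<in> vars_fm \<phi>" for v
      using that noInr by (auto simp: h_def split: sum.splits)
    then show ?thesis using wf by (auto simp: Fm_def fm.set_map)
  qed
  have sath: "sat C UNIV s (map_fm (h i l) \<phi>) \<longleftrightarrow>
      sat C UNIV (case_sum (\<lambda>x. s (Inl (i, x))) (\<lambda>y. s (Inr (l, y)))) \<phi>" for s i l
    by (rule sat_inst[OF wf]) (use noInr in \<open>auto simp: h_def split: sum.splits\<close>)
  have fs: "fin_sat C (range (\<lambda>(i, l). \<psi> i l))"
    unfolding fin_sat_def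
  proof (intro allI impI)
    fix F assume "F \<subseteq> range (\<lambda>(i, l). \<psi> i l)" "finite F"
    then obtain P where P: "finite P" "F = (\<lambda>(i, l). \<psi> i l) ` P"
      using finite_subset_image[of F "\<lambda>(i, l). \<psi> i l" UNIV] by blast
    define d where "d = Suc (Max (insert 0 (fst ` P)))"
    have d: "i < d" if "(i, l) \<in> P" for i l
    proof -
      have "i \<in> insert 0 (fst ` P)" using that by force
      then have "i \<le> Max (insert 0 (fst ` P))" using P(1) by (intro Max_ge) auto
      then show ?thesis by (simp add: d_def)
    qed
    obtain a b where ab: "\<forall>I\<subseteq>{..<d}. \<forall>i<d. sat C UNIV (case_sum (a i) (b I)) \<phi> \<longleftrightarrow> i \<in> I"
      using sh by blast
    \<comment> \<open>Only indices below \<open>d\<close> occur in \<open>P\<close>, so the set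
      coded by \<open>l\<close> may be cut down to one of those that \<open>b\<close>
      handles.\<close>
    let ?s = "case_sum (\<lambda>(i, x). a i x) (\<lambda>(l, y). b (set l \<inter> {..<d}) y)"
    have "sat C UNIV ?s (\<psi> i l)" if "(i, l) \<in> P" for i l
      using ab[rule_format, of "set l \<inter> {..<d}" i] d[OF that] by (simp add: \<psi>_def sath)
    then show "\<exists>s. \<forall>\<phi>\<in>F. sat C UNIV s \<phi>" using P(2) by (intro exI[of _ ?s]) auto
  qed
  have Fm1: "range (\<lambda>(i, l). \<psi> i l) \<subseteq> Fm L {}" using hFm by (auto simp: \<psi>_def)
  have "|UNIV :: (nat \<times> nat + nat list \<times> nat) set| <o \<kappa>" by (rule countable_small[OF mon]) simp
  then obtain s where s: "\<forall>\<xi>\<in>range (\<lambda>(i, l). \<psi> i l). sat C UNIV s \<xi>"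
    by (rule realize_partial_type[OF mon countable_small[OF mon countable_empty] _ Fm1 fs])
  define a where "a i x = s (Inl (i, x))" for i x
  have a: "\<exists>b. \<forall>i\<in>J. sat C UNIV (case_sum (a i) b) \<phi> \<longleftrightarrow> i \<in> I" if J: "finite J" for I J
  proof -
    obtain l where l: "set l = I \<inter> J" using finite_list[of "I \<inter> J"] J by auto
    have "sat C UNIV (case_sum (a i) (\<lambda>y. s (Inr (l, y)))) \<phi> \<longleftrightarrow> i \<in> I" if "i \<in> J" for i
    proof -
      have "sat C UNIV s (\<psi> i l)" using s by auto
      then show ?thesis using l that by (auto simp: \<psi>_def sath a_def[abs_def] split: if_splits)
    qed
    then show ?thesis by blast
  qed
  define A where "A = range (\<lambda>p. a (fst p) (snd p))"
  have cA: "countable A" by (simp add: A_def)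
  have aA: "a i x \<in> A" for i x unfolding A_def by (rule range_eqI[of _ _ "(i, x)"]) simp
  have "\<exists>b. \<forall>i. sat C UNIV (case_sum (a i) b) \<phi> \<longleftrightarrow> i \<in> I" for I
  proof -
    \<comment> \<open>The sequence is now fixed and enters through parameters from the countable set
      \<open>A\<close>; only the variables of the second block remain.\<close>
    define k :: "nat \<Rightarrow> (nat + nat) + 'c \<Rightarrow> nat + 'c" where
      "k i = case_sum (case_sum (\<lambda>x. Inr (a i x)) Inl) Inr" for i
    have satk: "sat C UNIV b (map_fm (k i) \<phi>) \<longleftrightarrow> sat C UNIV (case_sum (a i) b) \<phi>" for b i
      by (rule sat_inst[OF wf]) (auto simp: k_def split: sum.splits)
    have kFm: "map_fm (k i) \<phi> \<in> Fm L A" for i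
    proof -
      have "k i v \<in> range Inl \<union> Inr ` A" if "v \<in> vars_fm \<phi>" for v
        using that noInr aA by (auto simp: k_def split: sum.splits)
      then show ?thesis using wf by (auto simp: Fm_def fm.set_map)
    qed
    define \<xi> where "\<xi> i = (if i \<in> I then map_fm (k i) \<phi> else Neg (map_fm (k i) \<phi>))" for i
    have Fm2: "range \<xi> \<subseteq> Fm L A" using kFm by (auto simp: \<xi>_def)
    have fs2: "fin_sat C (range \<xi>)"
      unfolding fin_sat_def
    proof (intro allI impI)
      fix F assume "F \<subseteq> range \<xi>" "finite F"
      then obtain J where J: "finite J" "F = \<xi> ` J"
        using finite_subset_image[of F \<xi> UNIV] by blast
      obtain b where "\<forall>i\<in>J. sat C UNIV (case_sum (a i) b) \<phi> \<longleftrightarrow> i \<in> I" using a[OF J(1)] by blast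
      then have "sat C UNIV b (\<xi> i)" if "i \<in> J" for i
        using that by (cases "i \<in> I") (simp_all add: \<xi>_def satk)
      then show "\<exists>s. \<forall>\<phi>\<in>F. sat C UNIV s \<phi>"
        unfolding J(2) by (intro exI[of _ b] ballI) (elim imageE, simp)
    qed
    have "|UNIV :: nat set| <o \<kappa>" by (rule countable_small[OF mon]) simp
    then obtain b where b: "\<forall>\<zeta>\<in>range \<xi>. sat C UNIV b \<zeta>"
      by (rule realize_partial_type[OF mon countable_small[OF mon cA] _ Fm2 fs2])
    have "sat C UNIV (case_sum (a i) b) \<phi> \<longleftrightarrow> i \<in> I" for i
    proof -
      have "sat C UNIV b (\<xi> i)" using b by simp
      then show ?thesis by (cases "i \<in> I") (simp_all add: \<xi>_def satk)
    qed
    then show ?thesis by blast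
  qed
  then obtain b where "\<forall>i I. sat C UNIV (case_sum (a i) (b I)) \<phi> \<longleftrightarrow> i \<in> I" by metis
  then show False using nip \<phi> unfolding NIP_def by blast
qed

text \<open>Finitely many variables occur, so they can be recoded by natural numbers. The two sides
  are exchanged because later the types vary on the \<open>x\<close> side and the group elements on
  the \<open>y\<close> side.\<close>

theorem NIP_shatter:
  fixes \<phi> :: "('f, 'r, 'x + 'y, 'c) pfm"
  assumes mon: "monster L C \<kappa>" and nip: "NIP L C" and wf: "wf_fm L 0 \<phi>"
  shows "\<exists>d::nat. \<nexists>a b. \<forall>I\<subseteq>{..<d}. \<forall>i<d. sat C UNIV (case_sum (b I) (a i)) \<phi> \<longleftrightarrow> i \<in> I"
proof -
  obtain g :: "('x + 'y) + 'c \<Rightarrow> nat" where g: "inj_on g (vars_fm \<phi>)"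
    using finite_imp_inj_to_nat_seg[OF finite_vars_fm, of \<phi>] by (elim exE conjE)
  \<comment> \<open>Parameters of \<phi> become variables with constant values in the block that
    carries \<open>b I\<close>, because \<open>NIP\<close> speaks of formulas without
    parameters.\<close>
  define h :: "('x + 'y) + 'c \<Rightarrow> (nat + nat) + 'c" where
    "h v = (case v of Inl (Inr y) \<Rightarrow> Inl (Inl (g v)) | _ \<Rightarrow> Inl (Inr (g v)))" for v
  let ?i = "inv_into (vars_fm \<phi>) g"
  have hFm: "map_fm h \<phi> \<in> Fm L {}"
  proof -
    have "h v \<in> range Inl" for v by (auto simp: h_def split: sum.splits)
    then show ?thesis using wf by (auto simp: Fm_def fm.set_map)
  qed
  from NIP_shatter_nat[OF mon nip this] obtain d :: nat where d: "\<nexists>a b. \<forall>I\<subseteq>{..<d}. \<forall>i<d.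
      sat C UNIV (case_sum (a i) (b I)) (map_fm h \<phi>) \<longleftrightarrow> i \<in> I"
    by (rule exE)
  have "\<nexists>a b. \<forall>I\<subseteq>{..<d}. \<forall>i<d. sat C UNIV (case_sum (b I) (a i)) \<phi> \<longleftrightarrow> i \<in> I"
  proof (intro notI, elim exE)
    fix a :: "nat \<Rightarrow> 'y \<Rightarrow> 'c" and b :: "nat set \<Rightarrow> 'x \<Rightarrow> 'c"
    assume ab: "\<forall>I\<subseteq>{..<d}. \<forall>i<d. sat C UNIV (case_sum (b I) (a i)) \<phi> \<longleftrightarrow> i \<in> I"
    define val where "val x y v = case_sum (case_sum x y) id (?i v)" for x :: "'x \<Rightarrow> 'c" and y :: "'y \<Rightarrow> 'c" and v
    have "sat C UNIV (case_sum (val undefined (a i)) (val (b I) undefined)) (map_fm h \<phi>)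
        = sat C UNIV (case_sum (b I) (a i)) \<phi>" for i I
      by (rule sat_inst[OF wf]) (auto simp: h_def val_def inv_into_f_f[OF g] split: sum.splits)
    then have "\<forall>I\<subseteq>{..<d}. \<forall>i<d. sat C UNIV (case_sum (val undefined (a i)) (val (b I) undefined)) (map_fm h \<phi>)
        \<longleftrightarrow> i \<in> I" using ab by simp
    then have "\<exists>a b. \<forall>I\<subseteq>{..<d}. \<forall>i<d. sat C UNIV (case_sum (a i) (b I)) (map_fm h \<phi>) \<longleftrightarrow> i \<in> I"
      by (intro exI[of _ "\<lambda>i. val undefined (a i)"] exI[of _ "\<lambda>I. val (b I) undefined"])
    with d show False by contradiction
  qed
  then show ?thesis by blast
qed

section \<open>Automorphisms\<close>

definition fun_closed :: "('f, 'r) lang \<Rightarrow> ('f, 'r, 'c) struct \<Rightarrow> 'c set \<Rightarrow> bool" where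
  "fun_closed L C D \<longleftrightarrow> (\<forall>(f, n)\<in>Funs L. \<forall>xs\<in>lists D. length xs = n \<longrightarrow> fn C f xs \<in> D)"

lemma fun_closed_UNIV [simp]: "fun_closed L C UNIV"
  by (simp add: fun_closed_def)

lemma fun_closedD: "fun_closed L C D \<Longrightarrow> (f, length xs) \<in> Funs L \<Longrightarrow> xs \<in> lists D \<Longrightarrow> fn C f xs \<in> D"
  by (auto simp: fun_closed_def)

lemma AutD:
  assumes "\<sigma> \<in> Aut L C D"
  shows "bij_betw \<sigma> D D" "\<sigma> \<in> extensional D"
    "(f, length xs) \<in> Funs L \<Longrightarrow> xs \<in> lists D \<Longrightarrow> \<sigma> (fn C f xs) = fn C f (map \<sigma> xs)"
    "(R, length xs) \<in> Rels L \<Longrightarrow> xs \<in> lists D \<Longrightarrow> rl C R xs = rl C R (map \<sigma> xs)"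
  using assms by (auto simp: Aut_def Bij_def)

lemma AutI:
  assumes "\<sigma> \<in> Bij D"
    "\<And>f xs. (f, length xs) \<in> Funs L \<Longrightarrow> xs \<in> lists D \<Longrightarrow> \<sigma> (fn C f xs) = fn C f (map \<sigma> xs)"
    "\<And>R xs. (R, length xs) \<in> Rels L \<Longrightarrow> xs \<in> lists D \<Longrightarrow> rl C R xs = rl C R (map \<sigma> xs)"
  shows "\<sigma> \<in> Aut L C D"
  using assms by (auto simp: Aut_def)

lemma eval_tm_Aut:
  assumes \<sigma>: "\<sigma> \<in> Aut L C D" and D: "fun_closed L C D"
  shows "\<lbrakk>wf_tm L k t; \<And>n. n < k \<Longrightarrow> e n \<in> D; \<And>v. v \<in> vars_tm t \<Longrightarrow> s v \<in> D\<rbrakk>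
    \<Longrightarrow> eval_tm C e s t \<in> D \<and> eval_tm C (\<sigma> \<circ> e) (\<sigma> \<circ> s) t = \<sigma> (eval_tm C e s t)"
proof (induction t)
  case (Fn f ts)
  have IH: "eval_tm C e s t \<in> D \<and> eval_tm C (\<sigma> \<circ> e) (\<sigma> \<circ> s) t = \<sigma> (eval_tm C e s t)" if "t \<in> set ts" for t
    using that Fn.prems by (intro Fn.IH) auto
  let ?xs = "map (eval_tm C e s) ts"
  have xs: "?xs \<in> lists D" "(f, length ?xs) \<in> Funs L" using IH Fn.prems by auto
  have "map (eval_tm C (\<sigma> \<circ> e) (\<sigma> \<circ> s)) ts = map \<sigma> ?xs" using IH by simp
  then show ?case using AutD(3)[OF \<sigma> xs(2,1)] fun_closedD[OF D xs(2,1)] by (metis eval_tm.simps(3))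
qed auto

lemma eval_fm_Aut:
  assumes \<sigma>: "\<sigma> \<in> Aut L C D" and D: "fun_closed L C D"
  shows "\<lbrakk>wf_fm L k \<phi>; \<And>n. n < k \<Longrightarrow> e n \<in> D; \<And>v. v \<in> vars_fm \<phi> \<Longrightarrow> s v \<in> D\<rbrakk>
    \<Longrightarrow> eval_fm C D (\<sigma> \<circ> e) (\<sigma> \<circ> s) \<phi> = eval_fm C D e s \<phi>"
proof (induction \<phi> arbitrary: k e)
  case (Eq t u)
  have "eval_tm C e s t \<in> D \<and> eval_tm C (\<sigma> \<circ> e) (\<sigma> \<circ> s) t = \<sigma> (eval_tm C e s t)"
    "eval_tm C e s u \<in> D \<and> eval_tm C (\<sigma> \<circ> e) (\<sigma> \<circ> s) u = \<sigma> (eval_tm C e s u)"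
    by (rule eval_tm_Aut[OF \<sigma> D, of k]; use Eq in auto)+
  then show ?case using AutD(1)[OF \<sigma>] unfolding bij_betw_def eval_fm.simps by (metis inj_on_eq_iff)
next
  case (Rel R ts)
  have IH: "eval_tm C e s t \<in> D \<and> eval_tm C (\<sigma> \<circ> e) (\<sigma> \<circ> s) t = \<sigma> (eval_tm C e s t)" if "t \<in> set ts" for t
    by (rule eval_tm_Aut[OF \<sigma> D, of k]) (use that Rel in auto)
  let ?xs = "map (eval_tm C e s) ts"
  have xs: "?xs \<in> lists D" "(R, length ?xs) \<in> Rels L" using IH Rel.prems by auto
  have "map (eval_tm C (\<sigma> \<circ> e) (\<sigma> \<circ> s)) ts = map \<sigma> ?xs" using IH by simp
  then show ?case using AutD(4)[OF \<sigma> xs(2,1)] by (metis eval_fm.simps(2))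
next
  case (Neg \<phi>)
  have "eval_fm C D (\<sigma> \<circ> e) (\<sigma> \<circ> s) \<phi> = eval_fm C D e s \<phi>"
    by (rule Neg.IH[of k]) (use Neg.prems in auto)
  then show ?case by (simp only: eval_fm.simps)
next
  case (Or \<phi> \<psi>)
  have "eval_fm C D (\<sigma> \<circ> e) (\<sigma> \<circ> s) \<phi> = eval_fm C D e s \<phi>"
    by (rule Or.IH(1)[of k]) (use Or.prems in auto)
  moreover have "eval_fm C D (\<sigma> \<circ> e) (\<sigma> \<circ> s) \<psi> = eval_fm C D e s \<psi>"
    by (rule Or.IH(2)[of k]) (use Or.prems in auto)
  ultimately show ?case by (simp only: eval_fm.simps)
next
  case (Ex \<phi>)
  have "eval_fm C D (case_nat (\<sigma> d) (\<sigma> \<circ> e)) (\<sigma> \<circ> s) \<phi> = eval_fm C D (case_nat d e) s \<phi>" if "d \<in> D" for d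
  proof -
    have "eval_fm C D (\<sigma> \<circ> case_nat d e) (\<sigma> \<circ> s) \<phi> = eval_fm C D (case_nat d e) s \<phi>"
      by (rule Ex.IH[of "Suc k"]) (use Ex.prems that in \<open>auto split: nat.split\<close>)
    moreover have "\<sigma> \<circ> case_nat d e = case_nat (\<sigma> d) (\<sigma> \<circ> e)" by (auto split: nat.split)
    ultimately show ?thesis by simp
  qed
  moreover have "D = \<sigma> ` D" using AutD(1)[OF \<sigma>] by (simp add: bij_betw_def)
  ultimately show ?case by (metis (no_types, lifting) eval_fm.simps(5) imageE imageI)
qed

lemma sat_Aut:
  assumes "\<sigma> \<in> Aut L C D" "fun_closed L C D" "\<phi> \<in> Fm L {}" "range s \<subseteq> D"
  shows "sat C D (\<sigma> \<circ> s) \<phi> = sat C D s \<phi>"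
proof -
  have wf: "wf_fm L 0 \<phi>" using assms(3) by (simp add: Fm_def)
  have vars: "v \<in> vars_fm \<phi> \<Longrightarrow> v \<in> range Inl" for v using assms(3) by (auto simp: Fm_def)
  have "eval_fm C D (\<sigma> \<circ> (\<lambda>_. undefined)) (\<sigma> \<circ> case_sum s id) \<phi> = eval_fm C D (\<lambda>_. undefined) (case_sum s id) \<phi>"
  proof (rule eval_fm_Aut[OF assms(1,2) wf])
    show "case_sum s id v \<in> D" if "v \<in> vars_fm \<phi>" for v
      using vars[OF that] assms(4) by auto
  qed simp
  moreover have "eval_fm C D (\<sigma> \<circ> (\<lambda>_. undefined)) (\<sigma> \<circ> case_sum s id) \<phi> = sat C D (\<sigma> \<circ> s) \<phi>"
    unfolding sat_def
  proof (rule eval_fm_cong[OF wf])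
    show "(\<sigma> \<circ> case_sum s id) v = case_sum (\<sigma> \<circ> s) id v" if "v \<in> vars_fm \<phi>" for v
      using vars[OF that] by auto
  qed simp
  ultimately show ?thesis by (simp add: sat_def)
qed

lemma sat_map_Aut_UNIV:
  assumes "\<sigma> \<in> Aut L C UNIV" "wf_fm L 0 \<phi>"
  shows "sat C UNIV (\<sigma> \<circ> s) (map_fm (map_sum id \<sigma>) \<phi>) = sat C UNIV s \<phi>"
proof -
  have "case_sum (\<sigma> \<circ> s) id \<circ> map_sum id \<sigma> = \<sigma> \<circ> case_sum s id"
    by (auto simp: fun_eq_iff split: sum.split)
  then have "sat C UNIV (\<sigma> \<circ> s) (map_fm (map_sum id \<sigma>) \<phi>)
      = eval_fm C UNIV (\<lambda>_. undefined) (\<sigma> \<circ> case_sum s id) \<phi>" by (simp only: sat_map)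
  also have "\<dots> = eval_fm C UNIV (\<sigma> \<circ> (\<lambda>_. undefined)) (\<sigma> \<circ> case_sum s id) \<phi>"
    by (rule eval_fm_cong[OF assms(2)]) auto
  also have "\<dots> = sat C UNIV s \<phi>"
    unfolding sat_def by (rule eval_fm_Aut[OF assms(1) fun_closed_UNIV assms(2)]) auto
  finally show ?thesis .
qed

lemma Aut_inverse:
  assumes \<sigma>: "\<sigma> \<in> Aut L C D" and D: "fun_closed L C D"
  shows "restrict (inv_into D \<sigma>) D \<in> Aut L C D"
proof -
  let ?\<tau> = "restrict (inv_into D \<sigma>) D"
  have bij: "bij_betw \<sigma> D D" by (rule AutD[OF \<sigma>])
  have bi: "bij_betw ?\<tau> D D"
    using bij_betw_inv_into[OF bij] bij_betw_cong[of D ?\<tau> "inv_into D \<sigma>"] by simp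
  have st: "\<sigma> (?\<tau> d) = d" "?\<tau> d \<in> D" if "d \<in> D" for d
    using that bij by (auto simp: bij_betw_def f_inv_into_f inv_into_into)
  have ts: "?\<tau> (\<sigma> d) = d" if "d \<in> D" for d
    using that bij by (auto simp: bij_betw_def)
  have map: "map \<sigma> (map ?\<tau> xs) = xs" "map ?\<tau> xs \<in> lists D" if "xs \<in> lists D" for xs
  proof -
    have "map (\<sigma> \<circ> ?\<tau>) xs = map id xs" using that st by (intro map_cong) (auto simp: in_lists_conv_set)
    then show "map \<sigma> (map ?\<tau> xs) = xs" by simp
    show "map ?\<tau> xs \<in> lists D" using that st(2) by (auto simp: in_lists_conv_set)
  qed
  have "?\<tau> (fn C f xs) = fn C f (map ?\<tau> xs)" if "(f, length xs) \<in> Funs L" "xs \<in> lists D" for f xs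
  proof -
    let ?ys = "map ?\<tau> xs"
    have "\<sigma> (fn C f ?ys) = fn C f xs"
      using AutD(3)[OF \<sigma>, of f ?ys] map[OF that(2)] that(1) by simp
    moreover have "fn C f ?ys \<in> D"
      using that(1) by (intro fun_closedD[OF D] map(2)[OF that(2)]) simp
    ultimately show ?thesis using ts by metis
  qed
  moreover have "rl C R xs = rl C R (map ?\<tau> xs)" if "(R, length xs) \<in> Rels L" "xs \<in> lists D" for R xs
    using AutD(4)[OF \<sigma>, of R "map ?\<tau> xs"] map[OF that(2)] that(1) by simp
  moreover have "?\<tau> \<in> Bij D" using bi by (auto simp: Bij_def)
  ultimately show ?thesis by (intro AutI) blast+
qed

text \<open>Gives the abstract group inverse as a concrete map, so that closure of a subgroup under
  inverses yields automorphisms one can evaluate.\<close>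

lemma Aut_group_inv:
  assumes \<sigma>: "\<sigma> \<in> Aut L C D" and D: "fun_closed L C D"
  shows "inv\<^bsub>Aut_group L C D\<^esub> \<sigma> = restrict (inv_into D \<sigma>) D"
proof -
  let ?\<tau> = "restrict (inv_into D \<sigma>) D"
  have bij: "bij_betw \<sigma> D D" by (rule AutD[OF \<sigma>])
  have \<tau>: "?\<tau> \<in> Aut L C D" by (rule Aut_inverse[OF \<sigma> D])
  have Bij: "\<rho> \<in> Bij D" if "\<rho> \<in> Aut L C D" for \<rho> using that by (simp add: Aut_def)
  have "compose D \<sigma> ?\<tau> = (\<lambda>x\<in>D. x)" "compose D ?\<tau> \<sigma> = (\<lambda>x\<in>D. x)"
    using bij by (auto simp: compose_def fun_eq_iff bij_betw_def f_inv_into_f)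
  then have inv: "\<sigma> \<otimes>\<^bsub>Aut_group L C D\<^esub> ?\<tau> = \<one>\<^bsub>Aut_group L C D\<^esub>" "?\<tau> \<otimes>\<^bsub>Aut_group L C D\<^esub> \<sigma> = \<one>\<^bsub>Aut_group L C D\<^esub>"
    using Bij[OF \<sigma>] Bij[OF \<tau>] by (simp_all add: Aut_group_def BijGroup_def)
  have uniq: "\<rho> = ?\<tau>" if \<rho>: "\<rho> \<in> Aut L C D" "\<rho> \<otimes>\<^bsub>Aut_group L C D\<^esub> \<sigma> = \<one>\<^bsub>Aut_group L C D\<^esub>" for \<rho>
  proof (rule extensionalityI[of _ D])
    show "\<rho> \<in> extensional D" by (rule AutD[OF \<rho>(1)])
    fix d assume d: "d \<in> D"
    have comp: "compose D \<rho> \<sigma> = (\<lambda>x\<in>D. x)"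
      using \<rho>(2) Bij[OF \<sigma>] Bij[OF \<rho>(1)] by (simp add: Aut_group_def BijGroup_def)
    let ?e = "inv_into D \<sigma> d"
    have e: "?e \<in> D" "\<sigma> ?e = d" using bij d by (auto simp: bij_betw_def inv_into_into f_inv_into_f)
    have "\<rho> (\<sigma> ?e) = ?e" using fun_cong[OF comp, of ?e] e(1) by (simp add: compose_def)
    then show "\<rho> d = ?\<tau> d" using e d by simp
  qed simp
  show ?thesis
    unfolding m_inv_def
  proof (rule the_equality)
    show "?\<tau> \<in> carrier (Aut_group L C D) \<and> \<sigma> \<otimes>\<^bsub>Aut_group L C D\<^esub> ?\<tau> = \<one>\<^bsub>Aut_group L C D\<^esub> \<and>
        ?\<tau> \<otimes>\<^bsub>Aut_group L C D\<^esub> \<sigma> = \<one>\<^bsub>Aut_group L C D\<^esub>"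
      using inv \<tau> by (simp add: Aut_group_def)
  qed (use uniq in \<open>auto simp: Aut_group_def\<close>)
qed

section \<open>Elementary substructures\<close>

text \<open>The definition speaks of variables indexed by numbers; the finitely many variables of a
  formula over any index type can be recoded.\<close>

lemma elementary_substructure_sat:
  fixes s :: "'v \<Rightarrow> 'c"
  assumes el: "elementary_substructure L C M" and \<phi>: "\<phi> \<in> Fm L {}" and s: "range s \<subseteq> M"
  shows "sat C M s \<phi> = sat C UNIV s \<phi>"
proof -
  let ?W = "{v. Inl v \<in> vars_fm \<phi>}"
  have "finite ?W" using finite_vimageI[OF finite_vars_fm inj_Inl] by (simp add: vimage_def)
  then obtain g :: "'v \<Rightarrow> nat" where g: "inj_on g ?W"
    by (metis finite_imp_inj_to_nat_seg)
  let ?s = "s \<circ> inv_into ?W g" and ?\<phi> = "map_fm (map_sum g id) \<phi>"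
  have wf: "wf_fm L 0 \<phi>" using \<phi> by (simp add: Fm_def)
  have 1: "sat C D ?s ?\<phi> = sat C D s \<phi>" for D
    unfolding sat_map unfolding sat_def
  proof (rule eval_fm_cong[OF wf refl])
    fix v assume "v \<in> vars_fm \<phi>"
    then show "(case_sum ?s id \<circ> map_sum g id) v = case_sum s id v"
      by (cases v rule: sum.exhaust) (simp_all add: inv_into_f_f[OF g])
  qed
  have "map_sum g id v \<in> range Inl" if "v \<in> vars_fm \<phi>" for v :: "'v + 'c"
    using that Fm_empty_Inr[OF \<phi>] by (cases v rule: sum.exhaust) auto
  then have "?\<phi> \<in> Fm L {}" using wf by (auto simp: Fm_def fm.set_map)
  moreover have "\<forall>\<phi>\<in>Fm L {}. \<forall>s :: nat \<Rightarrow> 'c. range s \<subseteq> M \<longrightarrow> sat C M s \<phi> = sat C UNIV s \<phi>"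
    using el by (simp add: elementary_substructure_def)
  moreover have "range ?s \<subseteq> M" using s by auto
  ultimately have "sat C M ?s ?\<phi> = sat C UNIV ?s ?\<phi>" by blast
  then show ?thesis using 1 by simp
qed

text \<open>Under \<open>Ex\<close>, this says that some element, the bound index 0, differs from
  the values of the first \<open>k\<close> variables.\<close>

fun fresh_fm :: "nat \<Rightarrow> ('f, 'r, nat, 'c) pfm" where
  "fresh_fm 0 = Eq (Bnd 0) (Bnd 0)"
| "fresh_fm (Suc k) = Neg (Or (Neg (fresh_fm k)) (Eq (Bnd 0) (Free (Inl k))))"

lemma eval_fresh_fm: "eval_fm C D e s (fresh_fm k) \<longleftrightarrow> (\<forall>j<k. e 0 \<noteq> s (Inl j))"
  by (induction k) (auto simp: less_Suc_eq)

lemma fresh_fm_Fm: "wf_fm L (Suc 0) (fresh_fm k)" "vars_fm (fresh_fm k) \<subseteq> range Inl"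
  by (induction k) auto

text \<open>Otherwise the formula saying that some element differs from all those listed in
  \<open>M\<close> holds in the monster but not in \<open>M\<close>.\<close>

lemma finite_elementary_substructure:
  assumes el: "elementary_substructure L C M" and fin: "finite M" shows "M = UNIV"
proof (rule ccontr)
  assume "M \<noteq> UNIV"
  then obtain c where c: "c \<notin> M" by auto
  obtain xs where xs: "set xs = M" using finite_list[OF fin] by auto
  obtain m0 where m0: "m0 \<in> M" using el by (auto simp: elementary_substructure_def)
  \<comment> \<open>Assignments are total and have to stay in \<open>M\<close>, hence the default
    \<open>m0\<close>.\<close>
  define s where "s j = (if j < length xs then xs ! j else m0)" for j
  have s: "range s \<subseteq> M" using xs m0 by (auto simp: s_def)
  have sx: "\<exists>j<length xs. s j = d" if "d \<in> M" for d
  proof -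
    have "d \<in> set xs" using that xs by simp
    then obtain j where "j < length xs" "xs ! j = d" unfolding in_set_conv_nth by blast
    then show ?thesis by (intro exI[of _ j]) (simp add: s_def)
  qed
  let ?\<phi> = "Ex (fresh_fm (length xs))"
  have "?\<phi> \<in> Fm L {}" by (simp add: Fm_def fresh_fm_Fm)
  then have "sat C M s ?\<phi> = sat C UNIV s ?\<phi>" using el s by (auto simp: elementary_substructure_def)
  moreover have "sat C UNIV s ?\<phi>" using c s by (auto simp: sat_def eval_fresh_fm)
  moreover have "\<not> sat C M s ?\<phi>" using sx by (auto simp: sat_def eval_fresh_fm)
  ultimately show False by simp
qed

lemma sat_inst_x [simp]: "sat C D s (inst_x n \<phi>) = sat C D (case_sum n s) \<phi>"
proof -
  have "case_sum s id \<circ> case_sum (case_sum (Inr \<circ> n) Inl) Inr = case_sum (case_sum n s) id"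
    by (auto simp: fun_eq_iff split: sum.split)
  then show ?thesis by (simp add: inst_x_def sat_map) (simp add: sat_def)
qed

lemma sat_inst_y [simp]: "sat C D s (inst_y n \<phi>) = sat C D (case_sum s n) \<phi>"
proof -
  have "case_sum s id \<circ> case_sum (case_sum Inl (Inr \<circ> n)) Inr = case_sum (case_sum s n) id"
    by (auto simp: fun_eq_iff split: sum.split)
  then show ?thesis by (simp add: inst_y_def sat_map) (simp add: sat_def)
qed

lemma inst_x_Fm: "wf_fm L 0 \<phi> \<Longrightarrow> inst_x n \<phi> \<in> Fm L UNIV"
  by (simp add: inst_x_def Fm_UNIV)

lemma inst_y_Fm:
  assumes "\<phi> \<in> Fm L A" "range n \<subseteq> A" shows "inst_y n \<phi> \<in> Fm L A"
proof -
  have "case_sum (case_sum Inl (Inr \<circ> n)) Inr v \<in> range Inl \<union> Inr ` A" if "v \<in> vars_fm \<phi>" for v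
    using that assms Fm_Inr[OF assms(1)] by (auto split: sum.split)
  then show ?thesis using assms(1) by (auto simp: Fm_def inst_y_def fm.set_map)
qed

lemma regular_borel_probD:
  "regular_borel_prob X N \<Longrightarrow> B \<in> sets N \<Longrightarrow> 0 < e \<Longrightarrow>
    \<exists>K U. closedin X K \<and> openin X U \<and> K \<subseteq> B \<and> B \<subseteq> U \<and> measure N (U - K) < e"
  by (simp add: regular_borel_prob_def)

section \<open>Keisler measures as regular Borel measures\<close>

definition basic_types :: "('f, 'r) lang \<Rightarrow> ('f, 'r, 'c) struct \<Rightarrow> 'c set \<Rightarrow> ('f, 'r, 'v, 'c) pfm \<Rightarrow> ('f, 'r, 'v, 'c) pfm set set" where
  "basic_types L C A \<phi> = {p \<in> complete_types L C A. \<phi> \<in> p}"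

lemma basic_types_Neg: "\<phi> \<in> Fm L A \<Longrightarrow> basic_types L C A (Neg \<phi>) = complete_types L C A - basic_types L C A \<phi>"
  by (auto simp: basic_types_def complete_type_Neg)

lemma basic_types_Or: "\<phi> \<in> Fm L A \<Longrightarrow> \<psi> \<in> Fm L A \<Longrightarrow>
    basic_types L C A (Or \<phi> \<psi>) = basic_types L C A \<phi> \<union> basic_types L C A \<psi>"
  by (auto simp: basic_types_def complete_type_Or)

lemma basic_types_top: "basic_types L C A top_fm = complete_types L C A"
  using complete_type_conseq[of _ L C A "{}" top_fm] by (auto simp: basic_types_def)

text \<open>Compactness: without a finite subcover, the negations of the covering formulas are
  finitely satisfiable, and a complete type containing them lies in no member of the cover.\<close>

lemma stone_space_types:
  fixes L :: "('f, 'r) lang" and C :: "('f, 'r, 'c) struct"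
  shows "stone_space (complete_types L C A :: ('f, 'r, 'v, 'c) pfm set set) (basic_types L C A ` Fm L A)"
proof (intro stone_space.intro stone_space_axioms.intro)
  let ?O = "complete_types L C A :: ('f, 'r, 'v, 'c) pfm set set" and ?b = "basic_types L C A :: ('f, 'r, 'v, 'c) pfm \<Rightarrow> _"
  show "algebra ?O (?b ` Fm L A)"
    unfolding algebra_iff_Un
  proof (intro conjI ballI)
    show "?b ` Fm L A \<subseteq> Pow ?O" by (auto simp: basic_types_def)
    have "?b (Neg top_fm) = {}" by (simp add: basic_types_Neg basic_types_top)
    then show "{} \<in> ?b ` Fm L A" by (metis Neg_Fm image_eqI top_fm_Fm)
  next
    fix a assume "a \<in> ?b ` Fm L A"
    then show "?O - a \<in> ?b ` Fm L A"
      by (auto simp: basic_types_Neg[symmetric])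
  next
    fix a b assume "a \<in> ?b ` Fm L A" "b \<in> ?b ` Fm L A"
    then show "a \<union> b \<in> ?b ` Fm L A"
      by (auto simp: basic_types_Or[symmetric])
  qed
next
  let ?O = "complete_types L C A :: ('f, 'r, 'v, 'c) pfm set set" and ?b = "basic_types L C A :: ('f, 'r, 'v, 'c) pfm \<Rightarrow> _"
  fix \<C> assume \<C>: "\<C> \<subseteq> ?b ` Fm L A" "\<Union>\<C> = ?O"
  define \<Phi> where "\<Phi> = {\<phi> \<in> Fm L A. ?b \<phi> \<in> \<C>}"
  show "\<exists>\<D>\<subseteq>\<C>. finite \<D> \<and> \<Union>\<D> = ?O"
  proof (rule ccontr)
    assume no: "\<not> ?thesis"
    have "fin_sat C (Neg ` \<Phi>)"
      unfolding fin_sat_def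
    proof (intro allI impI)
      fix F assume "F \<subseteq> Neg ` \<Phi>" "finite F"
      then obtain \<Phi>0 where \<Phi>0: "\<Phi>0 \<subseteq> \<Phi>" "finite \<Phi>0" "F = Neg ` \<Phi>0" by (meson finite_subset_image)
      have "?b ` \<Phi>0 \<subseteq> \<C>" "finite (?b ` \<Phi>0)" using \<Phi>0 by (auto simp: \<Phi>_def)
      then have "\<Union>(?b ` \<Phi>0) \<noteq> ?O" using no by blast
      moreover have "\<Union>(?b ` \<Phi>0) \<subseteq> ?O" by (auto simp: basic_types_def)
      ultimately obtain q where q: "q \<in> ?O" "\<And>\<phi>. \<phi> \<in> \<Phi>0 \<Longrightarrow> \<phi> \<notin> q" by (auto simp: basic_types_def)
      have "F \<subseteq> q"
      proof
        fix \<psi> assume "\<psi> \<in> F"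
        then obtain \<phi> where \<phi>: "\<phi> \<in> \<Phi>0" "\<psi> = Neg \<phi>" using \<Phi>0(3) by auto
        moreover have "\<phi> \<in> Fm L A" using \<phi>(1) \<Phi>0(1) by (auto simp: \<Phi>_def)
        ultimately show "\<psi> \<in> q" using q(2)[OF \<phi>(1)] complete_type_Neg[OF q(1)] by simp
      qed
      then show "\<exists>s. \<forall>\<phi>\<in>F. sat C UNIV s \<phi>"
        using q(1) \<open>finite F\<close> unfolding complete_types_alt fin_sat_def by meson
    qed
    moreover have "Neg ` \<Phi> \<subseteq> Fm L A" by (auto simp: \<Phi>_def)
    ultimately obtain q where q: "q \<in> ?O" "Neg ` \<Phi> \<subseteq> q" using extend_to_complete_type by metis
    then have "q \<in> \<Union>\<C>" using \<C>(2) by simp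
    then obtain c where c: "c \<in> \<C>" "q \<in> c" by (rule UnionE)
    then obtain \<phi> where \<phi>: "\<phi> \<in> Fm L A" "c = ?b \<phi>" using \<C>(1) by auto
    then have "\<phi> \<in> \<Phi>" "\<phi> \<in> q" using c by (auto simp: \<Phi>_def basic_types_def)
    then show False using q complete_type_Neg[OF q(1) \<phi>(1)] by auto
  qed
qed

lemma type_space_X: "type_space L C A = stone_space.X (basic_types L C A ` Fm L A)"
  unfolding type_space_def stone_space.X_def[OF stone_space_types] basic_types_def ..

lemma basic_types_subset_sat:
  assumes "basic_types L C A \<phi> \<subseteq> basic_types L C A \<psi>" "\<phi> \<in> Fm L A" "\<psi> \<in> Fm L A" "sat C UNIV s \<phi>"
  shows "sat C UNIV s \<psi>"
proof -
  have "tp L C A s \<in> basic_types L C A \<phi>" using assms tp_complete[of L C A s] by (auto simp: basic_types_def tp_def)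
  then have "tp L C A s \<in> basic_types L C A \<psi>" using assms(1) by auto
  then show ?thesis by (auto simp: basic_types_def tp_def)
qed

lemma keislerD:
  assumes "\<mu> \<in> keisler L C A"
  shows "\<mu> \<in> extensional (Fm L A)" "\<phi> \<in> Fm L A \<Longrightarrow> 0 \<le> \<mu> \<phi>"
    "\<phi> \<in> Fm L A \<Longrightarrow> \<forall>s. sat C UNIV s \<phi> \<Longrightarrow> \<mu> \<phi> = 1"
    "\<phi> \<in> Fm L A \<Longrightarrow> \<psi> \<in> Fm L A \<Longrightarrow> \<forall>s. sat C UNIV s \<phi> = sat C UNIV s \<psi> \<Longrightarrow> \<mu> \<phi> = \<mu> \<psi>"
    "\<phi> \<in> Fm L A \<Longrightarrow> \<psi> \<in> Fm L A \<Longrightarrow> \<forall>s. \<not> (sat C UNIV s \<phi> \<and> sat C UNIV s \<psi>) \<Longrightarrow> \<mu> (Or \<phi> \<psi>) = \<mu> \<phi> + \<mu> \<psi>"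
  using assms unfolding keisler_def by blast+

lemma keislerI:
  assumes "\<mu> \<in> extensional (Fm L A)" "\<And>\<phi>. \<phi> \<in> Fm L A \<Longrightarrow> 0 \<le> \<mu> \<phi>"
    "\<And>\<phi>. \<phi> \<in> Fm L A \<Longrightarrow> \<forall>s. sat C UNIV s \<phi> \<Longrightarrow> \<mu> \<phi> = 1"
    "\<And>\<phi> \<psi>. \<phi> \<in> Fm L A \<Longrightarrow> \<psi> \<in> Fm L A \<Longrightarrow> \<forall>s. sat C UNIV s \<phi> = sat C UNIV s \<psi> \<Longrightarrow> \<mu> \<phi> = \<mu> \<psi>"
    "\<And>\<phi> \<psi>. \<phi> \<in> Fm L A \<Longrightarrow> \<psi> \<in> Fm L A \<Longrightarrow> \<forall>s. \<not> (sat C UNIV s \<phi> \<and> sat C UNIV s \<psi>) \<Longrightarrow> \<mu> (Or \<phi> \<psi>) = \<mu> \<phi> + \<mu> \<psi>"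
  shows "\<mu> \<in> keisler L C A"
  using assms unfolding keisler_def by blast

lemma keisler_le_1:
  fixes \<mu> :: "('f, 'r, 'v, 'c) pfm \<Rightarrow> real"
  assumes \<mu>: "\<mu> \<in> keisler L C A" and \<phi>: "\<phi> \<in> Fm L A" shows "\<mu> \<phi> \<le> 1"
proof -
  have "\<mu> (Or \<phi> (Neg \<phi>)) = \<mu> \<phi> + \<mu> (Neg \<phi>)" using \<phi> by (intro keislerD(5)[OF \<mu>]) auto
  moreover have "\<mu> (Or \<phi> (Neg \<phi>)) = 1" using \<phi> by (intro keislerD(3)[OF \<mu>]) auto
  moreover have "0 \<le> \<mu> (Neg \<phi>)" using \<phi> by (intro keislerD(2)[OF \<mu>]) simp
  ultimately show ?thesis by linarith
qed

text \<open>Justifies the definite description: the measure defines a content on clopen sets, whose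
  regular extension exists and is unique.\<close>

theorem borel_ext:
  fixes \<mu> :: "('f, 'r, 'v, 'c) pfm \<Rightarrow> real"
  assumes \<mu>: "\<mu> \<in> keisler L C A"
  shows "regular_borel_prob (type_space L C A) (borel_ext L C A \<mu>)"
    and "\<phi> \<in> Fm L A \<Longrightarrow> measure (borel_ext L C A \<mu>) (basic_types L C A \<phi>) = \<mu> \<phi>"
proof -
  let ?b = "basic_types L C A :: ('f, 'r, 'v, 'c) pfm \<Rightarrow> _"
  interpret stone_space "complete_types L C A" "?b ` Fm L A" by (rule stone_space_types)
  have same: "\<mu> \<phi> = \<mu> \<psi>" if "\<phi> \<in> Fm L A" "\<psi> \<in> Fm L A" "?b \<phi> = ?b \<psi>" for \<phi> \<psi>
    using that basic_types_subset_sat[of L C A \<phi> \<psi>] basic_types_subset_sat[of L C A \<psi> \<phi>]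
    by (intro keislerD(4)[OF \<mu>]) auto
  \<comment> \<open>A clopen set may be defined by several formulas; by \<open>same\<close> all of
    them have the same measure.\<close>
  define c where "c b = \<mu> (SOME \<phi>. \<phi> \<in> Fm L A \<and> ?b \<phi> = b)" for b
  have c: "c (?b \<phi>) = \<mu> \<phi>" if "\<phi> \<in> Fm L A" for \<phi>
  proof -
    have "(SOME \<psi>. \<psi> \<in> Fm L A \<and> ?b \<psi> = ?b \<phi>) \<in> Fm L A \<and> ?b (SOME \<psi>. \<psi> \<in> Fm L A \<and> ?b \<psi> = ?b \<phi>) = ?b \<phi>"
      by (rule someI[of _ \<phi>]) (use that in auto)
    then show ?thesis unfolding c_def using same that by blast
  qed
  interpret stone_content "complete_types L C A" "?b ` Fm L A" c
  proof
    show "0 \<le> c b" if "b \<in> ?b ` Fm L A" for b using that c keislerD(2)[OF \<mu>] by auto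
    show "c (complete_types L C A) = 1"
      using c[of top_fm] keislerD(3)[OF \<mu>, of top_fm] by (simp add: basic_types_top)
    show "c (a \<union> b) = c a + c b" if ab: "a \<in> ?b ` Fm L A" "b \<in> ?b ` Fm L A" "a \<inter> b = {}" for a b
    proof -
      obtain \<phi> \<psi> where \<phi>: "\<phi> \<in> Fm L A" "a = ?b \<phi>" and \<psi>: "\<psi> \<in> Fm L A" "b = ?b \<psi>" using ab by auto
      have "\<not> (sat C UNIV s \<phi> \<and> sat C UNIV s \<psi>)" for s
      proof
        assume "sat C UNIV s \<phi> \<and> sat C UNIV s \<psi>"
        then have "tp L C A s \<in> a \<inter> b"
          using \<phi> \<psi> tp_complete[of L C A s] by (auto simp: basic_types_def tp_def)
        then show False using ab(3) by simp
      qed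
      then have "\<mu> (Or \<phi> \<psi>) = \<mu> \<phi> + \<mu> \<psi>" using \<phi> \<psi> by (intro keislerD(5)[OF \<mu>]) auto
      then show ?thesis using c[of "Or \<phi> \<psi>"] c \<phi> \<psi> by (simp add: basic_types_Or)
    qed
  qed
  let ?P = "\<lambda>N. regular_borel_prob (type_space L C A) N \<and> (\<forall>\<phi>\<in>Fm L A. measure N (?b \<phi>) = \<mu> \<phi>)"
  obtain N where N: "regular_borel_prob X N" "\<And>b. b \<in> ?b ` Fm L A \<Longrightarrow> measure N b = c b"
    using regular_borel_prob_exists by blast
  have "?P N" using N c by (simp add: type_space_X)
  moreover have "N' = N" if "?P N'" for N'
    using that N c by (intro regular_borel_prob_unique) (auto simp: type_space_X)
  ultimately have "?P (THE N. ?P N)" by (rule theI)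
  then have P: "?P (borel_ext L C A \<mu>)" by (simp add: borel_ext_def basic_types_def)
  show "regular_borel_prob (type_space L C A) (borel_ext L C A \<mu>)" using P by blast
  show "measure (borel_ext L C A \<mu>) (?b \<phi>) = \<mu> \<phi>" if "\<phi> \<in> Fm L A" using P that by blast
qed

text \<open>\<open>p\<close> may be uncountable, so countable additivity does not suffice. The
  complement is an open union of null basic sets, a closed subset of it meets only finitely many,
  and regularity does the rest.\<close>

lemma measure_borel_ext_eq_1:
  fixes \<mu> :: "('f, 'r, 'v, 'c) pfm \<Rightarrow> real"
  assumes \<mu>: "\<mu> \<in> keisler L C A" and p: "p \<subseteq> Fm L A" "\<And>\<phi>. \<phi> \<in> p \<Longrightarrow> \<mu> \<phi> = 1"
  shows "measure (borel_ext L C A \<mu>) {q \<in> complete_types L C A. p \<subseteq> q} = 1"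
proof -
  let ?b = "basic_types L C A :: ('f, 'r, 'v, 'c) pfm \<Rightarrow> _" and ?N = "borel_ext L C A \<mu>" and ?K = "{q \<in> complete_types L C A. p \<subseteq> q}"
  interpret stone_space "complete_types L C A" "?b ` Fm L A" by (rule stone_space_types)
  have reg: "regular_borel_prob X ?N" using borel_ext(1)[OF \<mu>] by (simp add: type_space_X)
  interpret N: prob_space ?N using reg by (simp add: regular_borel_prob_def)
  have setsN: "sets ?N = sets (borel_of_top X)" using reg by (simp add: regular_borel_prob_def)
  have "complete_types L C A - ?K = \<Union>(?b ` Neg ` p)"
    using p(1) by (auto simp: basic_types_def complete_type_Neg subset_eq)
  moreover have "openin X (\<Union>(?b ` Neg ` p))"
    using p(1) by (intro openin_Union) (auto intro!: openin_basic)
  ultimately have K: "closedin X ?K" by (auto simp: closedin_def)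
  have KS: "?K \<in> sets ?N" using closed_borel[OF K] setsN by simp
  have spaceN: "space ?N = complete_types L C A" using sets_eq_imp_space_eq[OF setsN] by simp
  have "measure ?N (space ?N - ?K) \<le> 0"
  proof (rule field_le_epsilon)
    fix e :: real assume e: "e > 0"
    have DS: "space ?N - ?K \<in> sets ?N" using KS by auto
    obtain H U where H: "closedin X H" "openin X U" "H \<subseteq> space ?N - ?K" "space ?N - ?K \<subseteq> U" "measure ?N (U - H) < e"
      using regular_borel_probD[OF reg DS e] by (elim exE conjE)
    have "\<exists>b\<in>?b ` Fm L A. q \<in> b \<and> b \<in> ?b ` Neg ` p" if "q \<in> H" for q
    proof -
      have "q \<in> complete_types L C A" "\<not> p \<subseteq> q" using that H(3) spaceN by auto
      then obtain \<phi> where "\<phi> \<in> p" "q \<in> ?b (Neg \<phi>)"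
        using p(1) by (auto simp: basic_types_def complete_type_Neg subset_eq)
      moreover have "Neg \<phi> \<in> Fm L A" using p(1) \<open>\<phi> \<in> p\<close> by auto
      ultimately show ?thesis by (intro bexI[of _ "?b (Neg \<phi>)"] conjI imageI)
    qed
    from closedin_basic_cover[OF H(1) this]
    obtain F where F: "finite F" "F \<subseteq> ?b ` Fm L A" "\<forall>b\<in>F. b \<in> ?b ` Neg ` p" "H \<subseteq> \<Union>F" by metis
    have FS: "F \<subseteq> sets ?N" using F(2) open_borel[OF openin_basic] setsN by auto
    have z: "measure ?N b = 0" if "b \<in> F" for b
    proof -
      have "b \<in> ?b ` Neg ` p" using F(3) that by blast
      then obtain \<phi> where \<phi>: "\<phi> \<in> p" "b = ?b (Neg \<phi>)" by blast
      then have \<phi>F: "\<phi> \<in> Fm L A" using p(1) by auto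
      have "\<mu> (Or \<phi> (Neg \<phi>)) = \<mu> \<phi> + \<mu> (Neg \<phi>)" using \<phi>F by (intro keislerD(5)[OF \<mu>]) auto
      moreover have "\<mu> (Or \<phi> (Neg \<phi>)) = 1" using \<phi>F by (intro keislerD(3)[OF \<mu>]) auto
      ultimately show ?thesis using p(2)[OF \<phi>(1)] borel_ext(2)[OF \<mu>, of "Neg \<phi>"] \<phi>F \<phi>(2) by simp
    qed
    have "measure ?N (\<Union>F) \<le> (\<Sum>b\<in>F. measure ?N b)"
      using N.finite_measure_subadditive_finite[of F "\<lambda>b. b"] F(1) FS by auto
    then have UF: "measure ?N (\<Union>F) \<le> 0" using z by simp
    have UH: "U - H \<in> sets ?N" using open_borel[OF H(2)] closed_borel[OF H(1)] setsN by auto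
    have FU: "\<Union>F \<in> sets ?N" using F(1) FS by auto
    have "measure ?N (space ?N - ?K) \<le> measure ?N ((U - H) \<union> \<Union>F)"
      using H(4) F(4) by (intro N.finite_measure_mono sets.Un UH FU) auto
    also have "\<dots> \<le> measure ?N (U - H) + measure ?N (\<Union>F)" using UH FU by (rule measure_Un_le)
    finally show "measure ?N (space ?N - ?K) \<le> 0 + e" using H(5) UF by simp
  qed
  then show ?thesis using N.prob_compl[OF KS] measure_nonneg[of ?N "space ?N - ?K"] by linarith
qed

text \<open>The conditions are equations and weak inequalities between finitely many values, which
  pass to pointwise limits.\<close>

lemma keisler_limit:
  fixes g :: "'z \<Rightarrow> ('f, 'r, 'v, 'c) pfm \<Rightarrow> real"
  assumes "U \<noteq> bot" and ev: "eventually (\<lambda>r. g r \<in> keisler L C A) U"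
    and lim: "\<And>\<phi>. \<phi> \<in> Fm L A \<Longrightarrow> ((\<lambda>r. g r \<phi>) \<longlongrightarrow> \<rho> \<phi>) U" and ext: "\<rho> \<in> extensional (Fm L A)"
  shows "\<rho> \<in> keisler L C A"
proof (rule keislerI[OF ext])
  fix \<phi> :: "('f, 'r, 'v, 'c) pfm" assume \<phi>: "\<phi> \<in> Fm L A"
  show "0 \<le> \<rho> \<phi>"
    by (rule tendsto_lowerbound[OF lim[OF \<phi>] _ assms(1)])
      (rule eventually_mono[OF ev], rule keislerD(2)[OF _ \<phi>])
  show "\<rho> \<phi> = 1" if "\<forall>s. sat C UNIV s \<phi>"
  proof -
    have "eventually (\<lambda>r. g r \<phi> = 1) U"
      by (rule eventually_mono[OF ev]) (rule keislerD(3)[OF _ \<phi> that])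
    then have "((\<lambda>r. g r \<phi>) \<longlongrightarrow> 1) U" by (rule tendsto_eventually)
    then show ?thesis using tendsto_unique[OF assms(1) lim[OF \<phi>]] by blast
  qed
  fix \<psi> :: "('f, 'r, 'v, 'c) pfm" assume \<psi>: "\<psi> \<in> Fm L A"
  show "\<rho> \<phi> = \<rho> \<psi>" if "\<forall>s. sat C UNIV s \<phi> = sat C UNIV s \<psi>"
  proof -
    have "eventually (\<lambda>r. g r \<phi> = g r \<psi>) U"
      by (rule eventually_mono[OF ev]) (rule keislerD(4)[OF _ \<phi> \<psi> that])
    then have "((\<lambda>r. g r \<psi>) \<longlongrightarrow> \<rho> \<phi>) U" using lim[OF \<phi>] by (simp add: filterlim_cong)
    then show ?thesis using tendsto_unique[OF assms(1) _ lim[OF \<psi>]] by blast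
  qed
  show "\<rho> (Or \<phi> \<psi>) = \<rho> \<phi> + \<rho> \<psi>" if "\<forall>s. \<not> (sat C UNIV s \<phi> \<and> sat C UNIV s \<psi>)"
  proof -
    have "eventually (\<lambda>r. g r (Or \<phi> \<psi>) = g r \<phi> + g r \<psi>) U"
      by (rule eventually_mono[OF ev]) (rule keislerD(5)[OF _ \<phi> \<psi> that])
    moreover have "((\<lambda>r. g r \<phi> + g r \<psi>) \<longlongrightarrow> \<rho> \<phi> + \<rho> \<psi>) U" by (intro tendsto_add lim \<phi> \<psi>)
    ultimately have "((\<lambda>r. g r (Or \<phi> \<psi>)) \<longlongrightarrow> \<rho> \<phi> + \<rho> \<psi>) U" by (simp add: filterlim_cong)
    then show ?thesis using tendsto_unique[OF assms(1) lim[of "Or \<phi> \<psi>"]] \<phi> \<psi> by simp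
  qed
qed

lemma keisler_convex:
  fixes g :: "'z \<Rightarrow> ('f, 'r, 'v, 'c) pfm \<Rightarrow> real"
  assumes "finite S" "\<And>i. i \<in> S \<Longrightarrow> 0 \<le> w i" "sum w S = (1::real)" "\<And>i. i \<in> S \<Longrightarrow> g i \<in> keisler L C A"
  shows "(\<lambda>\<phi>\<in>Fm L A. \<Sum>i\<in>S. w i * g i \<phi>) \<in> keisler L C A"
proof (rule keislerI)
  fix \<phi> :: "('f, 'r, 'v, 'c) pfm" assume \<phi>: "\<phi> \<in> Fm L A"
  show "0 \<le> (\<lambda>\<phi>\<in>Fm L A. \<Sum>i\<in>S. w i * g i \<phi>) \<phi>"
    using assms(2) keislerD(2)[OF assms(4) \<phi>] \<phi> by (auto intro!: sum_nonneg mult_nonneg_nonneg)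
  show "(\<lambda>\<phi>\<in>Fm L A. \<Sum>i\<in>S. w i * g i \<phi>) \<phi> = 1" if "\<forall>s. sat C UNIV s \<phi>"
  proof -
    have "(\<Sum>i\<in>S. w i * g i \<phi>) = sum w S"
      by (rule sum.cong) (simp_all add: keislerD(3)[OF assms(4) \<phi> that])
    then show ?thesis using \<phi> assms(3) by simp
  qed
  fix \<psi> :: "('f, 'r, 'v, 'c) pfm" assume \<psi>: "\<psi> \<in> Fm L A"
  show "(\<lambda>\<phi>\<in>Fm L A. \<Sum>i\<in>S. w i * g i \<phi>) \<phi> = (\<lambda>\<phi>\<in>Fm L A. \<Sum>i\<in>S. w i * g i \<phi>) \<psi>"
    if "\<forall>s. sat C UNIV s \<phi> = sat C UNIV s \<psi>"
    using \<phi> \<psi> keislerD(4)[OF assms(4) \<phi> \<psi> that] by (auto intro!: sum.cong)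
  show "(\<lambda>\<phi>\<in>Fm L A. \<Sum>i\<in>S. w i * g i \<phi>) (Or \<phi> \<psi>)
      = (\<lambda>\<phi>\<in>Fm L A. \<Sum>i\<in>S. w i * g i \<phi>) \<phi> + (\<lambda>\<phi>\<in>Fm L A. \<Sum>i\<in>S. w i * g i \<phi>) \<psi>"
    if "\<forall>s. \<not> (sat C UNIV s \<phi> \<and> sat C UNIV s \<psi>)"
    using \<phi> \<psi> keislerD(5)[OF assms(4) \<phi> \<psi> that] by (simp add: algebra_simps flip: sum.distrib)
qed simp

lemma dirac_keisler: "dirac L A (tp L C A n) \<in> keisler L C A"
  by (rule keislerI) (auto simp: dirac_def tp_def)

lemma sat_keisler: "(\<lambda>\<theta>\<in>Fm L A. of_bool (sat C UNIV a \<theta>)) \<in> keisler L C A"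
  by (rule keislerI) auto

section \<open>Limits along filters and closures\<close>

text \<open>The filter lives on the index set instead of the image, so that two different maps on
  the same indices can be followed along it.\<close>

lemma closure_of_filter:
  assumes "x \<in> X closure_of (g ` S)"
  obtains U where "U \<noteq> bot" "eventually (\<lambda>r. r \<in> S) U" "limitin X g x U"
proof -
  let ?T = "{T. openin X T \<and> x \<in> T}"
  define U where "U = (INF T\<in>?T. principal {r \<in> S. g r \<in> T})"
  have x: "x \<in> topspace X" and meet: "\<And>T. T \<in> ?T \<Longrightarrow> \<exists>r\<in>S. g r \<in> T"
    using assms by (auto simp: in_closure_of)
  have ev: "eventually P U \<longleftrightarrow> (\<exists>T\<in>?T. eventually P (principal {r \<in> S. g r \<in> T}))" for P
    unfolding U_def
  proof (rule eventually_INF_base)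
    show "?T \<noteq> {}" using x by auto
    fix T T' assume "T \<in> ?T" "T' \<in> ?T"
    then show "\<exists>T''\<in>?T. principal {r \<in> S. g r \<in> T''} \<le> inf (principal {r \<in> S. g r \<in> T}) (principal {r \<in> S. g r \<in> T'})"
      by (intro bexI[of _ "T \<inter> T'"]) auto
  qed
  show ?thesis
  proof (rule that[of U])
    show "U \<noteq> bot"
    proof
      assume "U = bot"
      then have "eventually (\<lambda>_. False) U" by simp
      then show False using meet unfolding ev by (auto simp: eventually_principal)
    qed
    show "eventually (\<lambda>r. r \<in> S) U" unfolding ev using x by (auto simp: eventually_principal)
    show "limitin X g x U"
      unfolding limitin_def using x by (auto simp: ev eventually_principal)
  qed
qed

lemma limitin_closure_of:
  assumes "limitin X g x U" "U \<noteq> bot" "eventually (\<lambda>r. r \<in> S) U"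
  shows "x \<in> X closure_of (g ` S)"
  unfolding in_closure_of
proof (intro conjI allI impI)
  show "x \<in> topspace X" using assms(1) by (simp add: limitin_def)
  fix T assume "x \<in> T \<and> openin X T"
  then have "eventually (\<lambda>r. g r \<in> T) U" using assms(1) by (simp add: limitin_def)
  then have "eventually (\<lambda>r. r \<in> S \<and> g r \<in> T) U" using assms(3) by (simp add: eventually_conj)
  then obtain r where "r \<in> S" "g r \<in> T" using eventually_happens'[OF assms(2)] by blast
  then show "\<exists>y. y \<in> g ` S \<and> y \<in> T" by blast
qed

text \<open>Splitting on one set \<open>B j\<close> turns a condition on the trace into two
  conditions on a shorter trace. This makes the level sets of finite combinations of indicators
  clopen.\<close>

lemma (in algebra) trace_pattern_in_algebra:
  "finite S \<Longrightarrow> (\<And>i. i \<in> S \<Longrightarrow> B i \<in> M) \<Longrightarrow> {x \<in> \<Omega>. P {i \<in> S. x \<in> B i}} \<in> M"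
proof (induction S arbitrary: P rule: finite_induct)
  case empty
  have "{x \<in> \<Omega>. P {}} = (if P {} then \<Omega> else {})" by auto
  then show ?case by simp
next
  case (insert j S)
  have IH: "{x \<in> \<Omega>. Q {i \<in> S. x \<in> B i}} \<in> M" for Q using insert by blast
  have B: "B j \<in> M" using insert by blast
  have "{i \<in> insert j S. x \<in> B i} = (if x \<in> B j then insert j {i \<in> S. x \<in> B i} else {i \<in> S. x \<in> B i})" for x
    by auto
  then have "{x \<in> \<Omega>. P {i \<in> insert j S. x \<in> B i}} =
      (B j \<inter> {x \<in> \<Omega>. P (insert j {i \<in> S. x \<in> B i})}) \<union> ((\<Omega> - B j) \<inter> {x \<in> \<Omega>. P {i \<in> S. x \<in> B i}})"
    using sets_into_space[OF B] by auto
  then show ?case using IH[of "\<lambda>T. P (insert j T)"] IH[of P] B by auto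
qed

lemma tp_realization:
  assumes "q \<in> complete_types L C A" "\<forall>\<phi>\<in>q. sat C UNIV s \<phi>" shows "tp L C A s = q"
proof
  show "q \<subseteq> tp L C A s" using assms by (auto simp: tp_def complete_types_def)
  show "tp L C A s \<subseteq> q"
  proof
    fix \<phi> assume \<phi>: "\<phi> \<in> tp L C A s"
    show "\<phi> \<in> q"
    proof (rule ccontr)
      assume "\<phi> \<notin> q"
      then have "Neg \<phi> \<in> q" using complete_type_Neg[OF assms(1)] \<phi> by (auto simp: tp_def)
      then show False using assms(2) \<phi> by (auto simp: tp_def)
    qed
  qed
qed

section \<open>The compact Hausdorff space of Keisler measures\<close>

lemma topspace_keisler_space [simp]: "topspace (keisler_space L C A) = keisler L C A"
proof -
  have "keisler L C A \<subseteq> extensional (Fm L A)" using keislerD(1) by blast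
  then show ?thesis by (auto simp: keisler_space_def PiE_def)
qed

lemma limitin_keisler_space:
  "limitin (keisler_space L C A) g \<mu> U \<longleftrightarrow> \<mu> \<in> keisler L C A \<and> eventually (\<lambda>r. g r \<in> keisler L C A) U \<and>
    (\<forall>\<theta>\<in>Fm L A. ((\<lambda>r. g r \<theta>) \<longlongrightarrow> \<mu> \<theta>) U)"
  unfolding keisler_space_def limitin_subtopology limitin_componentwise
  by (auto simp: PiE_iff keislerD(1) elim!: eventually_mono)

text \<open>A subset of a product of unit intervals, closed by \<open>keisler_limit\<close>.\<close>

lemma compact_keisler_space: "compact_space (keisler_space L C A)"
proof -
  let ?P = "product_topology (\<lambda>_. euclideanreal) (Fm L A)"
  have "compactin ?P (PiE (Fm L A) (\<lambda>_. {0..1}))" by (simp add: compactin_PiE)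
  moreover have "keisler L C A \<subseteq> PiE (Fm L A) (\<lambda>_. {0..1})"
  proof
    fix \<mu> assume \<mu>: "\<mu> \<in> keisler L C A"
    show "\<mu> \<in> PiE (Fm L A) (\<lambda>_. {0..1})"
      using keislerD(1,2)[OF \<mu>] keisler_le_1[OF \<mu>] by (simp add: PiE_iff)
  qed
  moreover have "closedin ?P (keisler L C A)"
  proof -
    have "?P closure_of (keisler L C A) \<subseteq> keisler L C A"
    proof
      fix \<mu> assume "\<mu> \<in> ?P closure_of (keisler L C A)"
      then have "\<mu> \<in> ?P closure_of ((\<lambda>x. x) ` keisler L C A)" by simp
      then obtain U where "U \<noteq> bot" "eventually (\<lambda>r. r \<in> keisler L C A) U" "limitin ?P (\<lambda>x. x) \<mu> U"
        by (rule closure_of_filter)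
      then show "\<mu> \<in> keisler L C A"
        by (intro keisler_limit[of U "\<lambda>x. x"]) (auto simp: limitin_componentwise)
    qed
    moreover have "keisler L C A \<subseteq> topspace ?P" using keislerD(1) by (fastforce simp: PiE_def)
    ultimately show ?thesis using closure_of_subset_eq by blast
  qed
  ultimately have "compactin ?P (keisler L C A)" by (rule closed_compactin)
  then show ?thesis unfolding keisler_space_def by (rule compact_space_subtopology)
qed

lemma Hausdorff_keisler_space: "Hausdorff_space (keisler_space L C A)"
  unfolding keisler_space_def
  by (intro Hausdorff_space_subtopology) (simp add: Hausdorff_space_product_topology)

lemma continuous_map_keisler_eval: "\<theta> \<in> Fm L A \<Longrightarrow> continuous_map (keisler_space L C A) euclideanreal (\<lambda>\<mu>. \<mu> \<theta>)"
  unfolding keisler_space_def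
  by (intro continuous_map_from_subtopology continuous_map_product_projection)

section \<open>The correspondence\<close>

locale pi_setup =
  fixes L :: "('f, 'r) lang" and C :: "('f, 'r, 'c) struct" and \<kappa> :: "'k rel" and M :: "'c set"
    and m :: "'i \<Rightarrow> 'c" and \<pi> :: "('f, 'r, 'i + 'i, 'c) pfm set"
  assumes mon: "monster L C \<kappa>" and nip: "NIP L C" and el: "elementary_substructure L C M"
    and rm: "range m = M" and small: "|UNIV :: 'i set| <o \<kappa>" and pi: "\<pi> \<subseteq> Fm L {}"
    and gl: "group_like L C M m \<pi>"
begin

definition G :: "('c \<Rightarrow> 'c) set" where "G = G_pi L C M m \<pi>"

definition act :: "('c \<Rightarrow> 'c) \<Rightarrow> 'i \<Rightarrow> 'c" where "act \<sigma> = inv_into M \<sigma> \<circ> m"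

lemma closed: "fun_closed L C M"
  using el by (auto simp: elementary_substructure_def fun_closed_def)

lemma small_M: "|M| <o \<kappa>"
  using card_of_image[of m UNIV] small rm ordLeq_ordLess_trans by metis

lemma G_Aut: "\<sigma> \<in> G \<Longrightarrow> \<sigma> \<in> Aut L C M"
  by (simp add: G_def G_pi_def)

lemma inv_in: "\<sigma> \<in> G \<Longrightarrow> c \<in> M \<Longrightarrow> inv_into M \<sigma> c \<in> M"
  using AutD(1)[OF G_Aut, of \<sigma>] by (auto simp: bij_betw_def inv_into_into)


lemma m_in: "m i \<in> M"
  using rm by auto

lemma act_in: "\<sigma> \<in> G \<Longrightarrow> act \<sigma> i \<in> M"
  by (simp add: act_def inv_in m_in)

lemma act_range: "\<sigma> \<in> G \<Longrightarrow> range (act \<sigma>) \<subseteq> M"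
  using act_in by auto

text \<open>Membership in \<open>G\<close> gives \<pi> at the pair of
  \<open>\<sigma> \<circ> m\<close> and \<open>m\<close>; the inverse automorphism moves this to
  \<open>m\<close> and \<open>act \<sigma>\<close>, and elementarity lifts it to the
  monster.\<close>

lemma act_realizes:
  assumes \<sigma>: "\<sigma> \<in> G" shows "realizes C UNIV \<pi> m (act \<sigma>)"
  unfolding realizes_def
proof
  fix \<phi> assume \<phi>: "\<phi> \<in> \<pi>"
  have \<phi>F: "\<phi> \<in> Fm L {}" using \<phi> pi by auto
  have M: "range (case_sum m (act \<sigma>)) \<subseteq> M"
    using m_in act_in[OF \<sigma>] by (auto split: sum.split)
  have "\<sigma> (act \<sigma> i) = m i" for i
    using AutD(1)[OF G_Aut[OF \<sigma>]] m_in by (simp add: act_def bij_betw_def f_inv_into_f)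
  then have "\<sigma> \<circ> case_sum m (act \<sigma>) = case_sum (\<sigma> \<circ> m) m"
    by (auto simp: fun_eq_iff split: sum.split)
  moreover have "sat C M (case_sum (\<sigma> \<circ> m) m) \<phi>"
    using \<sigma> \<phi> by (auto simp: G_def G_pi_def realizes_def)
  ultimately have "sat C M (case_sum m (act \<sigma>)) \<phi>"
    using sat_Aut[OF G_Aut[OF \<sigma>] closed \<phi>F M] by simp
  then show "sat C UNIV (case_sum m (act \<sigma>)) \<phi>"
    using elementary_substructure_sat[OF el \<phi>F M] by simp
qed

text \<open>Group-likeness approximates \<open>a\<close> by \<open>\<sigma> \<circ> m\<close>,
  whereas \<open>act\<close> involves the inverse; closure of \<open>G\<close> under inverses
  reconciles the two.\<close>

lemma act_approximates:
  assumes a: "range a \<subseteq> M" "realizes C UNIV \<pi> m a" and F: "finite F"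
  obtains \<tau> where "\<tau> \<in> G" "\<And>i. i \<in> F \<Longrightarrow> act \<tau> i = a i"
proof -
  have sub: "subgroup G (Aut_group L C M)" using gl by (simp add: group_like_def G_def)
  obtain \<sigma> where \<sigma>: "\<sigma> \<in> G" "\<forall>i\<in>F. \<sigma> (m i) = a i"
    using gl a F unfolding group_like_def G_def by blast
  define \<tau> where "\<tau> = restrict (inv_into M \<sigma>) M"
  have \<tau>: "\<tau> \<in> G"
    using subgroup.m_inv_closed[OF sub \<sigma>(1)] Aut_group_inv[OF G_Aut[OF \<sigma>(1)] closed] by (simp add: \<tau>_def)
  have bij: "bij_betw \<sigma> M M" "bij_betw \<tau> M M" using AutD(1) G_Aut \<sigma>(1) \<tau> by blast+
  have "act \<tau> i = a i" if "i \<in> F" for i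
  proof -
    have mi: "m i \<in> M" using rm by auto
    then have "\<sigma> (m i) \<in> M" using bij by (auto simp: bij_betw_def)
    moreover have "\<tau> (\<sigma> (m i)) = m i"
      using bij(1) mi calculation by (auto simp: \<tau>_def bij_betw_def)
    ultimately have "inv_into M \<tau> (m i) = \<sigma> (m i)"
      using bij(2) by (intro inv_into_f_eq) (auto simp: bij_betw_def)
    then show ?thesis using \<sigma>(2) that by (simp add: act_def)
  qed
  then show ?thesis using that \<tau> by blast
qed

section \<open>Convex combinations of group elements acting on measures\<close>

lemma convD:
  assumes "r \<in> conv G"
  shows "finite {\<sigma>. r \<sigma> \<noteq> 0}" "\<And>\<sigma>. r \<sigma> \<noteq> 0 \<Longrightarrow> \<sigma> \<in> G" "\<And>\<sigma>. 0 \<le> r \<sigma>" "(\<Sum>\<sigma> | r \<sigma> \<noteq> 0. r \<sigma>) = 1"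
  using assms by (auto simp: conv_def)

text \<open>The push-forward of a measure by \<open>\<sigma>\<close> is evaluated at \<open>\<sigma>\<^sup>-\<^sup>1(m)\<close>; hence the inverse in \<open>act\<close>.\<close>

definition conv_mu :: "(('c \<Rightarrow> 'c) \<Rightarrow> real) \<Rightarrow> ('f, 'r, 'i, 'c) pfm \<Rightarrow> real" where
  "conv_mu r \<theta> = (\<Sum>\<sigma> | r \<sigma> \<noteq> 0. r \<sigma> * of_bool (sat C UNIV (act \<sigma>) \<theta>))"

lemma conv_mu_keisler:
  assumes "r \<in> conv G" shows "restrict (conv_mu r) (Fm L UNIV) \<in> keisler L C UNIV"
proof -
  have "(\<lambda>\<theta>\<in>Fm L UNIV. \<Sum>\<sigma> | r \<sigma> \<noteq> 0. r \<sigma> * (\<lambda>\<theta>\<in>Fm L UNIV. of_bool (sat C UNIV (act \<sigma>) \<theta>)) \<theta>)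
      \<in> keisler L C UNIV"
    by (intro keisler_convex sat_keisler convD assms)
  moreover have "(\<lambda>\<theta>\<in>Fm L UNIV. \<Sum>\<sigma> | r \<sigma> \<noteq> 0. r \<sigma> * (\<lambda>\<theta>\<in>Fm L UNIV. of_bool (sat C UNIV (act \<sigma>) \<theta>)) \<theta>)
      = restrict (conv_mu r) (Fm L UNIV)" by (auto simp: conv_mu_def fun_eq_iff)
  ultimately show ?thesis by simp
qed

lemma map_inst_y:
  assumes "\<phi> \<in> Fm L {}"
  shows "map_fm (map_sum id (inv_into M \<sigma>)) (inst_y m \<phi>) = inst_y (act \<sigma>) \<phi>"
  unfolding inst_y_def fm.map_comp
proof (rule fm.map_cong[OF refl])
  fix v assume "v \<in> vars_fm \<phi>"
  then have "v \<noteq> Inr c" for c using Fm_empty_Inr[OF assms] by auto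
  then show "(map_sum id (inv_into M \<sigma>) \<circ> case_sum (case_sum Inl (Inr \<circ> m)) Inr) v
      = case_sum (case_sum Inl (Inr \<circ> act \<sigma>)) Inr v"
    by (cases v rule: sum.exhaust) (auto simp: act_def split: sum.split)
qed

lemma conv_act_inst_y:
  assumes "\<phi> \<in> Fm L {}"
  shows "conv_act L M r \<nu> (inst_y m \<phi>) = (\<Sum>\<sigma> | r \<sigma> \<noteq> 0. r \<sigma> * \<nu> (inst_y (act \<sigma>) \<phi>))"
proof -
  have "inst_y m \<phi> \<in> Fm L M"
    using assms Fm_mono[of "{}" M] rm by (intro inst_y_Fm) auto
  then show ?thesis by (simp add: conv_act_def pushforward_def map_inst_y[OF assms])
qed

text \<open>An automorphism of \<open>M\<close> is elementary in the monster, so it extends to an automorphism of it.\<close>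

lemma extend_automorphism:
  assumes \<sigma>: "\<sigma> \<in> Aut L C M"
  obtains \<tau> where "\<tau> \<in> Aut L C UNIV" "\<And>c. c \<in> M \<Longrightarrow> \<tau> c = \<sigma> c"
proof -
  have "partial_elementary L C M \<sigma>"
    unfolding partial_elementary_def
  proof (intro ballI allI impI)
    fix \<phi> :: "('f, 'r, nat, 'c) pfm" and s :: "nat \<Rightarrow> 'c" assume \<phi>: "\<phi> \<in> Fm L {}" and s: "range s \<subseteq> M"
    have \<sigma>s: "range (\<sigma> \<circ> s) \<subseteq> M" using s AutD(1)[OF \<sigma>] by (auto simp: bij_betw_def)
    have "sat C UNIV s \<phi> = sat C M s \<phi>" using elementary_substructure_sat[OF el \<phi> s] by simp
    also have "\<dots> = sat C M (\<sigma> \<circ> s) \<phi>" using sat_Aut[OF \<sigma> closed \<phi> s] by simp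
    also have "\<dots> = sat C UNIV (\<sigma> \<circ> s) \<phi>" using elementary_substructure_sat[OF el \<phi> \<sigma>s] by simp
    finally show "sat C UNIV s \<phi> = sat C UNIV (\<sigma> \<circ> s) \<phi>" .
  qed
  then show ?thesis
    using mon small_M that unfolding monster_def strongly_homogeneous_def by blast
qed

text \<open>Validity and equivalence of formulas refer to the monster, so the inverse of \<sigma> is
  first extended to it. Renaming parameters along an automorphism then amounts to a change of
  assignment.\<close>

lemma pushforward_keisler:
  fixes \<nu> :: "('f, 'r, 'v, 'c) pfm \<Rightarrow> real"
  assumes \<sigma>: "\<sigma> \<in> G" and \<nu>: "\<nu> \<in> keisler L C M"
  shows "pushforward L M \<sigma> \<nu> \<in> keisler L C M"
proof -
  let ?h = "map_fm (map_sum id (inv_into M \<sigma>)) :: ('f, 'r, 'v, 'c) pfm \<Rightarrow> _"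
  obtain \<tau> where \<tau>: "\<tau> \<in> Aut L C UNIV" "\<And>c. c \<in> M \<Longrightarrow> \<tau> c = restrict (inv_into M \<sigma>) M c"
    using extend_automorphism[OF Aut_inverse[OF G_Aut[OF \<sigma>] closed]] by blast
  have h: "?h \<phi> = map_fm (map_sum id \<tau>) \<phi>" if \<phi>: "\<phi> \<in> Fm L M" for \<phi>
  proof (rule fm.map_cong[OF refl])
    fix v assume "v \<in> vars_fm \<phi>"
    then show "map_sum id (inv_into M \<sigma>) v = map_sum id \<tau> v"
      using Fm_Inr[OF \<phi>] \<tau>(2) by (cases v rule: sum.exhaust) auto
  qed
  have hF: "?h \<phi> \<in> Fm L M" if \<phi>: "\<phi> \<in> Fm L M" for \<phi>
  proof -
    have "map_sum id (inv_into M \<sigma>) v \<in> range Inl \<union> Inr ` M" if "v \<in> vars_fm \<phi>" for v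
      using that Fm_Inr[OF \<phi>] inv_in[OF \<sigma>] by (cases v rule: sum.exhaust) auto
    then show ?thesis using \<phi> by (auto simp: Fm_def fm.set_map)
  qed
  have bij: "bij \<tau>" using AutD(1)[OF \<tau>(1)] .
  have sh: "sat C UNIV s (?h \<phi>) = sat C UNIV (inv_into UNIV \<tau> \<circ> s) \<phi>" if \<phi>: "\<phi> \<in> Fm L M" for s \<phi>
  proof -
    have wf: "wf_fm L 0 \<phi>" using \<phi> by (simp add: Fm_def)
    have "\<tau> \<circ> (inv_into UNIV \<tau> \<circ> s) = s" using bij by (auto simp: fun_eq_iff bij_def surj_f_inv_f)
    then show ?thesis using sat_map_Aut_UNIV[OF \<tau>(1) wf, of "inv_into UNIV \<tau> \<circ> s"] h[OF \<phi>] by simp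
  qed
  show ?thesis
  proof (rule keislerI)
    show "pushforward L M \<sigma> \<nu> \<in> extensional (Fm L M)" by (simp add: pushforward_def)
    fix \<phi> :: "('f, 'r, 'v, 'c) pfm" assume \<phi>: "\<phi> \<in> Fm L M"
    show "0 \<le> pushforward L M \<sigma> \<nu> \<phi>" using keislerD(2)[OF \<nu> hF[OF \<phi>]] \<phi> by (simp add: pushforward_def)
    show "pushforward L M \<sigma> \<nu> \<phi> = 1" if "\<forall>s. sat C UNIV s \<phi>"
      using keislerD(3)[OF \<nu> hF[OF \<phi>]] that \<phi> by (simp add: pushforward_def sh)
    fix \<psi> :: "('f, 'r, 'v, 'c) pfm" assume \<psi>: "\<psi> \<in> Fm L M"
    show "pushforward L M \<sigma> \<nu> \<phi> = pushforward L M \<sigma> \<nu> \<psi>" if "\<forall>s. sat C UNIV s \<phi> = sat C UNIV s \<psi>"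
      using keislerD(4)[OF \<nu> hF[OF \<phi>] hF[OF \<psi>]] that \<phi> \<psi> by (simp add: pushforward_def sh)
    show "pushforward L M \<sigma> \<nu> (Or \<phi> \<psi>) = pushforward L M \<sigma> \<nu> \<phi> + pushforward L M \<sigma> \<nu> \<psi>"
      if "\<forall>s. \<not> (sat C UNIV s \<phi> \<and> sat C UNIV s \<psi>)"
      using keislerD(5)[OF \<nu> hF[OF \<phi>] hF[OF \<psi>]] that \<phi> \<psi> by (simp add: pushforward_def sh)
  qed
qed

lemma conv_act_keisler:
  assumes "r \<in> conv G" "\<nu> \<in> keisler L C M" shows "conv_act L M r \<nu> \<in> keisler L C M"
  unfolding conv_act_def
  using convD[OF assms(1)] by (intro keisler_convex pushforward_keisler assms(2)) auto

lemma conv_act_dirac: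
  assumes r: "r \<in> conv G" and \<phi>: "\<phi> \<in> Fm L {}"
  shows "conv_act L M r (dirac L M (tp L C M n)) (inst_y m \<phi>) = conv_mu r (inst_x n \<phi>)"
  unfolding conv_act_inst_y[OF \<phi>] conv_mu_def
proof (rule sum.cong[OF refl])
  fix \<sigma> assume "\<sigma> \<in> {\<sigma>. r \<sigma> \<noteq> 0}"
  then have "\<sigma> \<in> G" using convD(2)[OF r] by auto
  then have "inst_y (act \<sigma>) \<phi> \<in> Fm L M"
    using \<phi> Fm_mono[of "{}" M] act_range by (intro inst_y_Fm) auto
  then show "r \<sigma> * dirac L M (tp L C M n) (inst_y (act \<sigma>) \<phi>) = r \<sigma> * of_bool (sat C UNIV (act \<sigma>) (inst_x n \<phi>))"
    by (simp add: dirac_def tp_def)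
qed

text \<open>As \<open>m\<close> exhausts \<open>M\<close>, each parameter can be read as a variable
  of \<open>y\<close>.\<close>

lemma inst_y_surj:
  assumes \<theta>: "\<theta> \<in> Fm L M" obtains \<phi> where "\<phi> \<in> Fm L {}" "\<theta> = inst_y m \<phi>"
proof
  let ?h = "case_sum (Inl \<circ> Inl) (\<lambda>c. Inl (Inr (inv_into UNIV m c))) :: 'i + 'c \<Rightarrow> ('i + 'i) + 'c"
  have "?h v \<in> range Inl" for v by (cases v) auto
  then show "map_fm ?h \<theta> \<in> Fm L {}" using \<theta> by (auto simp: Fm_def fm.set_map)
  have "inst_y m (map_fm ?h \<theta>) = map_fm id \<theta>"
    unfolding inst_y_def fm.map_comp
  proof (rule fm.map_cong[OF refl])
    fix v assume "v \<in> vars_fm \<theta>"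
    then show "(case_sum (case_sum Inl (Inr \<circ> m)) Inr \<circ> ?h) v = id v"
      using Fm_Inr[OF \<theta>] rm by (cases v rule: sum.exhaust) (auto simp: f_inv_into_f)
  qed
  then show "\<theta> = inst_y m (map_fm ?h \<theta>)" by (simp add: fm.map_id)
qed

text \<open>
  If the tuple is finite, it can only carry boundedly many parameters; but then \<open>M\<close> is finite, hence
  all of the monster.
\<close>

lemma inst_x_surj:
  fixes \<theta> :: "('f, 'r, 'i, 'c) pfm"
  assumes \<theta>: "\<theta> \<in> Fm L UNIV" obtains n :: "'i \<Rightarrow> 'c" and \<phi> where "\<phi> \<in> Fm L {}" "\<theta> = inst_x n \<phi>"
proof -
  let ?P = "{c. Inr c \<in> vars_fm \<theta>}"
  have fin: "finite ?P" using finite_vimageI[OF finite_vars_fm inj_Inr] by (simp add: vimage_def)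
  have "\<exists>(g :: 'c \<Rightarrow> 'i) n. \<forall>c\<in>?P. n (g c) = c"
  proof (cases "finite (UNIV :: 'i set)")
    case True
    then have "finite M" using rm by (metis finite_imageI)
    then have "M = UNIV" by (rule finite_elementary_substructure[OF el])
    then show ?thesis using rm by (intro exI[of _ "inv_into UNIV m"] exI[of _ m]) (auto simp: f_inv_into_f)
  next
    case False
    then obtain S :: "'i set" where S: "finite S" "card S = card ?P"
      using infinite_arbitrarily_large by blast
    then obtain g where "bij_betw g ?P S" using finite_same_card_bij[OF fin S(1)] by metis
    then show ?thesis by (intro exI[of _ g] exI[of _ "inv_into ?P g"]) (simp add: bij_betw_def)
  qed
  then obtain g :: "'c \<Rightarrow> 'i" and n where gn: "\<And>c. c \<in> ?P \<Longrightarrow> n (g c) = c" by blast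
  let ?h = "case_sum (Inl \<circ> Inr) (\<lambda>c. Inl (Inl (g c))) :: 'i + 'c \<Rightarrow> ('i + 'i) + 'c"
  have "?h v \<in> range Inl" for v by (cases v) auto
  then have 1: "map_fm ?h \<theta> \<in> Fm L {}" using \<theta> by (auto simp: Fm_def fm.set_map)
  have "inst_x n (map_fm ?h \<theta>) = map_fm id \<theta>"
    unfolding inst_x_def fm.map_comp
  proof (rule fm.map_cong[OF refl])
    fix v assume "v \<in> vars_fm \<theta>"
    then show "(case_sum (case_sum (Inr \<circ> n) Inl) Inr \<circ> ?h) v = id v"
      using gn by (cases v rule: sum.exhaust) auto
  qed
  then have "\<theta> = inst_x n (map_fm ?h \<theta>)" by (simp add: fm.map_id)
  then show ?thesis using that 1 by blast
qed

definition conv_fun :: "(('c \<Rightarrow> 'c) \<Rightarrow> real) \<Rightarrow> ('f, 'r, 'i + 'i, 'c) pfm \<Rightarrow> ('f, 'r, 'i, 'c) pfm set \<Rightarrow> real" where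
  "conv_fun r \<phi> q = (\<Sum>\<sigma> | r \<sigma> \<noteq> 0. r \<sigma> * of_bool (inst_y (act \<sigma>) \<phi> \<in> q))"

text \<open>The same choice as in \<open>F_fun\<close>, so that both evaluate at the same
  tuple.\<close>

definition realization :: "('f, 'r, 'i, 'c) pfm set \<Rightarrow> 'i \<Rightarrow> 'c" where "realization q = (SOME b. tp L C M b = q)"

lemma tp_realization_of: "q \<in> complete_types L C M \<Longrightarrow> tp L C M (realization q) = q"
  unfolding realization_def
  using realize_complete_type[OF mon small_M small] tp_realization by (metis (mono_tags, lifting) someI_ex)

lemma inst_y_act_Fm: "\<sigma> \<in> G \<Longrightarrow> \<phi> \<in> Fm L M \<Longrightarrow> inst_y (act \<sigma>) \<phi> \<in> Fm L M"
  by (intro inst_y_Fm act_range)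

lemma mem_type_iff:
  assumes "\<sigma> \<in> G" "\<phi> \<in> Fm L M" "q \<in> complete_types L C M"
  shows "inst_y (act \<sigma>) \<phi> \<in> q \<longleftrightarrow> sat C UNIV (case_sum (realization q) (act \<sigma>)) \<phi>"
proof -
  have "inst_y (act \<sigma>) \<phi> \<in> q \<longleftrightarrow> inst_y (act \<sigma>) \<phi> \<in> tp L C M (realization q)" using tp_realization_of[OF assms(3)] by simp
  then show ?thesis using inst_y_act_Fm[OF assms(1,2)] by (simp add: tp_def)
qed

lemma conv_fun_eq:
  assumes r: "r \<in> conv G" and \<phi>: "\<phi> \<in> Fm L M" and q: "q \<in> complete_types L C M"
  shows "conv_fun r \<phi> q = (\<Sum>\<sigma> | r \<sigma> \<noteq> 0. r \<sigma> * of_bool (sat C UNIV (case_sum (realization q) (act \<sigma>)) \<phi>))"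
  unfolding conv_fun_def using convD(2)[OF r] mem_type_iff[OF _ \<phi> q] by (intro sum.cong) auto

lemma conv_act_integral:
  assumes r: "r \<in> conv G" and \<nu>: "\<nu> \<in> keisler L C M" and \<phi>: "\<phi> \<in> Fm L {}"
  shows "conv_act L M r \<nu> (inst_y m \<phi>) = (\<integral>q. conv_fun r \<phi> q \<partial>borel_ext L C M \<nu>)"
proof -
  let ?b = "basic_types L C M :: ('f, 'r, 'i, 'c) pfm \<Rightarrow> _" and ?N = "borel_ext L C M \<nu>"
  interpret S: stone_space "complete_types L C M" "?b ` Fm L M" by (rule stone_space_types)
  have reg: "regular_borel_prob S.X ?N" using borel_ext(1)[OF \<nu>] by (simp add: type_space_X)
  interpret N: prob_space ?N using reg by (simp add: regular_borel_prob_def)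
  have setsN: "sets ?N = sets (borel_of_top S.X)" using reg by (simp add: regular_borel_prob_def)
  have spaceN: "space ?N = complete_types L C M" using sets_eq_imp_space_eq[OF setsN] by simp
  have \<phi>M: "\<phi> \<in> Fm L M" using \<phi> Fm_mono[of "{}" M] by auto
  let ?\<psi> = "\<lambda>\<sigma>. inst_y (act \<sigma>) \<phi>"
  have F: "?\<psi> \<sigma> \<in> Fm L M" if "r \<sigma> \<noteq> 0" for \<sigma> using inst_y_act_Fm[OF convD(2)[OF r that] \<phi>M] .
  have BS: "?b (?\<psi> \<sigma>) \<in> sets ?N" if "r \<sigma> \<noteq> 0" for \<sigma>
    using S.open_borel[OF S.openin_basic[of "?b (?\<psi> \<sigma>)"]] F[OF that] setsN by auto
  have "(\<integral>q. conv_fun r \<phi> q \<partial>?N) = (\<integral>q. (\<Sum>\<sigma> | r \<sigma> \<noteq> 0. r \<sigma> * indicator (?b (?\<psi> \<sigma>)) q) \<partial>?N)"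
    by (rule Bochner_Integration.integral_cong[OF refl])
      (auto simp: conv_fun_def spaceN basic_types_def indicator_def intro!: sum.cong)
  also have "\<dots> = (\<Sum>\<sigma> | r \<sigma> \<noteq> 0. \<integral>q. r \<sigma> * indicator (?b (?\<psi> \<sigma>)) q \<partial>?N)"
    using BS by (intro Bochner_Integration.integral_sum) (auto simp: N.emeasure_eq_measure)
  also have "\<dots> = (\<Sum>\<sigma> | r \<sigma> \<noteq> 0. r \<sigma> * \<nu> (?\<psi> \<sigma>))"
    using BS borel_ext(2)[OF \<nu> F] sets.sets_into_space[OF BS]
    by (intro sum.cong refl) (simp add: Int_absorb2)
  finally show ?thesis by (simp add: conv_act_inst_y[OF \<phi>])
qed

text \<open>The bridge to the analysis: \<open>conv_fun r \<phi>\<close> is a convex combination of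
  the relations between \<open>realization q\<close> and \<open>act \<sigma>\<close> given by
  \<phi>, whose VC dimension is finite by \<open>NIP_shatter\<close>.\<close>

lemma stone_limit_F_fun:
  assumes U: "U \<noteq> bot" "eventually (\<lambda>r. r \<in> conv G) U"
    and lim: "\<And>\<theta>. \<theta> \<in> Fm L UNIV \<Longrightarrow> ((\<lambda>r. conv_mu r \<theta>) \<longlongrightarrow> \<mu> \<theta>) U" and \<phi>: "\<phi> \<in> Fm L M"
  shows "stone_limit (complete_types L C M) (basic_types L C M ` Fm L M) (conv G) (\<lambda>r. conv_fun r \<phi>) (F_fun L C M \<mu> \<phi>) U"
proof -
  let ?O = "complete_types L C M :: ('f, 'r, 'i, 'c) pfm set set"
  let ?b = "basic_types L C M :: ('f, 'r, 'i, 'c) pfm \<Rightarrow> _"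
  interpret S: stone_space ?O "?b ` Fm L M" by (rule stone_space_types)
  have wf: "wf_fm L 0 \<phi>" using \<phi> by (simp add: Fm_def)
  \<comment> \<open>The value at \<open>q\<close> depends only on which of finitely many formulas
    lie in \<open>q\<close>.\<close>
  have pat: "{q \<in> ?O. P (conv_fun r \<phi> q)} \<in> ?b ` Fm L M" if r: "r \<in> conv G" for r and P :: "real \<Rightarrow> bool"
  proof -
    let ?S = "{\<sigma>. r \<sigma> \<noteq> 0}" and ?B = "\<lambda>\<sigma>. ?b (inst_y (act \<sigma>) \<phi>)"
    have "conv_fun r \<phi> q = sum r {\<sigma> \<in> ?S. q \<in> ?B \<sigma>}" if "q \<in> ?O" for q
      unfolding conv_fun_def sum.inter_filter[OF convD(1)[OF r]] using that
      by (auto simp: basic_types_def intro!: sum.cong)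
    then have "{q \<in> ?O. P (conv_fun r \<phi> q)} = {q \<in> ?O. P (sum r {\<sigma> \<in> ?S. q \<in> ?B \<sigma>})}" by auto
    also have "\<dots> \<in> ?b ` Fm L M"
      using inst_y_act_Fm[OF convD(2)[OF r] \<phi>] convD(1)[OF r]
      by (intro S.trace_pattern_in_algebra) auto
    finally show ?thesis .
  qed
  show ?thesis
  proof
    show "U \<noteq> bot" "eventually (\<lambda>r. r \<in> conv G) U" by fact+
    show "{q \<in> ?O. conv_fun r \<phi> q < c} \<in> ?b ` Fm L M" if "r \<in> conv G" for r c by (rule pat[OF that])
    show "{q \<in> ?O. c < conv_fun r \<phi> q} \<in> ?b ` Fm L M" if "r \<in> conv G" for r c by (rule pat[OF that])
    show "((\<lambda>r. conv_fun r \<phi> q) \<longlongrightarrow> F_fun L C M \<mu> \<phi> q) U" if q: "q \<in> ?O" for q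
    proof -
      have "eventually (\<lambda>r. conv_mu r (inst_x (realization q) \<phi>) = conv_fun r \<phi> q) U"
        using U(2) by (rule eventually_mono) (simp add: conv_fun_eq[OF _ \<phi> q] conv_mu_def)
      moreover have "((\<lambda>r. conv_mu r (inst_x (realization q) \<phi>)) \<longlongrightarrow> \<mu> (inst_x (realization q) \<phi>)) U"
        by (intro lim inst_x_Fm wf)
      ultimately show ?thesis unfolding F_fun_def realization_def[symmetric] by (rule Lim_transform_eventually[rotated])
    qed
    show "\<exists>N. \<not> sep_tree (conv G) (\<lambda>r. conv_fun r \<phi>) ?O s t N" if "s < t" for s t
    proof -
      obtain d :: nat where d: "\<nexists>a b. \<forall>I\<subseteq>{..<d}. \<forall>i<d.
          sat C UNIV (case_sum (b I :: 'i \<Rightarrow> 'c) (a i :: 'i \<Rightarrow> 'c)) \<phi> \<longleftrightarrow> i \<in> I"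
        using NIP_shatter[OF mon nip wf] by (rule exE)
      show ?thesis
      proof (rule no_sep_tree_convex_hull[where Q = "\<lambda>q \<sigma>. sat C UNIV (case_sum (realization q) (act \<sigma>)) \<phi>"
            and w = "\<lambda>r. r" and P = "\<lambda>r. {\<sigma>. r \<sigma> \<noteq> 0}" and d = d])
        show "\<nexists>a (b :: nat set \<Rightarrow> ('f, 'r, 'i, 'c) pfm set). \<forall>I\<subseteq>{..<d}. \<forall>i<d.
            sat C UNIV (case_sum (realization (b I)) (act (a i))) \<phi> \<longleftrightarrow> i \<in> I"
        proof (intro notI, elim exE)
          fix a b assume "\<forall>I\<subseteq>{..<d}. \<forall>i<d. sat C UNIV (case_sum (realization (b I)) (act (a i))) \<phi> \<longleftrightarrow> i \<in> I"
          then have "\<exists>a b. \<forall>I\<subseteq>{..<d}. \<forall>i<d. sat C UNIV (case_sum (b I :: 'i \<Rightarrow> 'c) (a i :: 'i \<Rightarrow> 'c)) \<phi> \<longleftrightarrow> i \<in> I"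
            by (intro exI[of _ "\<lambda>i. act (a i)"] exI[of _ "\<lambda>I. realization (b I)"])
          with d show False by contradiction
        qed
      qed (use that convD conv_fun_eq[OF _ \<phi>] in auto)
    qed
    show "0 \<le> conv_fun r \<phi> q \<and> conv_fun r \<phi> q \<le> 1" if r: "r \<in> conv G" for r q
    proof
      show "0 \<le> conv_fun r \<phi> q" unfolding conv_fun_def using convD(3)[OF r] by (intro sum_nonneg) auto
      have "conv_fun r \<phi> q \<le> (\<Sum>\<sigma> | r \<sigma> \<noteq> 0. r \<sigma>)" unfolding conv_fun_def using convD(3)[OF r] by (intro sum_mono) auto
      then show "conv_fun r \<phi> q \<le> 1" using convD(4)[OF r] by simp
    qed
  qed
qed

end

section \<open>Limits of convex combinations and the two maps\<close>

context pi_setup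
begin

lemma sfsD:
  assumes "\<mu> \<in> sfs_measures L C M m \<pi>"
  shows "\<mu> \<in> keisler L C UNIV"
    and "\<theta> \<in> Fm L UNIV \<Longrightarrow> 0 < \<mu> \<theta> \<Longrightarrow> \<exists>a. range a \<subseteq> M \<and> realizes C UNIV \<pi> m a \<and> sat C UNIV a \<theta>"
  using assms by (auto simp: sfs_measures_def)

lemma sfsI:
  assumes \<mu>: "\<mu> \<in> keisler L C UNIV"
    and sfs: "\<And>\<theta>. \<theta> \<in> Fm L UNIV \<Longrightarrow> 0 < \<mu> \<theta> \<Longrightarrow> \<exists>a. range a \<subseteq> M \<and> realizes C UNIV \<pi> m a \<and> sat C UNIV a \<theta>"
  shows "\<mu> \<in> sfs_measures L C M m \<pi>"
proof -
  have sub: "inst_x m ` \<pi> \<subseteq> Fm L UNIV"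
  proof clarify
    fix \<phi> assume "\<phi> \<in> \<pi>"
    then have "wf_fm L 0 \<phi>" using pi by (auto simp: Fm_def)
    then show "inst_x m \<phi> \<in> Fm L UNIV" by (rule inst_x_Fm)
  qed
  have "\<mu> \<theta> = 1" if \<theta>\<pi>: "\<theta> \<in> inst_x m ` \<pi>" for \<theta>
  proof -
    obtain \<phi> where \<phi>: "\<phi> \<in> \<pi>" "\<theta> = inst_x m \<phi>" using \<theta>\<pi> by blast
    have \<theta>: "\<theta> \<in> Fm L UNIV" using \<theta>\<pi> sub by blast
    have "\<mu> (Or \<theta> (Neg \<theta>)) = \<mu> \<theta> + \<mu> (Neg \<theta>)" using \<theta> by (intro keislerD(5)[OF \<mu>]) auto
    moreover have "\<mu> (Or \<theta> (Neg \<theta>)) = 1" using \<theta> by (intro keislerD(3)[OF \<mu>]) auto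
    moreover have "0 \<le> \<mu> (Neg \<theta>)" using \<theta> by (intro keislerD(2)[OF \<mu>]) simp
    moreover have "\<not> 0 < \<mu> (Neg \<theta>)"
    proof
      assume "0 < \<mu> (Neg \<theta>)"
      then obtain a where "realizes C UNIV \<pi> m a" "sat C UNIV a (Neg \<theta>)" using sfs[of "Neg \<theta>"] \<theta> by auto
      then show False using \<phi> by (auto simp: realizes_def)
    qed
    ultimately show ?thesis by linarith
  qed
  then have "measure (borel_ext L C UNIV \<mu>) {p \<in> complete_types L C UNIV. inst_x m ` \<pi> \<subseteq> p} = 1"
    by (rule measure_borel_ext_eq_1[OF \<mu> sub])
  then show ?thesis using \<mu> sfs unfolding sfs_measures_def by blast
qed

text \<open>Every cell of positive measure contains the type of a tuple in \<open>M\<close>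
  realizing \<pi>, and a group element that matches it on the relevant variables receives the weight
  of the cell. The values agree exactly, not just approximately.\<close>

lemma sfs_finite_approximation:
  assumes \<mu>: "\<mu> \<in> sfs_measures L C M m \<pi>" and \<Theta>: "finite \<Theta>" "\<Theta> \<subseteq> Fm L UNIV"
  shows "\<exists>r\<in>conv G. \<forall>\<theta>\<in>\<Theta>. conv_mu r \<theta> = \<mu> \<theta>"
proof -
  let ?O = "complete_types L C UNIV :: ('f, 'r, 'i, 'c) pfm set set"
  let ?b = "basic_types L C UNIV :: ('f, 'r, 'i, 'c) pfm \<Rightarrow> _" and ?N = "borel_ext L C UNIV \<mu>"
  have \<mu>k: "\<mu> \<in> keisler L C UNIV" by (rule sfsD[OF \<mu>])
  interpret S: stone_space ?O "?b ` Fm L UNIV" by (rule stone_space_types)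
  have reg: "regular_borel_prob S.X ?N" using borel_ext(1)[OF \<mu>k] by (simp add: type_space_X)
  interpret N: prob_space ?N using reg by (simp add: regular_borel_prob_def)
  have setsN: "sets ?N = sets (borel_of_top S.X)" using reg by (simp add: regular_borel_prob_def)
  have spaceN: "space ?N = ?O" using sets_eq_imp_space_eq[OF setsN] by simp
  have BS: "?b \<psi> \<in> sets ?N" if "\<psi> \<in> Fm L UNIV" for \<psi>
    using S.open_borel[OF S.openin_basic[of "?b \<psi>"]] that setsN by auto
  \<comment> \<open>The atoms cut out by \<Theta>, indexed by which of its members hold.\<close>
  define cell where "cell S = {p \<in> ?O. p \<inter> \<Theta> = S}" for S
  have atom: "\<exists>\<psi>\<in>Fm L UNIV. ?b \<psi> = cell S \<and> (\<forall>s. sat C UNIV s \<psi> \<longleftrightarrow> (\<forall>\<theta>\<in>\<Theta>. sat C UNIV s \<theta> \<longleftrightarrow> \<theta> \<in> S))"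
    if S: "S \<subseteq> \<Theta>" for S
  proof -
    let ?A = "S \<union> Neg ` (\<Theta> - S)"
    have A: "finite ?A" "?A \<subseteq> Fm L UNIV" using S \<Theta> finite_subset[OF S] by auto
    obtain \<psi> where \<psi>: "\<psi> \<in> Fm L UNIV" "\<And>s. sat C UNIV s \<psi> \<longleftrightarrow> (\<forall>\<phi>\<in>?A. sat C UNIV s \<phi>)"
      using finite_conj[OF A] by metis
    have "\<psi> \<in> p \<longleftrightarrow> p \<inter> \<Theta> = S" if p: "p \<in> ?O" for p
    proof -
      have "\<psi> \<in> p \<longleftrightarrow> ?A \<subseteq> p"
      proof
        assume "\<psi> \<in> p"
        then show "?A \<subseteq> p"
          using complete_type_conseq[OF p, of "{\<psi>}"] A(2) \<psi>(2) by blast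
      next
        assume "?A \<subseteq> p"
        then show "\<psi> \<in> p" using complete_type_conseq[OF p _ A(1) \<psi>(1)] \<psi>(2) by blast
      qed
      also have "\<dots> \<longleftrightarrow> S \<subseteq> p \<and> (\<forall>\<theta>\<in>\<Theta> - S. \<theta> \<notin> p)"
      proof -
        have "Neg \<theta> \<in> p \<longleftrightarrow> \<theta> \<notin> p" if "\<theta> \<in> \<Theta>" for \<theta>
          using complete_type_Neg[OF p] \<Theta>(2) that by blast
        then show ?thesis by blast
      qed
      also have "\<dots> \<longleftrightarrow> p \<inter> \<Theta> = S" using S by auto
      finally show ?thesis .
    qed
    then have "?b \<psi> = cell S" by (auto simp: basic_types_def cell_def)
    moreover have "sat C UNIV s \<psi> \<longleftrightarrow> (\<forall>\<theta>\<in>\<Theta>. sat C UNIV s \<theta> \<longleftrightarrow> \<theta> \<in> S)" for s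
    proof -
      have "sat C UNIV s \<psi> \<longleftrightarrow> (\<forall>\<theta>\<in>S. sat C UNIV s \<theta>) \<and> (\<forall>\<theta>\<in>\<Theta> - S. \<not> sat C UNIV s \<theta>)"
        by (simp add: \<psi>(2) ball_Un)
      then show ?thesis using S by blast
    qed
    ultimately show ?thesis using \<psi>(1) by blast
  qed
  define w where "w S = measure ?N (cell S)" for S
  have cells: "(\<Sum>S\<in>D. w S) = measure ?N {p \<in> ?O. p \<inter> \<Theta> \<in> D}" if D: "D \<subseteq> Pow \<Theta>" for D
  proof -
    have finD: "finite D" using D \<Theta>(1) by (meson finite_Pow_iff finite_subset)
    have "cell S \<in> sets ?N" if "S \<in> D" for S
      using atom[of S] D that BS by (metis PowD subsetD)
    then have "measure ?N (\<Union>S\<in>D. cell S) = (\<Sum>S\<in>D. measure ?N (cell S))"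
      by (intro N.finite_measure_finite_Union finD) (auto simp: disjoint_family_on_def cell_def)
    moreover have "(\<Union>S\<in>D. cell S) = {p \<in> ?O. p \<inter> \<Theta> \<in> D}" by (auto simp: cell_def)
    ultimately show ?thesis by (simp add: w_def)
  qed
  define Pos where "Pos = {S \<in> Pow \<Theta>. 0 < w S}"
  have finPos: "finite Pos" using \<Theta>(1) by (simp add: Pos_def)
  have "\<exists>\<tau>\<in>G. \<forall>\<theta>\<in>\<Theta>. sat C UNIV (act \<tau>) \<theta> \<longleftrightarrow> \<theta> \<in> S" if S: "S \<in> Pos" for S
  proof -
    obtain \<psi> where \<psi>: "\<psi> \<in> Fm L UNIV" "?b \<psi> = cell S"
      "\<And>s. sat C UNIV s \<psi> \<longleftrightarrow> (\<forall>\<theta>\<in>\<Theta>. sat C UNIV s \<theta> \<longleftrightarrow> \<theta> \<in> S)"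
      using atom[of S] S unfolding Pos_def by blast
    have "\<mu> \<psi> > 0" using S borel_ext(2)[OF \<mu>k \<psi>(1)] by (simp add: \<psi>(2) Pos_def w_def)
    then obtain a where a: "range a \<subseteq> M" "realizes C UNIV \<pi> m a" "sat C UNIV a \<psi>"
      using sfsD(2)[OF \<mu> \<psi>(1)] by blast
    \<comment> \<open>Group-likeness controls finitely many coordinates, and \<Theta> mentions only
      these.\<close>
    let ?F = "\<Union>\<theta>\<in>\<Theta>. {i. Inl i \<in> vars_fm \<theta>}"
    have "finite {i. Inl i \<in> vars_fm \<theta>}" for \<theta> :: "('f, 'r, 'i, 'c) pfm"
      using finite_vimageI[OF finite_vars_fm inj_Inl] by (simp add: vimage_def)
    then have "finite ?F" using \<Theta>(1) by blast
    then obtain \<tau> where \<tau>: "\<tau> \<in> G" "\<And>i. i \<in> ?F \<Longrightarrow> act \<tau> i = a i"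
      by (rule act_approximates[OF a(1,2)]) blast
    have "sat C UNIV (act \<tau>) \<theta> \<longleftrightarrow> \<theta> \<in> S" if "\<theta> \<in> \<Theta>" for \<theta>
    proof -
      have "sat C UNIV (act \<tau>) \<theta> = sat C UNIV a \<theta>"
        using \<Theta>(2) that \<tau>(2) by (intro sat_cong[of L]) (auto simp: Fm_def)
      then show ?thesis using a(3) \<psi>(3) that by blast
    qed
    then show ?thesis using \<tau>(1) by blast
  qed
  then obtain \<tau> where \<tau>: "\<And>S. S \<in> Pos \<Longrightarrow> \<tau> S \<in> G"
    "\<And>S \<theta>. S \<in> Pos \<Longrightarrow> \<theta> \<in> \<Theta> \<Longrightarrow> sat C UNIV (act (\<tau> S)) \<theta> \<longleftrightarrow> \<theta> \<in> S" by metis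
  \<comment> \<open>Weights are indexed by group elements, so distinct cells need distinct ones to
    keep their weights apart.\<close>
  have inj: "inj_on \<tau> Pos"
  proof (rule inj_onI)
    fix S S' assume SS: "S \<in> Pos" "S' \<in> Pos" "\<tau> S = \<tau> S'"
    then have "S \<subseteq> \<Theta>" "S' \<subseteq> \<Theta>" by (auto simp: Pos_def)
    moreover have "\<theta> \<in> S \<longleftrightarrow> \<theta> \<in> S'" if "\<theta> \<in> \<Theta>" for \<theta> using \<tau>(2)[OF SS(1) that] \<tau>(2)[OF SS(2) that] SS(3) by simp
    ultimately show "S = S'" by blast
  qed
  define r where "r \<sigma> = (if \<sigma> \<in> \<tau> ` Pos then w (inv_into Pos \<tau> \<sigma>) else 0)" for \<sigma>
  have r\<tau>: "r (\<tau> S) = w S" if "S \<in> Pos" for S using that inj by (simp add: r_def)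
  have supp: "{\<sigma>. r \<sigma> \<noteq> 0} = \<tau> ` Pos"
  proof
    show "{\<sigma>. r \<sigma> \<noteq> 0} \<subseteq> \<tau> ` Pos" by (auto simp: r_def split: if_splits)
    show "\<tau> ` Pos \<subseteq> {\<sigma>. r \<sigma> \<noteq> 0}" using r\<tau> by (auto simp: Pos_def)
  qed
  have rsum: "(\<Sum>\<sigma> | r \<sigma> \<noteq> 0. r \<sigma> * h \<sigma>) = (\<Sum>S\<in>Pos. w S * h (\<tau> S))" for h
    unfolding supp by (subst sum.reindex[OF inj]) (simp add: r\<tau> cong: sum.cong)
  have Pow: "(\<Sum>S\<in>Pos. w S * of_bool (Q S)) = (\<Sum>S\<in>{S \<in> Pow \<Theta>. Q S}. w S)" for Q
  proof -
    have z: "w S = 0" if "S \<in> Pow \<Theta>" "S \<notin> Pos" for S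
    proof -
      have "0 \<le> w S" by (simp add: w_def)
      then show ?thesis using that by (auto simp: Pos_def)
    qed
    have "(\<Sum>S\<in>Pos. w S * of_bool (Q S)) = (\<Sum>S\<in>Pow \<Theta>. w S * of_bool (Q S))"
      by (rule sum.mono_neutral_left) (use \<Theta>(1) z in \<open>auto simp: Pos_def\<close>)
    also have "\<dots> = (\<Sum>S\<in>{S \<in> Pow \<Theta>. Q S}. w S)"
      unfolding sum.inter_filter[OF finite_Pow_iff[THEN iffD2, OF \<Theta>(1)]] by (intro sum.cong) auto
    finally show ?thesis .
  qed
  have "r \<in> conv G"
    unfolding conv_def
  proof (intro CollectI conjI allI)
    show "finite {\<sigma>. r \<sigma> \<noteq> 0}" "{\<sigma>. r \<sigma> \<noteq> 0} \<subseteq> G" using finPos \<tau>(1) by (auto simp: supp)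
    show "0 \<le> r \<sigma>" for \<sigma> by (simp add: r_def w_def)
    have "(\<Sum>\<sigma> | r \<sigma> \<noteq> 0. r \<sigma>) = (\<Sum>S\<in>{S \<in> Pow \<Theta>. True}. w S)"
      using rsum[of "\<lambda>_. 1"] Pow[of "\<lambda>_. True"] by simp
    also have "{S \<in> Pow \<Theta>. True} = Pow \<Theta>" by auto
    also have "(\<Sum>S\<in>Pow \<Theta>. w S) = measure ?N {p \<in> ?O. p \<inter> \<Theta> \<in> Pow \<Theta>}" by (rule cells) simp
    also have "{p \<in> ?O. p \<inter> \<Theta> \<in> Pow \<Theta>} = space ?N" by (auto simp: spaceN)
    finally show "(\<Sum>\<sigma> | r \<sigma> \<noteq> 0. r \<sigma>) = 1" using N.prob_space by simp
  qed
  moreover have "conv_mu r \<theta> = \<mu> \<theta>" if \<theta>: "\<theta> \<in> \<Theta>" for \<theta>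
  proof -
    have "conv_mu r \<theta> = (\<Sum>S\<in>Pos. w S * of_bool (\<theta> \<in> S))"
      unfolding conv_mu_def rsum by (rule sum.cong) (simp_all add: \<tau>(2) \<theta>)
    also have "\<dots> = measure ?N {p \<in> ?O. p \<inter> \<Theta> \<in> {S \<in> Pow \<Theta>. \<theta> \<in> S}}"
      unfolding Pow by (rule cells) auto
    also have "{p \<in> ?O. p \<inter> \<Theta> \<in> {S \<in> Pow \<Theta>. \<theta> \<in> S}} = ?b \<theta>" using \<theta> by (auto simp: basic_types_def)
    also have "measure ?N (?b \<theta>) = \<mu> \<theta>" using \<theta> \<Theta>(2) by (intro borel_ext(2)[OF \<mu>k]) auto
    finally show ?thesis .
  qed
  ultimately show ?thesis by blast
qed

text \<open>A basic open set of the product constrains finitely many formulas, so exact agreement on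
  finite sets gives density.\<close>

lemma sfs_filter:
  assumes \<mu>: "\<mu> \<in> sfs_measures L C M m \<pi>"
  obtains U where "U \<noteq> bot" "eventually (\<lambda>r. r \<in> conv G) U"
    "\<And>\<theta>. \<theta> \<in> Fm L UNIV \<Longrightarrow> ((\<lambda>r. conv_mu r \<theta>) \<longlongrightarrow> \<mu> \<theta>) U"
proof -
  let ?P = "product_topology (\<lambda>_. euclideanreal) (Fm L UNIV :: ('f, 'r, 'i, 'c) pfm set)"
  let ?g = "\<lambda>r. restrict (conv_mu r) (Fm L UNIV)"
  have "\<mu> \<in> ?P closure_of (?g ` conv G)"
    unfolding in_closure_of
  proof (intro conjI allI impI)
    show "\<mu> \<in> topspace ?P" using keislerD(1)[OF sfsD(1)[OF \<mu>]] by (simp add: PiE_iff)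
    fix T assume T: "\<mu> \<in> T \<and> openin ?P T"
    then obtain V where V: "finite {\<theta> \<in> Fm L UNIV. V \<theta> \<noteq> (UNIV :: real set)}" "\<mu> \<in> PiE (Fm L UNIV) V" "PiE (Fm L UNIV) V \<subseteq> T"
      unfolding openin_product_topology_alt by force
    obtain r where r: "r \<in> conv G" "\<forall>\<theta>\<in>{\<theta> \<in> Fm L UNIV. V \<theta> \<noteq> UNIV}. conv_mu r \<theta> = \<mu> \<theta>"
      using sfs_finite_approximation[OF \<mu> V(1)] by blast
    have "?g r \<in> PiE (Fm L UNIV) V"
    proof (rule PiE_I)
      fix \<theta> :: "('f, 'r, 'i, 'c) pfm" assume \<theta>: "\<theta> \<in> Fm L UNIV"
      show "?g r \<theta> \<in> V \<theta>"
      proof (cases "V \<theta> = UNIV")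
        case False
        then have "?g r \<theta> = \<mu> \<theta>" using r(2) \<theta> by simp
        then show ?thesis using V(2) \<theta> by (auto simp: PiE_iff)
      qed simp
    qed simp
    then show "\<exists>y. y \<in> ?g ` conv G \<and> y \<in> T" using r(1) V(3) by blast
  qed
  then obtain U where U: "U \<noteq> bot" "eventually (\<lambda>r. r \<in> conv G) U" "limitin ?P ?g \<mu> U"
    by (rule closure_of_filter)
  then show ?thesis by (intro that[of U]) (auto simp: limitin_componentwise)
qed

abbreviation K :: "(('f, 'r, 'i, 'c) pfm \<Rightarrow> real) set" where "K \<equiv> keisler L C M"

abbreviation PT where "PT \<equiv> product_topology (\<lambda>_. keisler_space L C M) K"

abbreviation E where "E \<equiv> E_conv L C M m \<pi>"

lemma topspace_E: "topspace E = PT closure_of ((\<lambda>r. restrict (conv_act L M r) K) ` conv G)"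
proof -
  have "topspace E = topspace PT \<inter> PT closure_of ((\<lambda>r. restrict (conv_act L M r) K) ` conv G)"
    by (simp add: E_conv_def ellis_space_def ellis_def G_def)
  then show ?thesis using closure_of_subset_topspace[of PT] by blast
qed

lemma E_filter:
  assumes \<eta>: "\<eta> \<in> topspace E"
  obtains U where "U \<noteq> bot" "eventually (\<lambda>r. r \<in> conv G) U"
    "\<And>\<nu> \<theta>. \<nu> \<in> K \<Longrightarrow> \<theta> \<in> Fm L M \<Longrightarrow> ((\<lambda>r. conv_act L M r \<nu> \<theta>) \<longlongrightarrow> \<eta> \<nu> \<theta>) U"
proof -
  have "\<eta> \<in> PT closure_of ((\<lambda>r. restrict (conv_act L M r) K) ` conv G)" using \<eta> by (simp add: topspace_E)
  then obtain U where "U \<noteq> bot" "eventually (\<lambda>r. r \<in> conv G) U"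
    "limitin PT (\<lambda>r. restrict (conv_act L M r) K) \<eta> U" by (rule closure_of_filter)
  then show ?thesis by (intro that[of U]) (auto simp: limitin_componentwise limitin_keisler_space)
qed

lemma E_PiE: "\<eta> \<in> topspace E \<Longrightarrow> \<eta> \<in> PiE K (\<lambda>_. K)"
  using closure_of_subset_topspace[of PT] by (auto simp: topspace_E)

lemma E_memI:
  assumes U: "U \<noteq> bot" "eventually (\<lambda>r. r \<in> conv G) U" and \<eta>: "\<eta> \<in> PiE K (\<lambda>_. K)"
    and lim: "\<And>\<nu> \<theta>. \<nu> \<in> K \<Longrightarrow> \<theta> \<in> Fm L M \<Longrightarrow> ((\<lambda>r. conv_act L M r \<nu> \<theta>) \<longlongrightarrow> \<eta> \<nu> \<theta>) U"
  shows "\<eta> \<in> topspace E"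
  unfolding topspace_E
proof (rule limitin_closure_of[OF _ U])
  have "eventually (\<lambda>r. \<forall>\<nu>\<in>K. conv_act L M r \<nu> \<in> K) U"
    using U(2) by (rule eventually_mono) (simp add: conv_act_keisler)
  moreover from this have "eventually (\<lambda>r. conv_act L M r \<nu> \<in> K) U" if "\<nu> \<in> K" for \<nu>
    by (rule eventually_mono) (use that in blast)
  ultimately show "limitin PT (\<lambda>r. restrict (conv_act L M r) K) \<eta> U"
    using \<eta> lim by (auto simp: limitin_componentwise limitin_keisler_space PiE_iff elim: eventually_mono)
qed

text \<open>Positivity at a formula is an open condition, so some \<open>conv_mu r\<close> is
  already positive there, and its support contains the required tuple.\<close>

lemma limit_measure_sfs:
  assumes U: "U \<noteq> bot" "eventually (\<lambda>r. r \<in> conv G) U" and ext: "\<mu> \<in> extensional (Fm L UNIV)"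
    and lim: "\<And>\<theta>. \<theta> \<in> Fm L UNIV \<Longrightarrow> ((\<lambda>r. conv_mu r \<theta>) \<longlongrightarrow> \<mu> \<theta>) U"
  shows "\<mu> \<in> sfs_measures L C M m \<pi>"
proof (rule sfsI)
  show "\<mu> \<in> keisler L C UNIV"
  proof (rule keisler_limit[OF U(1) _ _ ext])
    show "eventually (\<lambda>r. restrict (conv_mu r) (Fm L UNIV) \<in> keisler L C UNIV) U"
      using U(2) by (rule eventually_mono) (rule conv_mu_keisler)
  qed (simp add: lim)
  fix \<theta> :: "('f, 'r, 'i, 'c) pfm" assume \<theta>: "\<theta> \<in> Fm L UNIV" "0 < \<mu> \<theta>"
  have "eventually (\<lambda>r. 0 < conv_mu r \<theta>) U" by (rule order_tendstoD(1)[OF lim[OF \<theta>(1)] \<theta>(2)])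
  then have "eventually (\<lambda>r. r \<in> conv G \<and> 0 < conv_mu r \<theta>) U" using U(2) by (simp add: eventually_conj)
  then obtain r where r: "r \<in> conv G" "0 < conv_mu r \<theta>" using eventually_happens'[OF U(1)] by blast
  have "\<exists>\<sigma>. r \<sigma> \<noteq> 0 \<and> sat C UNIV (act \<sigma>) \<theta>"
  proof (rule ccontr)
    assume "\<not> ?thesis"
    then have "conv_mu r \<theta> = 0" unfolding conv_mu_def by (intro sum.neutral) auto
    then show False using r(2) by simp
  qed
  then obtain \<sigma> where "\<sigma> \<in> G" "sat C UNIV (act \<sigma>) \<theta>" using convD(2)[OF r(1)] by blast
  then show "\<exists>a. range a \<subseteq> M \<and> realizes C UNIV \<pi> m a \<and> sat C UNIV a \<theta>"
    using act_range act_realizes by blast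
qed

text \<open>Each \<open>conv_mu r\<close> is carried by tuples from \<open>M\<close>, which \<sigma>
  fixes; the equality passes to the limit.\<close>

lemma limit_measure_invariant:
  assumes U: "U \<noteq> bot" "eventually (\<lambda>r. r \<in> conv G) U"
    and lim: "\<And>\<theta>. \<theta> \<in> Fm L UNIV \<Longrightarrow> ((\<lambda>r. conv_mu r \<theta>) \<longlongrightarrow> \<mu> \<theta>) U"
  shows "invariant_measure L C M \<mu>"
  unfolding invariant_measure_def
proof (intro ballI impI)
  fix \<sigma> and \<theta> :: "('f, 'r, 'i, 'c) pfm"
  assume \<sigma>: "\<sigma> \<in> Aut L C UNIV" "\<forall>c\<in>M. \<sigma> c = c" and \<theta>: "\<theta> \<in> Fm L UNIV"
  let ?\<theta> = "map_fm (map_sum id \<sigma>) \<theta>"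
  have \<theta>': "?\<theta> \<in> Fm L UNIV" using \<theta> by (simp add: Fm_UNIV)
  have "eventually (\<lambda>r. conv_mu r ?\<theta> = conv_mu r \<theta>) U"
    using U(2)
  proof (rule eventually_mono)
    fix r assume r: "r \<in> conv G"
    have "sat C UNIV (act \<rho>) ?\<theta> = sat C UNIV (act \<rho>) \<theta>" if "r \<rho> \<noteq> 0" for \<rho>
    proof -
      have "\<sigma> \<circ> act \<rho> = act \<rho>" using \<sigma>(2) act_in[OF convD(2)[OF r that]] by auto
      then show ?thesis using sat_map_Aut_UNIV[OF \<sigma>(1), of \<theta> "act \<rho>"] \<theta> by (simp add: Fm_UNIV)
    qed
    then show "conv_mu r ?\<theta> = conv_mu r \<theta>" unfolding conv_mu_def by (intro sum.cong) auto
  qed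
  then have "((\<lambda>r. conv_mu r \<theta>) \<longlongrightarrow> \<mu> ?\<theta>) U"
    using lim[OF \<theta>'] by (rule Lim_transform_eventually[rotated])
  then show "\<mu> ?\<theta> = \<mu> \<theta>" using tendsto_unique[OF U(1) _ lim[OF \<theta>]] by blast
qed

lemma limit_measure_borel_definable:
  assumes U: "U \<noteq> bot" "eventually (\<lambda>r. r \<in> conv G) U"
    and lim: "\<And>\<theta>. \<theta> \<in> Fm L UNIV \<Longrightarrow> ((\<lambda>r. conv_mu r \<theta>) \<longlongrightarrow> \<mu> \<theta>) U"
  shows "borel_definable L C M \<mu>"
  unfolding borel_definable_def type_space_X
  using limit_measure_invariant[OF U lim] stone_limit.limit_borel[OF stone_limit_F_fun[OF U lim]] by blast

lemma morley_limit:
  assumes U: "U \<noteq> bot" "eventually (\<lambda>r. r \<in> conv G) U"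
    and lim: "\<And>\<theta>. \<theta> \<in> Fm L UNIV \<Longrightarrow> ((\<lambda>r. conv_mu r \<theta>) \<longlongrightarrow> \<mu> \<theta>) U"
    and \<nu>: "\<nu> \<in> K" and \<phi>: "\<phi> \<in> Fm L {}"
  shows "((\<lambda>r. conv_act L M r \<nu> (inst_y m \<phi>)) \<longlongrightarrow> morley L C M \<mu> \<nu> \<phi>) U"
proof -
  have \<phi>M: "\<phi> \<in> Fm L M" using \<phi> Fm_mono[of "{}" M] by auto
  have reg: "regular_borel_prob (stone_space.X (basic_types L C M ` Fm L M)) (borel_ext L C M \<nu>)"
    using borel_ext(1)[OF \<nu>] by (simp add: type_space_X)
  have "((\<lambda>r. \<integral>q. conv_fun r \<phi> q \<partial>borel_ext L C M \<nu>) \<longlongrightarrow> morley L C M \<mu> \<nu> \<phi>) U"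
    unfolding morley_def by (rule stone_limit.integral_tendsto[OF stone_limit_F_fun[OF U lim \<phi>M] reg])
  moreover have "eventually (\<lambda>r. (\<integral>q. conv_fun r \<phi> q \<partial>borel_ext L C M \<nu>) = conv_act L M r \<nu> (inst_y m \<phi>)) U"
    using U(2) by (rule eventually_mono) (simp add: conv_act_integral \<nu> \<phi>)
  ultimately show ?thesis by (rule Lim_transform_eventually)
qed

lemma Psi_eqI:
  assumes "\<nu> \<in> K" "\<rho> \<in> extensional (Fm L M)" "\<And>\<phi>. \<phi> \<in> Fm L {} \<Longrightarrow> \<rho> (inst_y m \<phi>) = morley L C M \<mu> \<nu> \<phi>"
  shows "Psi L C M m \<mu> \<nu> = \<rho>"
proof -
  have "(THE \<rho>. \<rho> \<in> extensional (Fm L M) \<and> (\<forall>\<phi>\<in>Fm L {}. \<rho> (inst_y m \<phi>) = morley L C M \<mu> \<nu> \<phi>)) = \<rho>"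
  proof (rule the_equality)
    fix \<rho>' assume \<rho>': "\<rho>' \<in> extensional (Fm L M) \<and> (\<forall>\<phi>\<in>Fm L {}. \<rho>' (inst_y m \<phi>) = morley L C M \<mu> \<nu> \<phi>)"
    show "\<rho>' = \<rho>"
    proof (rule extensionalityI[of _ "Fm L M"])
      fix \<theta> :: "('f, 'r, 'i, 'c) pfm" assume "\<theta> \<in> Fm L M"
      then obtain \<phi> where "\<phi> \<in> Fm L {}" "\<theta> = inst_y m \<phi>" by (rule inst_y_surj)
      then show "\<rho>' \<theta> = \<rho> \<theta>" using \<rho>' assms(3) by simp
    qed (use \<rho>' assms(2) in auto)
  qed (use assms in auto)
  then show ?thesis using assms(1) by (simp add: Psi_def)
qed

lemma Phi_eqI:
  assumes "\<mu> \<in> extensional (Fm L UNIV)"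
    and "\<And>n \<phi>. \<phi> \<in> Fm L {} \<Longrightarrow> \<mu> (inst_x n \<phi>) = \<eta> (dirac L M (tp L C M n)) (inst_y m \<phi>)"
  shows "Phi L C M m \<eta> = \<mu>"
  unfolding Phi_def
proof (rule the_equality)
  fix \<mu>' assume \<mu>': "\<mu>' \<in> extensional (Fm L UNIV) \<and>
    (\<forall>n. \<forall>\<phi>\<in>Fm L {}. \<mu>' (inst_x n \<phi>) = \<eta> (dirac L M (tp L C M n)) (inst_y m \<phi>))"
  show "\<mu>' = \<mu>"
  proof (rule extensionalityI[of _ "Fm L UNIV"])
    fix \<theta> :: "('f, 'r, 'i, 'c) pfm" assume "\<theta> \<in> Fm L UNIV"
    then obtain n \<phi> where "\<phi> \<in> Fm L {}" "\<theta> = inst_x n \<phi>" by (rule inst_x_surj)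
    then show "\<mu>' \<theta> = \<mu> \<theta>" using \<mu>' assms(2) by simp
  qed (use \<mu>' assms(1) in auto)
qed (use assms in auto)

text \<open>The limit \<open>\<rho>\<close> along \<open>U\<close> is a function of the formula in
  \<open>x\<close> alone. Since it equals the Morley value of every \<phi> representing that
  formula, the defining equation of \<open>Psi\<close> is solvable.\<close>

lemma Psi_limit:
  assumes U: "U \<noteq> bot" "eventually (\<lambda>r. r \<in> conv G) U"
    and lim: "\<And>\<theta>. \<theta> \<in> Fm L UNIV \<Longrightarrow> ((\<lambda>r. conv_mu r \<theta>) \<longlongrightarrow> \<mu> \<theta>) U" and \<nu>: "\<nu> \<in> K"
  shows "Psi L C M m \<mu> \<nu> \<in> K"
    and "\<phi> \<in> Fm L {} \<Longrightarrow> Psi L C M m \<mu> \<nu> (inst_y m \<phi>) = morley L C M \<mu> \<nu> \<phi>"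
    and "\<theta> \<in> Fm L M \<Longrightarrow> ((\<lambda>r. conv_act L M r \<nu> \<theta>) \<longlongrightarrow> Psi L C M m \<mu> \<nu> \<theta>) U"
proof -
  define \<rho> where "\<rho> = (\<lambda>\<theta>\<in>Fm L M. Lim U (\<lambda>r. conv_act L M r \<nu> \<theta>))"
  have \<rho>: "((\<lambda>r. conv_act L M r \<nu> (inst_y m \<phi>)) \<longlongrightarrow> \<rho> (inst_y m \<phi>)) U"
    "\<rho> (inst_y m \<phi>) = morley L C M \<mu> \<nu> \<phi>" if \<phi>: "\<phi> \<in> Fm L {}" for \<phi>
  proof -
    have "inst_y m \<phi> \<in> Fm L M" using \<phi> Fm_mono[of "{}" M] rm by (intro inst_y_Fm) auto
    then show "\<rho> (inst_y m \<phi>) = morley L C M \<mu> \<nu> \<phi>"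
      using tendsto_Lim[OF U(1) morley_limit[OF U lim \<nu> \<phi>]] by (simp add: \<rho>_def)
    then show "((\<lambda>r. conv_act L M r \<nu> (inst_y m \<phi>)) \<longlongrightarrow> \<rho> (inst_y m \<phi>)) U"
      using morley_limit[OF U lim \<nu> \<phi>] by simp
  qed
  have ext: "\<rho> \<in> extensional (Fm L M)" by (simp add: \<rho>_def)
  have Psi: "Psi L C M m \<mu> \<nu> = \<rho>" by (rule Psi_eqI[OF \<nu> ext \<rho>(2)])
  have lim\<rho>: "((\<lambda>r. conv_act L M r \<nu> \<theta>) \<longlongrightarrow> \<rho> \<theta>) U" if "\<theta> \<in> Fm L M" for \<theta>
    using inst_y_surj[OF that] \<rho>(1) by metis
  show "Psi L C M m \<mu> \<nu> \<in> K"
    unfolding Psi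
  proof (rule keisler_limit[OF U(1) _ lim\<rho> ext])
    show "eventually (\<lambda>r. conv_act L M r \<nu> \<in> K) U"
      using U(2) by (rule eventually_mono) (simp add: conv_act_keisler \<nu>)
  qed
  show "Psi L C M m \<mu> \<nu> (inst_y m \<phi>) = morley L C M \<mu> \<nu> \<phi>" if "\<phi> \<in> Fm L {}" using \<rho>(2)[OF that] by (simp add: Psi)
  show "((\<lambda>r. conv_act L M r \<nu> \<theta>) \<longlongrightarrow> Psi L C M m \<mu> \<nu> \<theta>) U" if "\<theta> \<in> Fm L M" using lim\<rho>[OF that] by (simp add: Psi)
qed

lemma Psi_E:
  assumes U: "U \<noteq> bot" "eventually (\<lambda>r. r \<in> conv G) U"
    and lim: "\<And>\<theta>. \<theta> \<in> Fm L UNIV \<Longrightarrow> ((\<lambda>r. conv_mu r \<theta>) \<longlongrightarrow> \<mu> \<theta>) U"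
  shows "Psi L C M m \<mu> \<in> topspace E"
proof (rule E_memI[OF U])
  show "Psi L C M m \<mu> \<in> PiE K (\<lambda>_. K)"
    using Psi_limit(1)[OF U lim] by (auto simp: PiE_iff Psi_def)
qed (rule Psi_limit(3)[OF U lim])

text \<open>The same filter converges to \<eta> and to its image under \<open>Phi\<close>; existence
  in the description of \<open>Phi\<close> follows as for \<open>Psi\<close>.\<close>

lemma Phi_limit:
  assumes \<eta>: "\<eta> \<in> topspace E"
  obtains U where "U \<noteq> bot" "eventually (\<lambda>r. r \<in> conv G) U"
    "\<And>\<theta>. \<theta> \<in> Fm L UNIV \<Longrightarrow> ((\<lambda>r. conv_mu r \<theta>) \<longlongrightarrow> Phi L C M m \<eta> \<theta>) U"
    "\<And>\<nu> \<theta>. \<nu> \<in> K \<Longrightarrow> \<theta> \<in> Fm L M \<Longrightarrow> ((\<lambda>r. conv_act L M r \<nu> \<theta>) \<longlongrightarrow> \<eta> \<nu> \<theta>) U"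
    "Phi L C M m \<eta> \<in> extensional (Fm L UNIV)"
    "\<And>n \<phi>. \<phi> \<in> Fm L {} \<Longrightarrow> Phi L C M m \<eta> (inst_x n \<phi>) = \<eta> (dirac L M (tp L C M n)) (inst_y m \<phi>)"
proof -
  obtain U where U: "U \<noteq> bot" "eventually (\<lambda>r. r \<in> conv G) U"
    and limE: "\<And>\<nu> \<theta>. \<nu> \<in> K \<Longrightarrow> \<theta> \<in> Fm L M \<Longrightarrow> ((\<lambda>r. conv_act L M r \<nu> \<theta>) \<longlongrightarrow> \<eta> \<nu> \<theta>) U"
    using E_filter[OF \<eta>] by metis
  define \<mu> where "\<mu> = (\<lambda>\<theta>\<in>Fm L UNIV. Lim U (\<lambda>r. conv_mu r \<theta>))"
  have ext: "\<mu> \<in> extensional (Fm L UNIV)" by (simp add: \<mu>_def)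
  have lim_inst: "((\<lambda>r. conv_mu r (inst_x n \<phi>)) \<longlongrightarrow> \<eta> (dirac L M (tp L C M n)) (inst_y m \<phi>)) U"
    if \<phi>: "\<phi> \<in> Fm L {}" for n \<phi>
  proof -
    have "inst_y m \<phi> \<in> Fm L M" using \<phi> Fm_mono[of "{}" M] rm by (intro inst_y_Fm) auto
    then have "((\<lambda>r. conv_act L M r (dirac L M (tp L C M n)) (inst_y m \<phi>))
        \<longlongrightarrow> \<eta> (dirac L M (tp L C M n)) (inst_y m \<phi>)) U"
      by (intro limE dirac_keisler)
    moreover have "eventually (\<lambda>r. conv_act L M r (dirac L M (tp L C M n)) (inst_y m \<phi>) = conv_mu r (inst_x n \<phi>)) U"
      using U(2) by (rule eventually_mono) (rule conv_act_dirac[OF _ \<phi>])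
    ultimately show ?thesis by (rule Lim_transform_eventually)
  qed
  have eq: "\<mu> (inst_x n \<phi>) = \<eta> (dirac L M (tp L C M n)) (inst_y m \<phi>)" if \<phi>: "\<phi> \<in> Fm L {}" for n \<phi>
  proof -
    have "inst_x n \<phi> \<in> Fm L UNIV" using \<phi> by (intro inst_x_Fm) (simp add: Fm_def)
    then show ?thesis using tendsto_Lim[OF U(1) lim_inst[OF \<phi>]] by (simp add: \<mu>_def)
  qed
  have Phi: "Phi L C M m \<eta> = \<mu>" by (rule Phi_eqI[OF ext eq])
  have lim: "((\<lambda>r. conv_mu r \<theta>) \<longlongrightarrow> \<mu> \<theta>) U" if \<theta>: "\<theta> \<in> Fm L UNIV" for \<theta>
  proof -
    obtain n \<phi> where "\<phi> \<in> Fm L {}" "\<theta> = inst_x n \<phi>" using \<theta> by (rule inst_x_surj)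
    then show ?thesis using lim_inst eq by simp
  qed
  show ?thesis
    by (rule that[OF U]) (simp_all add: Phi lim limE ext eq)
qed

lemma Psi_Phi:
  assumes \<eta>: "\<eta> \<in> topspace E" shows "Psi L C M m (Phi L C M m \<eta>) = \<eta>"
proof -
  obtain U where U: "U \<noteq> bot" "eventually (\<lambda>r. r \<in> conv G) U"
    and lim: "\<And>\<theta>. \<theta> \<in> Fm L UNIV \<Longrightarrow> ((\<lambda>r. conv_mu r \<theta>) \<longlongrightarrow> Phi L C M m \<eta> \<theta>) U"
    and limE: "\<And>\<nu> \<theta>. \<nu> \<in> K \<Longrightarrow> \<theta> \<in> Fm L M \<Longrightarrow> ((\<lambda>r. conv_act L M r \<nu> \<theta>) \<longlongrightarrow> \<eta> \<nu> \<theta>) U"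
    by (rule Phi_limit[OF \<eta>]) blast
  have \<eta>P: "\<eta> \<in> PiE K (\<lambda>_. K)" by (rule E_PiE[OF \<eta>])
  show ?thesis
  proof (rule extensionalityI[of _ K])
    show "Psi L C M m (Phi L C M m \<eta>) \<in> extensional K" by (simp add: Psi_def)
    show "\<eta> \<in> extensional K" using \<eta>P by (simp add: PiE_def)
    fix \<nu> assume \<nu>: "\<nu> \<in> K"
    show "Psi L C M m (Phi L C M m \<eta>) \<nu> = \<eta> \<nu>"
    proof (rule extensionalityI[of _ "Fm L M"])
      show "Psi L C M m (Phi L C M m \<eta>) \<nu> \<in> extensional (Fm L M)"
        by (rule keislerD(1)[OF Psi_limit(1)[OF U lim \<nu>]])
      show "\<eta> \<nu> \<in> extensional (Fm L M)" using \<eta>P \<nu> by (intro keislerD(1)[of _ L C]) auto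
      fix \<theta> :: "('f, 'r, 'i, 'c) pfm" assume \<theta>: "\<theta> \<in> Fm L M"
      show "Psi L C M m (Phi L C M m \<eta>) \<nu> \<theta> = \<eta> \<nu> \<theta>"
        by (rule tendsto_unique[OF U(1) Psi_limit(3)[OF U lim \<nu> \<theta>] limE[OF \<nu> \<theta>]])
    qed
  qed
qed

lemma Phi_sfs: "\<eta> \<in> topspace E \<Longrightarrow> Phi L C M m \<eta> \<in> sfs_measures L C M m \<pi>"
  by (rule Phi_limit, assumption) (rule limit_measure_sfs)

lemma Phi_inst_x:
  "\<eta> \<in> topspace E \<Longrightarrow> \<phi> \<in> Fm L {} \<Longrightarrow>
    Phi L C M m \<eta> (inst_x n \<phi>) = \<eta> (dirac L M (tp L C M n)) (inst_y m \<phi>)"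
  by (rule Phi_limit, assumption) blast

lemma Phi_Psi:
  assumes \<mu>: "\<mu> \<in> sfs_measures L C M m \<pi>" shows "Phi L C M m (Psi L C M m \<mu>) = \<mu>"
proof -
  obtain U where U: "U \<noteq> bot" "eventually (\<lambda>r. r \<in> conv G) U"
    and lim: "\<And>\<theta>. \<theta> \<in> Fm L UNIV \<Longrightarrow> ((\<lambda>r. conv_mu r \<theta>) \<longlongrightarrow> \<mu> \<theta>) U"
    using sfs_filter[OF \<mu>] by blast
  show ?thesis
  proof (rule Phi_eqI)
    show "\<mu> \<in> extensional (Fm L UNIV)" by (rule keislerD(1)[OF sfsD(1)[OF \<mu>]])
    fix n and \<phi> :: "('f, 'r, 'i + 'i, 'c) pfm" assume \<phi>: "\<phi> \<in> Fm L {}"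
    have y: "inst_y m \<phi> \<in> Fm L M" using \<phi> Fm_mono[of "{}" M] rm by (intro inst_y_Fm) auto
    have x: "inst_x n \<phi> \<in> Fm L UNIV" using \<phi> by (intro inst_x_Fm) (simp add: Fm_def)
    have "eventually (\<lambda>r. conv_act L M r (dirac L M (tp L C M n)) (inst_y m \<phi>) = conv_mu r (inst_x n \<phi>)) U"
      using U(2) by (rule eventually_mono) (rule conv_act_dirac[OF _ \<phi>])
    with Psi_limit(3)[OF U lim dirac_keisler y]
    have "((\<lambda>r. conv_mu r (inst_x n \<phi>)) \<longlongrightarrow> Psi L C M m \<mu> (dirac L M (tp L C M n)) (inst_y m \<phi>)) U"
      by (rule Lim_transform_eventually)
    then show "\<mu> (inst_x n \<phi>) = Psi L C M m \<mu> (dirac L M (tp L C M n)) (inst_y m \<phi>)"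
      using tendsto_unique[OF U(1) lim[OF x]] by blast
  qed
qed

lemma Psi_sfs:
  assumes \<mu>: "\<mu> \<in> sfs_measures L C M m \<pi>"
  shows "borel_definable L C M \<mu>" "Psi L C M m \<mu> \<in> topspace E"
    "\<nu> \<in> K \<Longrightarrow> \<phi> \<in> Fm L {} \<Longrightarrow> Psi L C M m \<mu> \<nu> (inst_y m \<phi>) = morley L C M \<mu> \<nu> \<phi>"
proof -
  obtain U where U: "U \<noteq> bot" "eventually (\<lambda>r. r \<in> conv G) U"
    and lim: "\<And>\<theta>. \<theta> \<in> Fm L UNIV \<Longrightarrow> ((\<lambda>r. conv_mu r \<theta>) \<longlongrightarrow> \<mu> \<theta>) U"
    using sfs_filter[OF \<mu>] by blast
  show "borel_definable L C M \<mu>" by (rule limit_measure_borel_definable[OF U lim])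
  show "Psi L C M m \<mu> \<in> topspace E" by (rule Psi_E[OF U lim])
  show "\<nu> \<in> K \<Longrightarrow> \<phi> \<in> Fm L {} \<Longrightarrow> Psi L C M m \<mu> \<nu> (inst_y m \<phi>) = morley L C M \<mu> \<nu> \<phi>"
    by (rule Psi_limit(2)[OF U lim])
qed

abbreviation SFS where "SFS \<equiv> sfs_space L C M m \<pi>"

lemma topspace_SFS: "topspace SFS = sfs_measures L C M m \<pi>"
  using sfsD(1) by (auto simp: sfs_space_def)

lemma compact_E: "compact_space E"
proof -
  have "compact_space PT" by (simp add: compact_space_product_topology compact_keisler_space)
  then have "compactin PT (PT closure_of ((\<lambda>r. restrict (conv_act L M r) K) ` conv G))"
    by (intro closedin_compact_space) auto
  then show ?thesis
    unfolding E_conv_def ellis_space_def ellis_def by (simp add: compact_space_subtopology G_def)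
qed

lemma continuous_Phi: "continuous_map E SFS (Phi L C M m)"
proof -
  let ?P = "product_topology (\<lambda>_. euclideanreal) (Fm L UNIV :: ('f, 'r, 'i, 'c) pfm set)"
  have "continuous_map E ?P (Phi L C M m)"
    unfolding continuous_map_componentwise
  proof (intro conjI ballI)
    show "Phi L C M m ` topspace E \<subseteq> extensional (Fm L UNIV)"
      using keislerD(1)[OF sfsD(1)[OF Phi_sfs]] by blast
    fix \<theta> :: "('f, 'r, 'i, 'c) pfm" assume "\<theta> \<in> Fm L UNIV"
    then obtain n \<phi> where \<phi>: "\<phi> \<in> Fm L {}" "\<theta> = inst_x n \<phi>" by (rule inst_x_surj)
    \<comment> \<open>For fixed \<open>n\<close> and \<phi>, the coordinate of \<open>Phi\<close> is
      a projection to one Dirac measure followed by one to a formula.\<close>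
    let ?d = "dirac L M (tp L C M n)"
    have "inst_y m \<phi> \<in> Fm L M" using \<phi>(1) Fm_mono[of "{}" M] rm by (intro inst_y_Fm) auto
    then have "continuous_map (keisler_space L C M) euclideanreal (\<lambda>\<nu>. \<nu> (inst_y m \<phi>))"
      by (rule continuous_map_keisler_eval)
    moreover have "continuous_map E (keisler_space L C M) (\<lambda>\<eta>. \<eta> ?d)"
      unfolding E_conv_def ellis_space_def topspace_keisler_space
      by (intro continuous_map_from_subtopology continuous_map_product_projection dirac_keisler)
    ultimately have "continuous_map E euclideanreal ((\<lambda>\<nu>. \<nu> (inst_y m \<phi>)) \<circ> (\<lambda>\<eta>. \<eta> ?d))"
      by (rule continuous_map_compose[rotated])
    then show "continuous_map E euclideanreal (\<lambda>\<eta>. Phi L C M m \<eta> \<theta>)"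
      by (rule continuous_map_eq) (simp add: \<phi> Phi_inst_x)
  qed
  then show ?thesis
    unfolding sfs_space_def keisler_space_def continuous_map_in_subtopology
    using Phi_sfs sfsD(1) by blast
qed

theorem homeomorphic_Phi: "homeomorphic_map E SFS (Phi L C M m)"
proof (rule continuous_imp_homeomorphic_map[OF continuous_Phi compact_E])
  show "Hausdorff_space SFS"
    unfolding sfs_space_def by (intro Hausdorff_space_subtopology Hausdorff_keisler_space)
  show "Phi L C M m ` topspace E = topspace SFS"
    unfolding topspace_SFS
  proof (intro subset_antisym subsetI)
    fix \<mu> assume "\<mu> \<in> Phi L C M m ` topspace E"
    then show "\<mu> \<in> sfs_measures L C M m \<pi>" using Phi_sfs by blast
  next
    fix \<mu> assume "\<mu> \<in> sfs_measures L C M m \<pi>"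
    then show "\<mu> \<in> Phi L C M m ` topspace E"
      using Psi_sfs(2)[of \<mu>] Phi_Psi[of \<mu>] by (intro image_eqI[of _ _ "Psi L C M m \<mu>"]) simp_all
  qed
  show "inj_on (Phi L C M m) (topspace E)"
    by (rule inj_on_inverseI[of _ "Psi L C M m"]) (rule Psi_Phi)
qed

text \<open>No continuity of \<open>Psi\<close> is checked: it agrees on the whole space with the
  inverse of the homeomorphism \<open>Phi\<close>.\<close>

theorem homeomorphic_Psi: "homeomorphic_map SFS E (Psi L C M m)"
proof -
  obtain g where g: "homeomorphic_maps E SFS (Phi L C M m) g"
    using homeomorphic_Phi unfolding homeomorphic_map_maps by blast
  have "g \<mu> = Psi L C M m \<mu>" if "\<mu> \<in> topspace SFS" for \<mu>
  proof -
    have "\<mu> \<in> sfs_measures L C M m \<pi>" using that by (simp add: topspace_SFS)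
    then show ?thesis
      using g Psi_sfs(2)[of \<mu>] Phi_Psi[of \<mu>] unfolding homeomorphic_maps_def by metis
  qed
  moreover have "homeomorphic_map SFS E g"
    using g homeomorphic_maps_map homeomorphic_maps_sym by blast
  ultimately show ?thesis using homeomorphic_map_eq by blast
qed

end

theorem theorem4p9:
  fixes L :: "('f, 'r) lang"
    and T :: "('f, 'r, nat, 'c) pfm set"
    and C :: "('f, 'r, 'c) struct"
    and \<kappa> :: "'k rel"
    and M :: "'c set"
    and m :: "'i \<Rightarrow> 'c"
    and \<pi> :: "('f, 'r, 'i + 'i, 'c) pfm set"
  assumes "complete_theory L T"
    and "models C T"
    and "monster L C \<kappa>"
    and "NIP L C"
    and "elementary_substructure L C M"
    and "range m = M"
    and "|UNIV :: 'i set| <o \<kappa>"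
    and "\<pi> \<subseteq> Fm L {}"
    and "group_like L C M m \<pi>"
  shows "(\<forall>\<eta>\<in>topspace (E_conv L C M m \<pi>).
            Phi L C M m \<eta> \<in> sfs_measures L C M m \<pi> \<and>
            (\<forall>n. \<forall>\<phi>\<in>Fm L {}.
               Phi L C M m \<eta> (inst_x n \<phi>) = \<eta> (dirac L M (tp L C M n)) (inst_y m \<phi>))) \<and>
         (\<forall>\<mu>\<in>sfs_measures L C M m \<pi>.
            borel_definable L C M \<mu> \<and>
            Psi L C M m \<mu> \<in> topspace (E_conv L C M m \<pi>) \<and>
            (\<forall>\<nu>\<in>keisler L C M. \<forall>\<phi>\<in>Fm L {}.
               Psi L C M m \<mu> \<nu> (inst_y m \<phi>) = morley L C M \<mu> \<nu> \<phi>)) \<and>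
         (\<forall>\<mu>\<in>sfs_measures L C M m \<pi>. Phi L C M m (Psi L C M m \<mu>) = \<mu>) \<and>
         (\<forall>\<eta>\<in>topspace (E_conv L C M m \<pi>). Psi L C M m (Phi L C M m \<eta>) = \<eta>) \<and>
         homeomorphic_map (E_conv L C M m \<pi>) (sfs_space L C M m \<pi>) (Phi L C M m) \<and>
         homeomorphic_map (sfs_space L C M m \<pi>) (E_conv L C M m \<pi>) (Psi L C M m)"
proof -
  interpret pi_setup L C \<kappa> M m \<pi> by unfold_locales fact+
  show ?thesis
    using Phi_sfs Phi_inst_x Psi_sfs Phi_Psi Psi_Phi homeomorphic_Phi homeomorphic_Psi by (intro conjI ballI allI) auto
qed

end
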